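(* Let $d \geq 1$ and $K \geq 1$ be integers, and let $(X,Y)$ be a random variable with values in $[0,1]^d \times \{0,1\}$ whose conditional probability function $\eta : [0,1]^d \to [0,1]$, $\eta(x) = \mathbb P(Y=1 \mid X=x)$, is Lipschitz on $[0,1]^d$. Let $(\lambda_n)_{n\geq 1}$ be an increasing sequence of positive reals with $\lambda_n \asymp n^{1/(d+2)}$, i.e. there are constants $0 < c \leq C < \infty$ with $c\, n^{1/(d+2)} \leq \lambda_n \leq C\, n^{1/(d+2)}$ for all $n \ge 1$. Let $\widehat \eta_n$ be the Mondrian Forest estimate of $\eta$ with $K$ trees and lifetime sequence $(\lambda_n)$. Then, for $n$ large enough, the following upper bound holds: $$\mathbb E\big[ (\eta(X) - \widehat\eta_n(X))^2 \big] = O\big(n^{-2/(d+2)}\big),$$ and this rate $n^{-2/(d+2)}$ is the minimax rate over the set of Lipschitz functions.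
   Context: Mondrian process. For a box $C = \prod_{j=1}^d [a_j,b_j]$, write $|C| = \sum_{j=1}^d (b_j-a_j)$. For $\lambda > 0$, $\mathrm{MP}(\lambda, C)$ is the distribution of the random tree partition of $C$ produced by calling $\mathrm{SplitCell}(C,0,\lambda)$, where $\mathrm{SplitCell}(A,\tau,\lambda)$, for a cell $A$ with sides $[a_j,b_j]$, is defined recursively: draw an exponential variable $E_A$ with rate $|A|$ (independent of everything else). If $\tau + E_A \leq \lambda$, draw a split dimension $J \in \{1,\dots,d\}$ with $\mathbb P(J=j) = (b_j-a_j)/|A|$ and a threshold $\nu$ uniform on $[a_J,b_J]$, split $A$ into $\{x \in A : x_J \leq \nu\}$ and $\{x \in A : x_J > \nu\}$, and call $\mathrm{SplitCell}(\cdot, \tau + E_A, \lambda)$ on both children (with fresh independent randomness). Otherwise do nothing, so $A$ is a leaf cell. The leaf cells form the partition. Data. $(X_1,Y_1), (X_2,Y_2),\dots$ are i.i.d. copies of $(X,Y)$, independent of $(X,Y)$. Mondrian Forest estimate. $K$ i.i.d. trees are grown, independently of the data and of $(X,Y)$. At time $n$, the $k$-th tree is a partition $M^{(k)}_{\lambda_n} \sim \mathrm{MP}(\lambda_n,[0,1]^d)$ (obtained from $M^{(k)}_{\lambda_{n-1}}$ by continuing to split its leaves from time $\lambda_{n-1}$ to time $\lambda_n$, with $\lambda_0=0$). The $k$-th tree estimate $\widehat\eta_n^{(k)}(x)$ is the proportion of labels equal to $1$ among the $Y_i$, $1 \le i\le n$, such that $X_i$ lies in the leaf cell of $M^{(k)}_{\lambda_n}$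 containing $x$ (and $0$ if there is no such $X_i$). The forest estimate is the average $\widehat\eta_n(x) = \frac1K \sum_{k=1}^K \widehat\eta_n^{(k)}(x)$. The expectation is over $X$, the training data and the random partitions. Minimax rate. This is meant in the usual sense of nonparametric estimation: the optimal order in $n$ of the worst-case quadratic risk $\mathbb E[(\eta(X)-\widetilde\eta_n(X))^2]$ over Lipschitz functions $\eta$, when $\widetilde\eta_n$ ranges over all estimators based on $n$ i.i.d. observations. *)

theory Defs
  imports "HOL-Probability.Probability" "HOL-Library.Landau_Symbols"
begin

section \<open>The Mondrian process\<close>

text \<open>
  The pair \<open>(a, b)\<close> stands for the cell with sides \<open>[a\<^sub>j, b\<^sub>j]\<close>. Which faces belong to the cell is
  irrelevant for the law of the splits and is only recorded by \<open>leaf_cell\<close> below.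
\<close>

type_synonym 'd box = "(real ^ 'd) \<times> (real ^ 'd)"

text \<open>
  The length of \<open>[a\<^sub>j, b\<^sub>j]\<close> is \<open>b\<^sub>j - a\<^sub>j\<close> if \<open>a\<^sub>j \<le> b\<^sub>j\<close>. Reading it as \<open>0\<close> otherwise affects no cell
  that can occur; it keeps the kernels below sub-probability kernels on all parameters.
\<close>

definition side :: "'d::finite box \<Rightarrow> 'd \<Rightarrow> real" where
  "side A j = measure lborel {fst A $ j .. snd A $ j}"

definition lin_dim :: "'d::finite box \<Rightarrow> real" where
  "lin_dim A = (\<Sum>j\<in>UNIV. side A j)"

definition lower_box :: "'d::finite box \<Rightarrow> 'd \<Rightarrow> real \<Rightarrow> 'd box" where
  "lower_box A j \<nu> = (fst A, \<chi> i. if i = j then \<nu> else snd A $ i)"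

definition upper_box :: "'d::finite box \<Rightarrow> 'd \<Rightarrow> real \<Rightarrow> 'd box" where
  "upper_box A j \<nu> = (\<chi> i. if i = j then \<nu> else fst A $ i, snd A)"

definition split_time :: "'d::finite box \<Rightarrow> real measure" where
  "split_time A = density lborel (\<lambda>t. ennreal (exponential_density (lin_dim A) t))"

definition split_dimension :: "'d::finite box \<Rightarrow> 'd measure" where
  "split_dimension A = point_measure UNIV (\<lambda>j. ennreal (side A j / lin_dim A))"

definition split_threshold :: "'d::finite box \<Rightarrow> 'd \<Rightarrow> real measure" where
  "split_threshold A j = uniform_measure lborel {fst A $ j .. snd A $ j}"

text \<open>Inner nodes of a tree partition carry the split dimension and the threshold.\<close>

type_synonym 'd mtree = "('d \<times> real) tree"

definition mtree_space :: "'d::finite mtree measure" where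
  "mtree_space = tree_sigma (count_space UNIV \<Otimes>\<^sub>M borel)"

text \<open>
  \<open>split_cell m A \<tau> l\<close> is the sub-probability law of the outcome of \<open>SplitCell(A, \<tau>, l)\<close>, restricted
  to the executions whose recursion depth is less than \<open>m\<close>. A cell of linear dimension \<open>0\<close>
  (exponential variable of rate \<open>0\<close>, i.e. infinite) is never split.
\<close>

primrec split_cell :: "nat \<Rightarrow> 'd::finite box \<Rightarrow> real \<Rightarrow> real \<Rightarrow> 'd mtree measure" where
  "split_cell 0 A \<tau> l = null_measure mtree_space"
| "split_cell (Suc m) A \<tau> l =
     (if lin_dim A = 0 then return mtree_space Leaf
      else do {
        e \<leftarrow> split_time A;
        if \<tau> + e \<le> l then do {
          j \<leftarrow> split_dimension A;
          \<nu> \<leftarrow> split_threshold A j;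
          lt \<leftarrow> split_cell m (lower_box A j \<nu>) (\<tau> + e) l;
          rt \<leftarrow> split_cell m (upper_box A j \<nu>) (\<tau> + e) l;
          return mtree_space (Node lt (j, \<nu>) rt)
        } else return mtree_space Leaf
      })"

text \<open>
  These laws increase with \<open>m\<close>; their supremum, taken in the complete lattice of measures, is the
  law of the outcome of the unbounded recursion (which stops almost surely).
\<close>

definition split_cell_law :: "'d::finite box \<Rightarrow> real \<Rightarrow> real \<Rightarrow> 'd mtree measure" where
  "split_cell_law A \<tau> l = (SUP m. split_cell m A \<tau> l)"

definition MP :: "real \<Rightarrow> 'd::finite box \<Rightarrow> 'd mtree measure" where
  "MP l C = split_cell_law C 0 l"

text \<open>
  \<open>continue_splitting \<sigma> l t A\<close>: law of the tree obtained from a tree partition \<open>t\<close> of \<open>A\<close>, grown up to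
  time \<open>\<sigma>\<close>, by splitting its leaves further from time \<open>\<sigma>\<close> to time \<open>l\<close>.
\<close>

primrec continue_splitting :: "real \<Rightarrow> real \<Rightarrow> 'd mtree \<Rightarrow> 'd::finite box \<Rightarrow> 'd mtree measure" where
  "continue_splitting \<sigma> l Leaf A = split_cell_law A \<sigma> l"
| "continue_splitting \<sigma> l (Node lt s rt) A =
     do {
       lt' \<leftarrow> continue_splitting \<sigma> l lt (lower_box A (fst s) (snd s));
       rt' \<leftarrow> continue_splitting \<sigma> l rt (upper_box A (fst s) (snd s));
       return mtree_space (Node lt' s rt')
     }"

text \<open>
  A random tree grown along the lifetimes \<open>lam 1, lam 2, \<dots>\<close>: \<open>T n\<close> is a \<open>MP (lam n) [0,1]\<^sup>d\<close> partition,
  and, given \<open>T 0, \<dots>, T n\<close>, the next tree is obtained by continuing to split the leaves of \<open>T n\<close>.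
\<close>

definition mondrian_tree_process ::
    "'w measure \<Rightarrow> (nat \<Rightarrow> real) \<Rightarrow> (nat \<Rightarrow> 'w \<Rightarrow> 'd::finite mtree) \<Rightarrow> bool" where
  "mondrian_tree_process M lam T \<longleftrightarrow>
     (\<forall>n. T n \<in> M \<rightarrow>\<^sub>M mtree_space) \<and>
     (\<forall>\<omega>\<in>space M. T 0 \<omega> = Leaf) \<and>
     (\<forall>n\<ge>1. distr M mtree_space (T n) = MP (lam n) (0, 1)) \<and>
     (\<forall>n. let past = (\<lambda>\<omega>. \<lambda>m\<in>{..n}. T m \<omega>); H = PiM {..n} (\<lambda>_. mtree_space) in
        distr M (H \<Otimes>\<^sub>M mtree_space) (\<lambda>\<omega>. (past \<omega>, T (Suc n) \<omega>)) =
        do {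
          h \<leftarrow> distr M H past;
          t \<leftarrow> continue_splitting (lam n) (lam (Suc n)) (h n) (0, 1);
          return (H \<Otimes>\<^sub>M mtree_space) (h, t)
        })"


section \<open>The Mondrian Forest estimate\<close>

text \<open>The cell containing \<open>x\<close> in the partition of \<open>A\<close> described by a tree.\<close>

primrec leaf_cell :: "'d mtree \<Rightarrow> (real ^ 'd::finite) set \<Rightarrow> real ^ 'd \<Rightarrow> (real ^ 'd) set" where
  "leaf_cell Leaf A x = A"
| "leaf_cell (Node lt s rt) A x =
     (if x $ fst s \<le> snd s then leaf_cell lt {y \<in> A. y $ fst s \<le> snd s} x
      else leaf_cell rt {y \<in> A. y $ fst s > snd s} x)"

definition tree_estimate ::
    "(nat \<Rightarrow> (real ^ 'd::finite) \<times> real) \<Rightarrow> nat \<Rightarrow> 'd mtree \<Rightarrow> real ^ 'd \<Rightarrow> real" where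
  "tree_estimate D n t x =
     (let N = {i \<in> {1..n}. fst (D i) \<in> leaf_cell t (cbox 0 1) x}
      in if N = {} then 0 else real (card {i \<in> N. snd (D i) = 1}) / real (card N))"

definition forest_estimate ::
    "(nat \<Rightarrow> (real ^ 'd::finite) \<times> real) \<Rightarrow> nat \<Rightarrow> nat \<Rightarrow> (nat \<Rightarrow> 'd mtree) \<Rightarrow> real ^ 'd \<Rightarrow> real" where
  "forest_estimate D n K t x = (1 / real K) * (\<Sum>k=1..K. tree_estimate D n (t k) x)"


section \<open>The regression model\<close>

definition obs_space :: "((real ^ 'd::finite) \<times> real) measure" where
  "obs_space = restrict_space borel (cbox 0 1 \<times> {0, 1})"

definition cond_prob_function ::
    "'w measure \<Rightarrow> ('w \<Rightarrow> real ^ 'd::finite) \<Rightarrow> ('w \<Rightarrow> real) \<Rightarrow> (real ^ 'd \<Rightarrow> real) \<Rightarrow> bool" where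
  "cond_prob_function M X Y \<eta> \<longleftrightarrow>
     \<eta> ` cbox 0 1 \<subseteq> {0..1} \<and>
     (AE \<omega> in M. real_cond_exp M (vimage_algebra (space M) X borel)
                   (indicator {\<omega> \<in> space M. Y \<omega> = 1}) \<omega> = \<eta> (X \<omega>))"

text \<open>Names for the sources of randomness, to express that they are all mutually independent.\<close>

datatype source = Generic | Sample nat | Tree nat

definition mutually_independent ::
    "'w measure \<Rightarrow> ('w \<Rightarrow> (real ^ 'd::finite) \<times> real) \<Rightarrow> (nat \<Rightarrow> 'w \<Rightarrow> (real ^ 'd) \<times> real) \<Rightarrow>
     nat \<Rightarrow> (nat \<Rightarrow> nat \<Rightarrow> 'w \<Rightarrow> 'd mtree) \<Rightarrow> bool" where
  "mutually_independent M Z D K T \<longleftrightarrow>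
     prob_space.indep_sets M
       (\<lambda>s. case s of
          Generic \<Rightarrow> sets (vimage_algebra (space M) Z obs_space)
        | Sample i \<Rightarrow> sets (vimage_algebra (space M) (D i) obs_space)
        | Tree k \<Rightarrow> sets (vimage_algebra (space M) (\<lambda>\<omega> n. T k n \<omega>) (PiM UNIV (\<lambda>_. mtree_space))))
       ({Generic} \<union> Sample ` {1..} \<union> Tree ` {1..K})"


section \<open>Minimax risk\<close>

text \<open>
  Laws of \<open>(X, Y)\<close> with an \<open>L\<close>-Lipschitz conditional probability function. The constant has to be
  fixed: over all Lipschitz functions together the minimax risk does not tend to \<open>0\<close>.
  The law of \<open>X\<close> ranges over all laws on the cube.
\<close>

definition lipschitz_class ::
    "real \<Rightarrow> (((real ^ 'd::finite) \<times> real) measure \<times> (real ^ 'd \<Rightarrow> real)) set" where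
  "lipschitz_class L =
     {(P, \<eta>). prob_space P \<and> sets P = sets obs_space \<and> cond_prob_function P fst snd \<eta> \<and>
              L-lipschitz_on (cbox 0 1) \<eta>}"

definition estimators ::
    "nat \<Rightarrow> ((nat \<Rightarrow> (real ^ 'd::finite) \<times> real) \<Rightarrow> real ^ 'd \<Rightarrow> real) set" where
  "estimators n =
     {f. case_prod f \<in> PiM {1..n} (\<lambda>_. obs_space) \<Otimes>\<^sub>M restrict_space borel (cbox 0 1) \<rightarrow>\<^sub>M borel}"

definition quadratic_risk ::
    "nat \<Rightarrow> ((nat \<Rightarrow> (real ^ 'd::finite) \<times> real) \<Rightarrow> real ^ 'd \<Rightarrow> real) \<Rightarrow>
     ((real ^ 'd) \<times> real) measure \<Rightarrow> (real ^ 'd \<Rightarrow> real) \<Rightarrow> ennreal" where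
  "quadratic_risk n f P \<eta> =
     (\<integral>\<^sup>+ D. \<integral>\<^sup>+ z. ennreal ((\<eta> (fst z) - f D (fst z))\<^sup>2) \<partial>P \<partial>PiM {1..n} (\<lambda>_. P))"

definition minimax_risk :: "'d::finite itself \<Rightarrow> real \<Rightarrow> nat \<Rightarrow> ennreal" where
  "minimax_risk _ L n =
     (INF f\<in>(estimators n :: ((nat \<Rightarrow> (real ^ 'd) \<times> real) \<Rightarrow> real ^ 'd \<Rightarrow> real) set).
        SUP (P, \<eta>)\<in>lipschitz_class L. quadratic_risk n f P \<eta>)"

end

theory Submission
  imports Defs "HOL-Real_Asymp.Real_Asymp"
begin

text \<open>
  Upper bound. If a supersolution of the backward equation of the splitting dynamics dominates a
  cell functional at time \<open>0\<close>, it dominates the expected sum of the functional over the leaves; since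
  this passes to the supremum of the truncated laws, no termination argument is needed. With
  \<open>\<Prod>\<^sub>j (1 + \<lambda> a\<^sub>j)\<close> it gives at most \<open>(1 + \<lambda>)\<^sup>d\<close> expected leaves, and with a rational function of the
  distances to the faces an expected squared cell diameter of order \<open>d / \<lambda>\<^sup>2\<close> around every point. For a
  fixed partition the variance is at most \<open>4 / n\<close> per cell, so the risk is of order
  \<open>(1 + \<lambda>)\<^sup>d / n + 1 / \<lambda>\<^sup>2\<close>. Convexity handles forests, and also the estimator that averages a tree over
  its law, which bounds the minimax risk from above.

  Lower bound. Assouad's method on laws of \<open>X\<close> uniform on a grid of mesh \<open>1 / m\<close> with
  \<open>m \<approx> n powr (1 / (d + 2))\<close>, where \<open>\<eta>\<close> takes the values \<open>1 / 2\<close> and \<open>1 / 2 + L / m\<close>; neighbouring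
  hypotheses are compared through the second moment of their likelihood ratio.
\<close>

section \<open>Measurability of the splitting kernels\<close>

text \<open>Conditioning on the first cut of a box A gives the backward equation. The rate |A| of
  the clock, the probability of direction j and the density of the threshold multiply to 1, so cuts
  arrive with Lebesgue intensity in time and position. If F(A, s) is the expected leaf sum with time
  s left, then F' = -|A| F + S, where S sums over j the integral of F(lower) + F(upper) over the
  j-th side. A function with F' at least the right-hand side and F(A, 0) at least the weight is an
  upper bound, also for laws that lose mass through truncation. In a cell of mass p the variance is
  of order 1 / (n p); integrating 1 / p over the law of X counts the cells of positive mass,
  whatever that law is. The lifetime n powr (1 / (d + 2)) makes \<lambda>^d / n and 1 / \<lambda>^2
  equal in order. For the lower bound, each grid point receives about n / m^d, that is about m^2,
  observations; this is too few to tell success probabilities that differ by L / m apart with error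
  tending to 0.\<close>

lemma borel_measurable_vec_lambda:
  fixes f :: "'a \<Rightarrow> 'd::finite \<Rightarrow> real"
  assumes "\<And>i. (\<lambda>x. f x i) \<in> borel_measurable M"
  shows "(\<lambda>x. \<chi> i. f x i) \<in> borel_measurable M"
  unfolding borel_measurable_euclidean_space[of "\<lambda>x. \<chi> i. f x i"]
  using assms by (auto simp: Basis_vec_def inner_axis)

lemma borel_measurable_vec_nth [measurable (raw)]:
  fixes f :: "'a \<Rightarrow> real ^ 'd"
  assumes "f \<in> borel_measurable M"
  shows "(\<lambda>x. f x $ i) \<in> borel_measurable M"
  by (rule borel_measurable_continuous_on[OF _ assms]) (intro continuous_intros)

lemma borel_measurable_fst_snd [measurable (raw)]:
  fixes f :: "'a \<Rightarrow> 'b::topological_space \<times> 'c::topological_space"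
  assumes "f \<in> borel_measurable M"
  shows "(\<lambda>x. fst (f x)) \<in> borel_measurable M" "(\<lambda>x. snd (f x)) \<in> borel_measurable M"
  by (rule borel_measurable_continuous_on[OF _ assms], intro continuous_intros)+

lemma measurable_lower_box [measurable (raw)]:
  assumes [measurable]: "A \<in> borel_measurable M" "\<nu> \<in> borel_measurable M"
  shows "(\<lambda>x. lower_box (A x) j (\<nu> x)) \<in> borel_measurable M"
  unfolding lower_box_def
  by (intro borel_measurable_Pair borel_measurable_vec_lambda) (auto intro!: measurable_If)

lemma measurable_upper_box [measurable (raw)]:
  assumes [measurable]: "A \<in> borel_measurable M" "\<nu> \<in> borel_measurable M"
  shows "(\<lambda>x. upper_box (A x) j (\<nu> x)) \<in> borel_measurable M"
  unfolding upper_box_def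
  by (intro borel_measurable_Pair borel_measurable_vec_lambda) (auto intro!: measurable_If)

lemma side_eq: "side A j = max 0 (snd A $ j - fst A $ j)"
  by (simp add: side_def)

lemma measurable_side [measurable]: "(\<lambda>A. side A j) \<in> borel_measurable borel"
  unfolding side_eq by measurable

lemma measurable_lin_dim [measurable]: "lin_dim \<in> borel_measurable borel"
  unfolding lin_dim_def by measurable

lemma side_nonneg [simp]: "0 \<le> side A j"
  by (simp add: side_eq)

lemma lin_dim_nonneg [simp]: "0 \<le> lin_dim A"
  by (simp add: lin_dim_def sum_nonneg)

text \<open>Rate 0 gives the zero density and so the null measure; this degenerate value keeps the
  family a sub-probability kernel on every box, as the monadic binds require.\<close>

lemma measurable_split_time [measurable]:
  "(split_time :: 'd::finite box \<Rightarrow> real measure) \<in> borel \<rightarrow>\<^sub>M subprob_algebra borel"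
proof (rule measurable_subprob_algebra)
  fix A :: "'d box"
  show "subprob_space (split_time A)"
  proof (cases "lin_dim A = 0")
    case True
    then have "exponential_density (lin_dim A) t = 0" for t
      by (simp add: exponential_density_def)
    then have "split_time A = null_measure lborel"
      by (intro measure_eqI) (simp_all add: split_time_def emeasure_density)
    then show ?thesis by (simp add: subprob_space_null_measure)
  next
    case False
    then show ?thesis
      unfolding split_time_def
      by (intro prob_space_imp_subprob_space prob_space_exponential_density)
        (simp add: less_le)
  qed
next
  fix B :: "real set" assume [measurable]: "B \<in> sets borel"
  show "(\<lambda>A. emeasure (split_time A) B) \<in> borel_measurable borel"
    unfolding split_time_def exponential_density_def erlang_density_def
    by (simp add: emeasure_density)
qed (simp add: split_time_def)

lemma measurable_split_dimension [measurable]: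
  "(split_dimension :: 'd::finite box \<Rightarrow> 'd measure) \<in> borel \<rightarrow>\<^sub>M subprob_algebra (count_space UNIV)"
proof (rule measurable_subprob_algebra)
  fix A :: "'d box"
  show "subprob_space (split_dimension A)"
  proof (rule subprob_spaceI)
    have "(\<Sum>j\<in>UNIV. side A j / lin_dim A) \<le> 1"
      by (simp add: sum_divide_distrib[symmetric] lin_dim_def[symmetric])
    then show "emeasure (split_dimension A) (space (split_dimension A)) \<le> 1"
      by (simp add: split_dimension_def space_point_measure emeasure_point_measure_finite ennreal_le_1)
  qed (simp add: split_dimension_def space_point_measure)
next
  fix B :: "'d set"
  show "(\<lambda>A. emeasure (split_dimension A) B) \<in> borel_measurable borel"
    by (simp add: split_dimension_def emeasure_point_measure_finite)
qed (simp add: split_dimension_def sets_point_measure)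

lemma measurable_split_threshold [measurable]:
  fixes j :: "'d::finite"
  shows   "(\<lambda>A. split_threshold A j) \<in> borel \<rightarrow>\<^sub>M subprob_algebra borel"
proof (rule measurable_subprob_algebra)
  fix A :: "'d box"
  let ?I = "{fst A $ j .. snd A $ j}"
  show "subprob_space (split_threshold A j)"
  proof (cases "emeasure lborel ?I = 0")
    \<comment> \<open>On an interval of measure 0 the uniform density is infinite at most on a null
      set and 0 elsewhere, so the measure is null.\<close>
    case True
    then have "split_threshold A j = null_measure lborel"
      by (intro measure_eqI)
       (auto simp: split_threshold_def intro!: emeasure_eq_0[of ?I])
    then show ?thesis by (simp add: subprob_space_null_measure)
  next
    case False
    then show ?thesis
      unfolding split_threshold_def
      by (intro prob_space_imp_subprob_space prob_space_uniform_measure)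
        (auto simp: emeasure_lborel_Icc_eq)
  qed
next
  fix B :: "real set" assume [measurable]: "B \<in> sets borel"
  have "emeasure (split_threshold A j) B = 
     (\<integral>\<^sup>+\<nu>. (if fst A $ j \<le> \<nu> \<and> \<nu> \<le> snd A $ j \<and> \<nu> \<in> B then 1 else 0) \<partial>lborel) / ennreal (side A j)"
    for A :: "'d box"
  proof -
    have "emeasure (split_threshold A j) B =
        (\<integral>\<^sup>+\<nu>. indicator ({fst A $ j .. snd A $ j} \<inter> B) \<nu> \<partial>lborel) / ennreal (side A j)"
      by (simp add: split_threshold_def side_eq emeasure_lborel_Icc_eq max_def)
    also have "(\<integral>\<^sup>+\<nu>. indicator ({fst A $ j .. snd A $ j} \<inter> B) \<nu> \<partial>lborel) =
        (\<integral>\<^sup>+\<nu>. (if fst A $ j \<le> \<nu> \<and> \<nu> \<le> snd A $ j \<and> \<nu> \<in> B then 1 else 0) \<partial>lborel)"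
      by (intro nn_integral_cong) (auto split: split_indicator)
    finally show ?thesis .
  qed
  then show "(\<lambda>A. emeasure (split_threshold A j) B) \<in> borel_measurable borel"
    by simp
qed (simp add: split_threshold_def)

lemma sets_split_kernels [simp, measurable_cong]:
  "sets (split_time A) = sets borel" "sets (split_dimension A) = sets (count_space UNIV)"
  "sets (split_threshold A j) = sets borel"
  by (simp_all add: split_time_def split_dimension_def split_threshold_def sets_point_measure)

lemma space_split_kernels [simp]:
  "space (split_time A) = UNIV" "space (split_dimension A) = UNIV"
  "space (split_threshold A j) = UNIV"
  by (simp_all add: split_time_def split_dimension_def split_threshold_def space_point_measure)

lemma space_mtree_space [simp]: "space mtree_space = UNIV"
  by (simp add: mtree_space_def space_tree_sigma space_pair_measure)

lemma measurable_mtree_Node [measurable (raw)]: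
  assumes [measurable]: "f \<in> M \<rightarrow>\<^sub>M mtree_space" "g \<in> M \<rightarrow>\<^sub>M mtree_space" 
    and [measurable]: "\<nu> \<in> borel_measurable M"
  shows "(\<lambda>x. Node (f x) (j, \<nu> x) (g x)) \<in> M \<rightarrow>\<^sub>M mtree_space"
  using assms(1,2) unfolding mtree_space_def by measurable

text \<open>The induction needs joint measurability in the box and the starting time, because the
  recursive calls move both.\<close>

lemma measurable_split_cell:
  "(\<lambda>p :: 'd::finite box \<times> real. split_cell m (fst p) (snd p) l) \<in> borel \<Otimes>\<^sub>M borel \<rightarrow>\<^sub>M subprob_algebra mtree_space"
proof (induction m)
  case 0
  show ?case by (simp add: subprob_space_null_measure space_subprob_algebra)
next
  case (Suc m)
  have IH [measurable]: "(\<lambda>x. split_cell m (A x) (t x) l) \<in> M \<rightarrow>\<^sub>M subprob_algebra mtree_space"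
    if "A \<in> borel_measurable M" "t \<in> borel_measurable M" for A :: "'x \<Rightarrow> 'd box" and t and M :: "'x measure"
    using measurable_compose[OF measurable_Pair[OF that] Suc] by simp
  have [measurable]: "return mtree_space \<in> mtree_space \<rightarrow>\<^sub>M subprob_algebra mtree_space" 
    by (rule return_measurable)
  have [measurable]: "Leaf \<in> space mtree_space" by simp
  have thr: "(\<lambda>x. split_threshold (fst (fst x)) j \<bind> (\<lambda>\<nu>.
           split_cell m (lower_box (fst (fst x)) j \<nu>) (snd (fst x) + snd x) l \<bind> (\<lambda>lt.
           split_cell m (upper_box (fst (fst x)) j \<nu>) (snd (fst x) + snd x) l \<bind> (\<lambda>rt.
           return mtree_space (Node lt (j, \<nu>) rt)))))
     \<in> (borel \<Otimes>\<^sub>M borel) \<Otimes>\<^sub>M borel \<rightarrow>\<^sub>M subprob_algebra mtree_space" for j :: 'd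
    by measurable
  have "(\<lambda>x :: ('d box \<times> real) \<times> real. split_dimension (fst (fst x)) \<bind> (\<lambda>j. split_threshold (fst (fst x)) j \<bind> (\<lambda>\<nu>.
           split_cell m (lower_box (fst (fst x)) j \<nu>) (snd (fst x) + snd x) l \<bind> (\<lambda>lt.
           split_cell m (upper_box (fst (fst x)) j \<nu>) (snd (fst x) + snd x) l \<bind> (\<lambda>rt.
           return mtree_space (Node lt (j, \<nu>) rt))))))
     \<in> (borel \<Otimes>\<^sub>M borel) \<Otimes>\<^sub>M borel \<rightarrow>\<^sub>M subprob_algebra mtree_space"
  \<comment> \<open>The direction takes finitely many values, so it suffices to have measurability
    for each fixed direction.\<close>
  proof (rule measurable_bind'[where N="count_space UNIV"])
    show "(\<lambda>x :: ('d box \<times> real) \<times> real. split_dimension (fst (fst x))) \<in> (borel \<Otimes>\<^sub>M borel) \<Otimes>\<^sub>M borel \<rightarrow>\<^sub>M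
        subprob_algebra (count_space (UNIV :: 'd set))"
      by measurable
  qed (unfold case_prod_unfold, rule measurable_compose_countable'[where g=snd and I=UNIV],
      rule measurable_compose[OF measurable_fst thr], auto intro: countable_finite)
  note [measurable] = this
  show ?case
    by (simp del: return_measurable) measurable
qed

lemma sets_split_cell [simp, measurable_cong]: "sets (split_cell m A \<tau> l) = sets mtree_space"
  using sets_kernel[OF measurable_split_cell, of "(A, \<tau>)" m l] by (simp add: space_pair_measure)

lemma space_split_cell [simp]: "space (split_cell m A \<tau> l) = UNIV"
  using sets_eq_imp_space_eq[OF sets_split_cell, of m A \<tau> l] by simp

lemma measurable_split_cell' [measurable (raw)]:
  fixes A :: "'x \<Rightarrow> 'd::finite box"
  assumes "A \<in> borel_measurable M" "t \<in> borel_measurable M"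
  shows "(\<lambda>x. split_cell m (A x) (t x) l) \<in> M \<rightarrow>\<^sub>M subprob_algebra mtree_space"
  using measurable_compose[OF measurable_Pair[OF assms] measurable_split_cell] by simp

text \<open>Turns the monadic program into iterated nonnegative integrals over waiting time,
  direction, threshold and the two independent subtrees. The later estimates work in this form,
  where no integrability has to be checked.\<close>

lemma nn_integral_split_cell_Suc:
  fixes A :: "'d::finite box"
  assumes [measurable]: "f \<in> borel_measurable mtree_space"
  shows "(\<integral>\<^sup>+t. f t \<partial>split_cell (Suc m) A \<tau> l) =
    (if lin_dim A = 0 then f Leaf
     else \<integral>\<^sup>+e. (if \<tau> + e \<le> l then
        \<integral>\<^sup>+j. \<integral>\<^sup>+\<nu>. \<integral>\<^sup>+lt. \<integral>\<^sup>+rt. f (Node lt (j, \<nu>) rt)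
          \<partial>split_cell m (upper_box A j \<nu>) (\<tau> + e) l
          \<partial>split_cell m (lower_box A j \<nu>) (\<tau> + e) l \<partial>split_threshold A j \<partial>split_dimension A
        else f Leaf) \<partial>split_time A)"
proof (cases "lin_dim A = 0")
  case False
  have [measurable]: "return mtree_space \<in> mtree_space \<rightarrow>\<^sub>M subprob_algebra mtree_space" 
    by (rule return_measurable)
  have [measurable]: "Leaf \<in> space mtree_space" by simp
  let ?R = "\<lambda>e j \<nu> lt. split_cell m (upper_box A j \<nu>) (\<tau> + e) l \<bind> (\<lambda>rt.
           return mtree_space (Node lt (j, \<nu>) rt))"
  let ?L = "\<lambda>e j \<nu>. split_cell m (lower_box A j \<nu>) (\<tau> + e) l \<bind> ?R e j \<nu>"
  have T [measurable]: "(\<lambda>x. split_threshold A j \<bind> ?L (e x) j) \<in> M \<rightarrow>\<^sub>M subprob_algebra mtree_space"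
    if [measurable]: "e \<in> borel_measurable M" for j e and M :: "'x measure"
    by (rule measurable_bind[where N=borel]; measurable)
      (auto simp: space_subprob_algebra intro!: subprob_space_kernel[OF measurable_split_threshold])
  have J: "(\<lambda>e. split_dimension A \<bind> (\<lambda>j. split_threshold A j \<bind> ?L e j))
      \<in> borel \<rightarrow>\<^sub>M subprob_algebra mtree_space"
  proof (rule measurable_bind'[where N="count_space UNIV"])
    show "(\<lambda>x. split_dimension A) \<in> borel \<rightarrow>\<^sub>M subprob_algebra (count_space UNIV)"
      by (rule measurable_compose[OF _ measurable_split_dimension]) simp
  qed (unfold case_prod_unfold, rule measurable_compose_countable'[where g=snd and I=UNIV],
      rule T, auto intro: countable_finite)
  have R: "(\<integral>\<^sup>+t. f t \<partial>?R e j \<nu> lt) =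
      (\<integral>\<^sup>+rt. f (Node lt (j, \<nu>) rt) \<partial>split_cell m (upper_box A j \<nu>) (\<tau> + e) l)" for e j \<nu> lt
    by (subst nn_integral_bind[where B=mtree_space]) (auto simp: nn_integral_return)
  have L: "(\<integral>\<^sup>+t. f t \<partial>?L e j \<nu>) = (\<integral>\<^sup>+lt. \<integral>\<^sup>+rt. f (Node lt (j, \<nu>) rt)
          \<partial>split_cell m (upper_box A j \<nu>) (\<tau> + e) l
          \<partial>split_cell m (lower_box A j \<nu>) (\<tau> + e) l)" for e j \<nu>
    by (subst nn_integral_bind[where B=mtree_space]) (auto simp: R)
  have T': "(\<integral>\<^sup>+t. f t \<partial>(split_threshold A j \<bind> ?L e j)) =
      (\<integral>\<^sup>+\<nu>. \<integral>\<^sup>+t. f t \<partial>?L e j \<nu> \<partial>split_threshold A j)" for e j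
    by (subst nn_integral_bind[where B=mtree_space]) measurable
  have J': "(\<integral>\<^sup>+t. f t \<partial>(split_dimension A \<bind> (\<lambda>j. split_threshold A j \<bind> ?L e j))) =
      (\<integral>\<^sup>+j. \<integral>\<^sup>+\<nu>. \<integral>\<^sup>+t. f t \<partial>?L e j \<nu> \<partial>split_threshold A j \<partial>split_dimension A)" for e
  proof (subst nn_integral_bind[where B=mtree_space])
    have "(\<lambda>j. split_threshold A j \<bind> ?L e j) \<in> count_space UNIV \<rightarrow>\<^sub>M subprob_algebra mtree_space"
      using measurable_space[OF T[of "\<lambda>_. e" borel]] by auto
    then show "(\<lambda>j. split_threshold A j \<bind> ?L e j) \<in> split_dimension A \<rightarrow>\<^sub>M subprob_algebra mtree_space"
      by (subst measurable_cong_sets[OF sets_split_kernels(2) refl])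
  qed (simp_all add: T')
  have "(\<lambda>e. if \<tau> + e \<le> l then split_dimension A \<bind> (\<lambda>j. split_threshold A j \<bind> ?L e j)
      else return mtree_space Leaf) \<in> split_time A \<rightarrow>\<^sub>M subprob_algebra mtree_space"
    unfolding measurable_cong_sets[OF sets_split_kernels(1) refl]
    by (rule measurable_If[OF J]) (auto simp: subprob_space_return space_subprob_algebra)
  then have "(\<integral>\<^sup>+t. f t \<partial>split_cell (Suc m) A \<tau> l) = (\<integral>\<^sup>+e. \<integral>\<^sup>+t. f t \<partial>
     (if \<tau> + e \<le> l then split_dimension A \<bind> (\<lambda>j. split_threshold A j \<bind> ?L e j)
      else return mtree_space Leaf) \<partial>split_time A)"
    using False by (subst split_cell.simps) (simp add: nn_integral_bind[where B=mtree_space])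
  also have "\<dots> = (\<integral>\<^sup>+e. (if \<tau> + e \<le> l then
        \<integral>\<^sup>+j. \<integral>\<^sup>+\<nu>. \<integral>\<^sup>+lt. \<integral>\<^sup>+rt. f (Node lt (j, \<nu>) rt)
          \<partial>split_cell m (upper_box A j \<nu>) (\<tau> + e) l
          \<partial>split_cell m (lower_box A j \<nu>) (\<tau> + e) l \<partial>split_threshold A j \<partial>split_dimension A
        else f Leaf) \<partial>split_time A)"
    by (intro nn_integral_cong) (simp add: J' L nn_integral_return)
  finally show ?thesis using False by (simp del: split_cell.simps)
qed (simp add: nn_integral_return)

text \<open>The claim concerns all integrands and not just sets: in the induction step the integral
  over the right subtree becomes the integrand for the left one.\<close>

lemma nn_integral_split_cell_mono:
  fixes A :: "'d::finite box"
  assumes "f \<in> borel_measurable mtree_space"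
  shows "(\<integral>\<^sup>+t. f t \<partial>split_cell m A \<tau> l) \<le> (\<integral>\<^sup>+t. f t \<partial>split_cell (Suc m) A \<tau> l)"
  using assms
proof (induction m arbitrary: f A \<tau>)
  case 0
  then show ?case by (simp add: nn_integral_null_measure)
next
  case (Suc m)
  note [measurable] = Suc.prems
  have step: "(\<integral>\<^sup>+lt. \<integral>\<^sup>+rt. f (Node lt (j, \<nu>) rt) \<partial>split_cell m B t l \<partial>split_cell m C t l) \<le>
     (\<integral>\<^sup>+lt. \<integral>\<^sup>+rt. f (Node lt (j, \<nu>) rt) \<partial>split_cell (Suc m) B t l \<partial>split_cell (Suc m) C t l)" 
    for j \<nu> B C t
  proof (rule order_trans[OF Suc.IH nn_integral_mono[OF Suc.IH]])
    show "(\<lambda>lt. \<integral>\<^sup>+ rt. f \<langle>lt, (j, \<nu>), rt\<rangle> \<partial>split_cell m B t l) \<in> borel_measurable mtree_space"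
      by (rule nn_integral_measurable_subprob_algebra2[where N=mtree_space]) measurable
  qed measurable
  show ?case
    unfolding nn_integral_split_cell_Suc[OF Suc.prems]
    by (auto intro!: nn_integral_mono step simp del: split_cell.simps)
qed

section \<open>From the truncated laws to their supremum\<close>

lemma incseq_split_cell: "incseq (\<lambda>m. split_cell m A \<tau> l)"
proof (rule incseq_SucI)
  fix m
  have "emeasure (split_cell m A \<tau> l) B \<le> emeasure (split_cell (Suc m) A \<tau> l) B"
    if "B \<in> sets mtree_space" for B
    using nn_integral_split_cell_mono[of "indicator B" m A \<tau> l] that
    by (simp del: split_cell.simps)
  then show "split_cell m A \<tau> l \<le> split_cell (Suc m) A \<tau> l"
    by (subst le_measure) (simp_all del: split_cell.simps)
qed

text \<open>Along a chain the supremum in the lattice of measures is the setwise supremum, which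
  fails for general families.\<close>

lemma emeasure_split_cell_law:
  assumes "B \<in> sets mtree_space"
  shows "emeasure (split_cell_law A \<tau> l) B = (SUP m. emeasure (split_cell m A \<tau> l) B)"
  unfolding split_cell_law_def
proof (rule emeasure_SUP_chain[where N=mtree_space])
  show "Complete_Partial_Order.chain (\<le>) (range (\<lambda>m. split_cell m A \<tau> l))"
    using incseq_split_cell[of A \<tau> l] by (auto simp: chain_def mono_def) (metis linear)
qed (use assms in auto)

lemma sets_split_cell_law [simp, measurable_cong]: "sets (split_cell_law A \<tau> l) = sets mtree_space"
  unfolding split_cell_law_def by (rule sets_SUP) auto

lemma space_split_cell_law [simp]: "space (split_cell_law A \<tau> l) = UNIV"
  using sets_eq_imp_space_eq[OF sets_split_cell_law, of A \<tau> l] by simp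

lemma sets_MP [simp, measurable_cong]: "sets (MP l C) = sets mtree_space"
  by (simp add: MP_def)

text \<open>A simple function below \<open>f\<close> takes finitely many values, so its integral is
  a finite sum of increasing measures and the supremum over \<open>m\<close> passes through the
  sum.\<close>

lemma nn_integral_split_cell_law_le:
  fixes A :: "'d::finite box"
  assumes [measurable]: "f \<in> borel_measurable mtree_space"
    and le: "\<And>m. (\<integral>\<^sup>+t. f t \<partial>split_cell m A \<tau> l) \<le> b"
  shows "(\<integral>\<^sup>+t. f t \<partial>split_cell_law A \<tau> l) \<le> b"
proof -
  have "integral\<^sup>S (split_cell_law A \<tau> l) g \<le> b"
    if g: "simple_function (split_cell_law A \<tau> l) g" and "g \<le> f" for g
  proof -
    have g': "simple_function (split_cell m A \<tau> l) g" for m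
      using g by (simp add: simple_function_def)
    have S: "g -` {x} \<in> sets mtree_space" for x
      using simple_functionD(2)[OF g, of "{x}"] by simp
    have "integral\<^sup>S (split_cell_law A \<tau> l) g =
        (\<Sum>x\<in>range g. SUP m. x * emeasure (split_cell m A \<tau> l) (g -` {x}))"
      by (simp add: simple_integral_def emeasure_split_cell_law S SUP_mult_left_ennreal)
    also have "\<dots> = (SUP m. \<Sum>x\<in>range g. x * emeasure (split_cell m A \<tau> l) (g -` {x}))"
    proof (rule ennreal_SUP_sum[symmetric])
      show "incseq (\<lambda>m. x * emeasure (split_cell m A \<tau> l) (g -` {x}))" for x
        using incseq_split_cell[of A \<tau> l]
        by (auto simp: mono_def intro!: mult_left_mono le_measureD3)
    qed
    also have "\<dots> = (SUP m. integral\<^sup>S (split_cell m A \<tau> l) g)"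
      by (simp add: simple_integral_def)
    also have "\<dots> \<le> b"
    proof (rule SUP_least)
      fix m
      have "integral\<^sup>S (split_cell m A \<tau> l) g = (\<integral>\<^sup>+t. g t \<partial>split_cell m A \<tau> l)"
        by (rule nn_integral_eq_simple_integral[symmetric, OF g'])
      also have "\<dots> \<le> (\<integral>\<^sup>+t. f t \<partial>split_cell m A \<tau> l)"
        using \<open>g \<le> f\<close> by (intro nn_integral_mono) (auto simp: le_fun_def)
      finally show "integral\<^sup>S (split_cell m A \<tau> l) g \<le> b"
        using le[of m] by simp
    qed
    finally show ?thesis .
  qed
  then show ?thesis
    unfolding nn_integral_def by (intro SUP_least) auto
qed

section \<open>Supersolutions of the splitting dynamics\<close>

text \<open>The boxes are closed and adjacent leaves share a face, so a point may lie in the boxes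
  of several leaves; the sum only ever serves as an upper bound.\<close>

primrec leaf_sum :: "('d::finite box \<Rightarrow> ennreal) \<Rightarrow> 'd mtree \<Rightarrow> 'd box \<Rightarrow> ennreal" where
  "leaf_sum w Leaf A = w A"
| "leaf_sum w (Node lt s rt) A =
     leaf_sum w lt (lower_box A (fst s) (snd s)) + leaf_sum w rt (upper_box A (fst s) (snd s))"

text \<open>A depth bound turns the proof of measurability into an induction over numbers. The box,
  which changes along the recursion, then stays a free argument.\<close>

primrec leaf_sum_upto :: "nat \<Rightarrow> ('d::finite box \<Rightarrow> ennreal) \<Rightarrow> 'd mtree \<Rightarrow> 'd box \<Rightarrow> ennreal" where
  "leaf_sum_upto 0 w t A = 0"
| "leaf_sum_upto (Suc n) w t A = (case t of Leaf \<Rightarrow> w A | Node lt s rt \<Rightarrow>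
     leaf_sum_upto n w lt (lower_box A (fst s) (snd s)) +
     leaf_sum_upto n w rt (upper_box A (fst s) (snd s)))"

lemma leaf_sum_upto_eq: "height t < n \<Longrightarrow> leaf_sum_upto n w t A = leaf_sum w t A"
proof (induction n arbitrary: t A)
  case (Suc n)
  then show ?case by (cases t) simp_all
qed simp

lemma measurable_split_boxes [measurable (raw)]:
  fixes A :: "'x \<Rightarrow> 'd::finite box"
  assumes A [measurable]: "A \<in> borel_measurable M"
    and s [measurable]: "s \<in> M \<rightarrow>\<^sub>M count_space UNIV \<Otimes>\<^sub>M borel"
  shows "(\<lambda>x. lower_box (A x) (fst (s x)) (snd (s x))) \<in> borel_measurable M"
    and "(\<lambda>x. upper_box (A x) (fst (s x)) (snd (s x))) \<in> borel_measurable M"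
proof -
  have j: "(\<lambda>x. fst (s x)) \<in> M \<rightarrow>\<^sub>M count_space UNIV"
    by measurable
  show "(\<lambda>x. lower_box (A x) (fst (s x)) (snd (s x))) \<in> borel_measurable M"
    by (rule measurable_compose_countable'[OF _ j]) (auto intro: countable_finite)
  show "(\<lambda>x. upper_box (A x) (fst (s x)) (snd (s x))) \<in> borel_measurable M"
    by (rule measurable_compose_countable'[OF _ j]) (auto intro: countable_finite)
qed

lemma measurable_leaf_sum_upto:
  fixes w :: "'p \<Rightarrow> 'd::finite box \<Rightarrow> ennreal"
  assumes w: "(\<lambda>x. w (fst x) (snd x)) \<in> borel_measurable (N \<Otimes>\<^sub>M borel)"
  shows "(\<lambda>x. leaf_sum_upto n (w (fst x)) (fst (snd x)) (snd (snd x)))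
    \<in> borel_measurable (N \<Otimes>\<^sub>M mtree_space \<Otimes>\<^sub>M borel)"
proof (induction n)
  case (Suc n)
  have IH: "(\<lambda>x. leaf_sum_upto n (w (p x)) (t x) (A x)) \<in> borel_measurable M"
    if "t \<in> M \<rightarrow>\<^sub>M tree_sigma (count_space UNIV \<Otimes>\<^sub>M borel)" "A \<in> borel_measurable M" "p \<in> M \<rightarrow>\<^sub>M N" 
    for t A p and M :: "'x measure"
    using measurable_compose[OF measurable_Pair[OF that(3) measurable_Pair[OF that(1,2)]],
      OF Suc[unfolded mtree_space_def]] by simp
  have W: "(\<lambda>x. w (p x) (A x)) \<in> borel_measurable M"
    if "A \<in> borel_measurable M" "p \<in> M \<rightarrow>\<^sub>M N" for A p and M :: "'x measure"
    using measurable_compose[OF measurable_Pair[OF that(2,1)] w] by simp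
  have LU: "(\<lambda>x. leaf_sum_upto n (w (p x)) (t x) (lower_box (A x) (fst (s x)) (snd (s x)))) \<in> borel_measurable M"
       "(\<lambda>x. leaf_sum_upto n (w (p x)) (t x) (upper_box (A x) (fst (s x)) (snd (s x)))) \<in> borel_measurable M"
    if "t \<in> M \<rightarrow>\<^sub>M tree_sigma (count_space UNIV \<Otimes>\<^sub>M borel)" "A \<in> borel_measurable M" "p \<in> M \<rightarrow>\<^sub>M N" 
     "s \<in> M \<rightarrow>\<^sub>M count_space UNIV \<Otimes>\<^sub>M borel"
    for t A p s and M :: "'x measure"
    using that by (auto intro!: IH measurable_split_boxes)
  show ?case
    unfolding leaf_sum_upto.simps mtree_space_def
  proof (rule measurable_case_tree[where M="count_space UNIV \<Otimes>\<^sub>M borel"], goal_cases)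
    case 2
    show ?case by (rule W) measurable
  next
    case 3
    show ?case
      unfolding case_prod_unfold by (intro borel_measurable_add LU) measurable
  qed measurable
qed simp

lemma measurable_leaf_sum:
  fixes w :: "'p \<Rightarrow> 'd::finite box \<Rightarrow> ennreal"
  assumes "(\<lambda>x. w (fst x) (snd x)) \<in> borel_measurable (N \<Otimes>\<^sub>M borel)"
    and t: "t \<in> M \<rightarrow>\<^sub>M mtree_space" and "A \<in> borel_measurable M" "p \<in> M \<rightarrow>\<^sub>M N"
  shows "(\<lambda>x. leaf_sum (w (p x)) (t x) (A x)) \<in> borel_measurable M"
proof -
  have height: "height t' = rec_tree 0 (\<lambda>l v r a b. Suc (max a b)) t'" for t' :: "'d mtree"
    by (induction t') auto
  have "(\<lambda>x. rec_tree 0 (\<lambda>l v r a b. Suc (max a b)) (t x)) \<in> M \<rightarrow>\<^sub>M count_space UNIV"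
  proof (rule measurable_rec_tree[OF t[unfolded mtree_space_def]])
    show "(\<lambda>(x, l, v, r, a, b). Suc (max a b)) \<in> M \<Otimes>\<^sub>M tree_sigma (count_space UNIV \<Otimes>\<^sub>M borel) \<Otimes>\<^sub>M
      (count_space UNIV \<Otimes>\<^sub>M borel) \<Otimes>\<^sub>M tree_sigma (count_space UNIV \<Otimes>\<^sub>M borel) \<Otimes>\<^sub>M
      count_space UNIV \<Otimes>\<^sub>M count_space UNIV \<rightarrow>\<^sub>M count_space UNIV"
      unfolding case_prod_unfold by measurable
  qed simp
  then have H: "(\<lambda>x. height (t x)) \<in> M \<rightarrow>\<^sub>M count_space UNIV"
    by (simp only: height)
  have U: "(\<lambda>x. leaf_sum_upto n (w (p x)) (t x) (A x)) \<in> borel_measurable M" for n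
    using measurable_compose[OF measurable_Pair[OF assms(4) measurable_Pair[OF assms(2,3)]]
      measurable_leaf_sum_upto[OF assms(1)]] by (simp only: fst_conv snd_conv)
  \<comment> \<open>The height is a measurable map into a countable space, so the depth bound may
    depend on the tree.\<close>
  have "(\<lambda>x. leaf_sum_upto (Suc (height (t x))) (w (p x)) (t x) (A x)) \<in> borel_measurable M"
    by (rule measurable_compose_countable[where f="\<lambda>n x. leaf_sum_upto (Suc n) (w (p x)) (t x) (A x)", OF U H])
  then show ?thesis
    by (simp only: leaf_sum_upto_eq[OF lessI])
qed

section \<open>One step of the backward equation\<close>

definition proper :: "'d::finite box \<Rightarrow> bool" where
  "proper A \<longleftrightarrow> (\<forall>j. fst A $ j \<le> snd A $ j)"

lemma proper_lower_upper:
  assumes "proper A" "\<nu> \<in> {fst A $ j .. snd A $ j}"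
  shows "proper (lower_box A j \<nu>)" "proper (upper_box A j \<nu>)"
  using assms by (auto simp: proper_def lower_box_def upper_box_def)

text \<open>The probability \<open>side A j / lin_dim A\<close> cancels against the density
  \<open>1 / side A j\<close> of the threshold, which leaves Lebesgue measure on every side with the
  common factor \<open>1 / lin_dim A\<close>. A side of length 0 has probability 0 on the left and
  is a null set on the right.\<close>

lemma nn_integral_split_dimension_threshold:
  fixes A :: "'d::finite box"
  assumes A: "proper A" "lin_dim A \<noteq> 0" and [measurable]: "\<And>j. G j \<in> borel_measurable borel"
  shows "(\<integral>\<^sup>+j. \<integral>\<^sup>+\<nu>. G j \<nu> \<partial>split_threshold A j \<partial>split_dimension A) =
    ennreal (1 / lin_dim A) * (\<Sum>j\<in>UNIV. \<integral>\<^sup>+\<nu>. G j \<nu> * indicator {fst A $ j .. snd A $ j} \<nu> \<partial>lborel)"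
proof -
  have "0 < lin_dim A" using A by (simp add: less_le)
  have "ennreal (side A j / lin_dim A) * (\<integral>\<^sup>+\<nu>. G j \<nu> \<partial>split_threshold A j) =
     ennreal (1 / lin_dim A) * (\<integral>\<^sup>+\<nu>. G j \<nu> * indicator {fst A $ j .. snd A $ j} \<nu> \<partial>lborel)" for j
  proof (cases "side A j = 0")
    case False
    moreover have "fst A $ j \<le> snd A $ j"
      using A by (simp add: proper_def)
    ultimately have pos: "0 < side A j" and e: "emeasure lborel {fst A $ j .. snd A $ j} = ennreal (side A j)"
      by (simp_all add: side_eq max_def)
    have "(\<integral>\<^sup>+\<nu>. G j \<nu> \<partial>split_threshold A j) =
        (\<integral>\<^sup>+\<nu>. G j \<nu> * indicator {fst A $ j .. snd A $ j} \<nu> \<partial>lborel) / ennreal (side A j)"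
      unfolding split_threshold_def e[symmetric]
      by (rule nn_integral_uniform_measure) auto
    also have "ennreal (side A j / lin_dim A) * \<dots> =
        (ennreal (side A j / lin_dim A) * ennreal (1 / side A j)) *
        (\<integral>\<^sup>+\<nu>. G j \<nu> * indicator {fst A $ j .. snd A $ j} \<nu> \<partial>lborel)"
      using pos by (simp add: divide_ennreal_def inverse_ennreal inverse_eq_divide mult_ac)
    also have "ennreal (side A j / lin_dim A) * ennreal (1 / side A j) = ennreal (1 / lin_dim A)"
      using pos \<open>0 < lin_dim A\<close> by (simp add: ennreal_mult[symmetric])
    finally show ?thesis .
  next
    case True
    then have eq: "{fst A $ j .. snd A $ j} = {fst A $ j}"
      using A by (auto simp: side_eq proper_def max_def split: if_splits)
    have "AE \<nu> in lborel. \<nu> \<notin> {fst A $ j .. snd A $ j}"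
      unfolding eq singleton_iff by (rule AE_lborel_singleton)
    then have "(\<integral>\<^sup>+\<nu>. G j \<nu> * indicator {fst A $ j .. snd A $ j} \<nu> \<partial>lborel) = 0"
      by (subst nn_integral_0_iff_AE) (auto elim: eventually_mono)
    then show ?thesis using True by simp
  qed
  then show ?thesis
    unfolding split_dimension_def
    by (subst nn_integral_point_measure_finite) (auto simp: sum_distrib_left)
qed

text \<open>Multiplied by the exponential density, the integrand before time s is the derivative of
  \<open>- exp (- a * e) * \<phi> (s - e)\<close>. It integrates to
  \<open>\<phi> s - exp (- a * s) * \<phi> 0\<close>, and the missing term is covered by the event
  of no split: it has probability \<open>exp (- a * s)\<close> and contributes at most
  \<open>\<phi> 0\<close>.\<close>

lemma nn_integral_exponential_le:
  fixes \<phi> \<phi>' :: "real \<Rightarrow> real"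
  assumes "0 < a" "0 \<le> s"
    and deriv: "\<And>u. 0 \<le> u \<Longrightarrow> (\<phi> has_real_derivative \<phi>' u) (at u)"
    and [measurable]: "\<phi> \<in> borel_measurable borel" "\<phi>' \<in> borel_measurable borel"
    and nonneg': "\<And>u. 0 \<le> u \<Longrightarrow> 0 \<le> a * \<phi> u + \<phi>' u" and "0 \<le> \<phi> 0" and w: "w \<le> ennreal (\<phi> 0)"
  shows "(\<integral>\<^sup>+e. ennreal (exponential_density a e) *
      (if e \<le> s then ennreal (\<phi> (s - e) + \<phi>' (s - e) / a) else w) \<partial>lborel) \<le> ennreal (\<phi> s)"
proof -
  define f where "f e = a * exp (- a * e) * \<phi> (s - e) + exp (- a * e) * \<phi>' (s - e)" for e
  have f_nonneg: "0 \<le> f e" if "e \<le> s" for e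
  proof -
    have "f e = exp (- a * e) * (a * \<phi> (s - e) + \<phi>' (s - e))"
      by (simp add: f_def algebra_simps)
    then show ?thesis using nonneg'[of "s - e"] that by simp
  qed
  have [measurable]: "f \<in> borel_measurable borel"
    unfolding f_def by measurable
  have "(\<integral>\<^sup>+e. ennreal (exponential_density a e) *
      (if e \<le> s then ennreal (\<phi> (s - e) + \<phi>' (s - e) / a) else w) \<partial>lborel) \<le>
      (\<integral>\<^sup>+e. ennreal (f e) * indicator {0..s} e +
       w * (ennreal (a * exp (- a * e)) * indicator {s..} e) \<partial>lborel)"
  \<comment> \<open>Both indicators contain the point e = s; the overlap is harmless for an upper
    bound.\<close>
  proof (rule nn_integral_mono)
    fix e
    consider "e < 0" | "0 \<le> e" "e \<le> s" | "s < e" by linarith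
    then show "ennreal (exponential_density a e) *
        (if e \<le> s then ennreal (\<phi> (s - e) + \<phi>' (s - e) / a) else w)
        \<le> ennreal (f e) * indicator {0..s} e + w * (ennreal (a * exp (- a * e)) * indicator {s..} e)"
    proof cases
      case 2
      then have "exponential_density a e * (\<phi> (s - e) + \<phi>' (s - e) / a) = f e"
        using \<open>0 < a\<close> by (simp add: exponential_density_def f_def distrib_left mult_ac)
      then have "ennreal (exponential_density a e) * ennreal (\<phi> (s - e) + \<phi>' (s - e) / a) = ennreal (f e)"
        using \<open>0 < a\<close> by (subst ennreal_mult'[symmetric]) (auto simp: exponential_density_nonneg)
      then show ?thesis using 2 by simp
    next
      case 3
      then show ?thesis using \<open>0 \<le> s\<close>
        by (simp add: exponential_density_def mult_ac)
    qed (simp add: exponential_density_def)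
  qed
  also have "\<dots> = (\<integral>\<^sup>+e. ennreal (f e) * indicator {0..s} e \<partial>lborel) +
       w * (\<integral>\<^sup>+e. ennreal (a * exp (- a * e)) * indicator {s..} e \<partial>lborel)"
    by (simp add: nn_integral_add nn_integral_cmult)
  also have "(\<integral>\<^sup>+e. ennreal (f e) * indicator {0..s} e \<partial>lborel) =
      ennreal ((- exp (- a * s) * \<phi> (s - s)) - (- exp (- a * 0) * \<phi> (s - 0)))"
  proof (rule nn_integral_FTC_Icc[where F="\<lambda>e. - exp (- a * e) * \<phi> (s - e)"])
    fix e assume e: "e \<in> {0..s}"
    show "((\<lambda>e. - exp (- a * e) * \<phi> (s - e)) has_real_derivative f e) (at e)"
      using deriv[of "s - e"] e
      by (auto intro!: derivative_eq_intros DERIV_chain2[of \<phi>] simp: f_def algebra_simps)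
  qed (use f_nonneg \<open>0 \<le> s\<close> in auto)
  also have "(\<integral>\<^sup>+e. ennreal (a * exp (- a * e)) * indicator {s..} e \<partial>lborel) = ennreal (0 - (- exp (- a * s)))"
  proof (rule nn_integral_FTC_atLeast[where F="\<lambda>e. - exp (- a * e)"])
    show "((\<lambda>e. - exp (- a * e)) \<longlongrightarrow> 0) at_top"
      using \<open>0 < a\<close> by real_asymp
  qed (use \<open>0 < a\<close> in \<open>auto intro!: derivative_eq_intros\<close>)
  also have "ennreal (- exp (- a * s) * \<phi> (s - s) - (- exp (- a * 0) * \<phi> (s - 0))) +
      w * ennreal (0 - (- exp (- a * s))) \<le>
      ennreal (\<phi> s - exp (- a * s) * \<phi> 0) + ennreal (\<phi> 0) * ennreal (exp (- a * s))"
    using mult_right_mono[OF w, of "ennreal (exp (- (a * s)))"] by (intro add_mono) auto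
  also have "\<dots> = ennreal (\<phi> s)"
  proof -
    \<comment> \<open>The difference \<open>\<phi> s - exp (- a * s) * \<phi> 0\<close> stands
      inside \<open>ennreal\<close> and must not be cut off at 0.\<close>
    have "exp (a * 0) * \<phi> 0 \<le> exp (a * s) * \<phi> s"
    proof (rule DERIV_nonneg_imp_nondecreasing[where f="\<lambda>u. exp (a * u) * \<phi> u", OF \<open>0 \<le> s\<close>])
      fix u assume "0 \<le> u" "u \<le> s"
      then have "((\<lambda>u. exp (a * u) * \<phi> u) has_real_derivative exp (a * u) * (a * \<phi> u + \<phi>' u)) (at u)"
        using deriv[of u] by (auto intro!: derivative_eq_intros simp: algebra_simps)
      then show "\<exists>y. ((\<lambda>u. exp (a * u) * \<phi> u) has_real_derivative y) (at u) \<and> 0 \<le> y"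
        using nonneg'[OF \<open>0 \<le> u\<close>] by (intro exI[of _ "exp (a * u) * (a * \<phi> u + \<phi>' u)"]) auto
    qed
    then have "exp (- a * s) * \<phi> 0 \<le> \<phi> s"
      by (simp add: exp_minus field_simps)
    then show ?thesis
      using \<open>0 \<le> \<phi> 0\<close>
      by (simp add: ennreal_mult'[symmetric] ennreal_plus[symmetric] mult_ac del: ennreal_plus)
  qed
  finally show ?thesis .
qed

text \<open>The bound on the split integral is the supersolution inequality for the backward equation of the
  splitting dynamics, with \<open>s\<close> the remaining time.\<close>

lemma nn_integral_leaf_sum_split_cell_le:
  fixes A :: "'d::finite box" and \<Phi> \<Phi>' :: "'d box \<Rightarrow> real \<Rightarrow> real"
  assumes w: "w \<in> borel_measurable borel"
    and leaf: "\<And>A. proper A \<Longrightarrow> w A \<le> ennreal (\<Phi> A 0)"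
    and nonneg: "\<And>A. proper A \<Longrightarrow> 0 \<le> \<Phi> A 0"
    and deriv: "\<And>A s. proper A \<Longrightarrow> 0 \<le> s \<Longrightarrow> (\<Phi> A has_real_derivative \<Phi>' A s) (at s)"
    and meas: "\<And>A. \<Phi> A \<in> borel_measurable borel" "\<And>A. \<Phi>' A \<in> borel_measurable borel"
    and nonneg': "\<And>A s. proper A \<Longrightarrow> 0 \<le> s \<Longrightarrow> 0 \<le> lin_dim A * \<Phi> A s + \<Phi>' A s"
    and super: "\<And>A s. proper A \<Longrightarrow> 0 \<le> s \<Longrightarrow>
      (\<Sum>j\<in>UNIV. \<integral>\<^sup>+\<nu>. (ennreal (\<Phi> (lower_box A j \<nu>) s) + ennreal (\<Phi> (upper_box A j \<nu>) s))
          * indicator {fst A $ j .. snd A $ j} \<nu> \<partial>lborel)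
      \<le> ennreal (lin_dim A * \<Phi> A s + \<Phi>' A s)"
    and A: "proper A" and "\<tau> \<le> l"
  shows "(\<integral>\<^sup>+t. leaf_sum w t A \<partial>split_cell m A \<tau> l) \<le> ennreal (\<Phi> A (l - \<tau>))"
  using A \<open>\<tau> \<le> l\<close>
proof (induction m arbitrary: A \<tau>)
  case 0
  then show ?case by (simp add: nn_integral_null_measure)
next
  case (Suc m)
  note A = Suc.prems(1)
  have ms [measurable]: "(\<lambda>x. leaf_sum w (t x) A) \<in> borel_measurable M"
    if [measurable]: "t \<in> M \<rightarrow>\<^sub>M mtree_space" for t A and M :: "'x measure"
    by (rule measurable_leaf_sum[of "\<lambda>_. w" "count_space UNIV", where p="\<lambda>_. ()"]) (use w in measurable)
  have ms': "(\<lambda>t. leaf_sum w t A) \<in> borel_measurable mtree_space" for A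
    by (rule ms) simp
  define a where "a = lin_dim A"
  define s where "s = l - \<tau>"
  have "0 \<le> s" using Suc.prems by (simp add: s_def)
  show ?case
  proof (cases "a = 0")
    \<comment> \<open>A box of linear dimension 0 is never split. Here \<open>nonneg'\<close> says
      that \<open>\<Phi>' A\<close> is nonnegative, so \<open>\<Phi> A\<close> can only grow from
      its value at time 0.\<close>
    case True
    have "\<Phi> A 0 \<le> \<Phi> A s"
      using deriv[OF A] nonneg'[OF A] True \<open>0 \<le> s\<close>
      by (intro DERIV_nonneg_imp_nondecreasing[of 0 s "\<Phi> A"]) (auto simp: a_def)
    then have "w A \<le> ennreal (\<Phi> A s)"
      using leaf[OF A] by (blast intro: order_trans ennreal_leI)
    then show ?thesis
      unfolding nn_integral_split_cell_Suc[OF ms'] using True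
      by (simp add: a_def s_def)
  next
    case False
    then have "0 < a" by (simp add: a_def less_le)
    let ?G = "\<lambda>\<sigma> j \<nu>. \<integral>\<^sup>+lt. \<integral>\<^sup>+rt. leaf_sum w (Node lt (j, \<nu>) rt) A
          \<partial>split_cell m (upper_box A j \<nu>) \<sigma> l \<partial>split_cell m (lower_box A j \<nu>) \<sigma> l"
    have split: "?G \<sigma> j \<nu>
        \<le> ennreal (\<Phi> (lower_box A j \<nu>) (l - \<sigma>)) + ennreal (\<Phi> (upper_box A j \<nu>) (l - \<sigma>))"
      if \<nu>: "\<nu> \<in> {fst A $ j .. snd A $ j}" and "\<sigma> \<le> l" for j \<nu> \<sigma>
    proof -
      let ?L = "split_cell m (lower_box A j \<nu>) \<sigma> l" and ?U = "split_cell m (upper_box A j \<nu>) \<sigma> l"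
      interpret L: subprob_space ?L
        using subprob_space_kernel[OF measurable_split_cell, of "(lower_box A j \<nu>, \<sigma>)" m l]
        by (simp add: space_pair_measure)
      interpret U: subprob_space ?U
        using subprob_space_kernel[OF measurable_split_cell, of "(upper_box A j \<nu>, \<sigma>)" m l]
        by (simp add: space_pair_measure)
      have "?G \<sigma> j \<nu> =
          (\<integral>\<^sup>+lt. leaf_sum w lt (lower_box A j \<nu>) * emeasure ?U UNIV +
             (\<integral>\<^sup>+rt. leaf_sum w rt (upper_box A j \<nu>) \<partial>?U) \<partial>?L)"
        by (simp add: nn_integral_add)
      also have "\<dots> = (\<integral>\<^sup>+lt. leaf_sum w lt (lower_box A j \<nu>) \<partial>?L) * emeasure ?U UNIV +
          (\<integral>\<^sup>+rt. leaf_sum w rt (upper_box A j \<nu>) \<partial>?U) * emeasure ?L UNIV"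
        by (simp add: nn_integral_add nn_integral_multc)
      \<comment> \<open>Each subtree sum is weighted with the total mass of the law of its sibling.
        Truncation makes that mass at most 1, which is the right direction.\<close>
      also have "\<dots> \<le> ennreal (\<Phi> (lower_box A j \<nu>) (l - \<sigma>)) * 1 + ennreal (\<Phi> (upper_box A j \<nu>) (l - \<sigma>)) * 1"
        using proper_lower_upper[OF A \<nu>] \<open>\<sigma> \<le> l\<close>
        by (intro add_mono mult_mono Suc.IH L.subprob_emeasure_le_1 U.subprob_emeasure_le_1) auto
      finally show ?thesis by simp
    qed
    have inner: "(\<integral>\<^sup>+j. \<integral>\<^sup>+\<nu>. ?G \<sigma> j \<nu> \<partial>split_threshold A j \<partial>split_dimension A)
        \<le> ennreal (\<Phi> A (l - \<sigma>) + \<Phi>' A (l - \<sigma>) / a)" (is "?I \<le> _") if "\<sigma> \<le> l" for \<sigma>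
    proof -
      have Gm: "(\<lambda>\<nu>. ?G \<sigma> j \<nu>) \<in> borel_measurable borel" for j
      proof (rule nn_integral_measurable_subprob_algebra2[where N=mtree_space])
        have "(\<lambda>x. \<integral>\<^sup>+rt. leaf_sum w (Node (snd x) (j, fst x) rt) A
            \<partial>split_cell m (upper_box A j (fst x)) \<sigma> l) \<in> borel_measurable (borel \<Otimes>\<^sub>M mtree_space)"
          by (rule nn_integral_measurable_subprob_algebra2[where N=mtree_space])
             (unfold case_prod_unfold, rule ms, measurable)
        then show "(\<lambda>(x, y). \<integral>\<^sup>+ rt. leaf_sum w \<langle>y, (j, x), rt\<rangle> A \<partial>split_cell m (upper_box A j x) \<sigma> l)
            \<in> borel_measurable (borel \<Otimes>\<^sub>M mtree_space)"
          by (simp only: case_prod_unfold)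
      qed measurable
      have "?I = ennreal (1 / a) * (\<Sum>j\<in>UNIV. \<integral>\<^sup>+\<nu>. ?G \<sigma> j \<nu> * indicator {fst A $ j .. snd A $ j} \<nu> \<partial>lborel)"
        unfolding a_def
        by (rule nn_integral_split_dimension_threshold[OF A]) (use False Gm in \<open>auto simp: a_def\<close>)
      also have "\<dots> \<le> ennreal (1 / a) * (\<Sum>j\<in>UNIV.
         \<integral>\<^sup>+\<nu>. (ennreal (\<Phi> (lower_box A j \<nu>) (l - \<sigma>)) + ennreal (\<Phi> (upper_box A j \<nu>) (l - \<sigma>)))
          * indicator {fst A $ j .. snd A $ j} \<nu> \<partial>lborel)"
        using split[OF _ that]
        by (intro mult_left_mono sum_mono nn_integral_mono)
           (auto split: split_indicator simp del: leaf_sum.simps)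
      also have "\<dots> \<le> ennreal (1 / a) * ennreal (lin_dim A * \<Phi> A (l - \<sigma>) + \<Phi>' A (l - \<sigma>))"
        using that by (intro mult_left_mono super A) auto
      also have "\<dots> = ennreal (\<Phi> A (l - \<sigma>) + \<Phi>' A (l - \<sigma>) / a)"
        using \<open>0 < a\<close> by (simp add: ennreal_mult'[symmetric] a_def[symmetric] field_simps)
      finally show ?thesis .
    qed
    have "(\<integral>\<^sup>+t. leaf_sum w t A \<partial>split_cell (Suc m) A \<tau> l) \<le>
      (\<integral>\<^sup>+e. (if e \<le> s then ennreal (\<Phi> A (s - e) + \<Phi>' A (s - e) / a) else w A) \<partial>split_time A)"
      unfolding nn_integral_split_cell_Suc[OF ms'] if_not_P[OF False[unfolded a_def]]
    proof (rule nn_integral_mono, goal_cases)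
      case (1 e)
      have eq: "l - (\<tau> + e) = s - e" "\<tau> + e \<le> l \<longleftrightarrow> e \<le> s" by (auto simp: s_def)
      show ?case
        unfolding eq(2) using inner[of "\<tau> + e", unfolded eq] by (simp del: leaf_sum.simps(2))
    qed
    also have "\<dots> = (\<integral>\<^sup>+e. ennreal (exponential_density a e) *
       (if e \<le> s then ennreal (\<Phi> A (s - e) + \<Phi>' A (s - e) / a) else w A) \<partial>lborel)"
      unfolding split_time_def a_def[symmetric] using meas
      by (subst nn_integral_density) auto
    also have "\<dots> \<le> ennreal (\<Phi> A s)"
      using \<open>0 < a\<close> \<open>0 \<le> s\<close> nonneg'[OF A] nonneg[OF A] leaf[OF A]
      by (intro nn_integral_exponential_le deriv[OF A] meas) (auto simp: a_def)
    finally show ?thesis by (simp add: s_def)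
  qed
qed

section \<open>Number of leaves and size of the cell of a point\<close>

lemma side_lower_upper:
  assumes "\<nu> \<in> {fst A $ j .. snd A $ j}"
  shows "side (lower_box A j \<nu>) i = (if i = j then \<nu> - fst A $ j else side A i)"
    and "side (upper_box A j \<nu>) i = (if i = j then snd A $ j - \<nu> else side A i)"
  using assms by (auto simp: side_eq lower_box_def upper_box_def)

lemma proper_side: "proper A \<Longrightarrow> side A j = snd A $ j - fst A $ j"
  by (simp add: proper_def side_eq)

text \<open>The product solves the backward equation with equality. A cut in direction j leaves the
  other factors alone and turns \<open>1 + s * side A j\<close> into two factors with sum
  \<open>2 + s * side A j\<close>, wherever the threshold falls. Integrating over the side gives
  \<open>side A j * \<Phi> A s\<close> plus the j-th term of the time derivative.\<close>

lemma expected_leaves_split_cell_le: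
  fixes A :: "'d::finite box"
  assumes "proper A" "\<tau> \<le> l"
  shows "(\<integral>\<^sup>+t. leaf_sum (\<lambda>_. 1) t A \<partial>split_cell m A \<tau> l) \<le> ennreal (\<Prod>j\<in>UNIV. 1 + (l - \<tau>) * side A j)"
proof -
  define P where "P A j s = (\<Prod>i\<in>UNIV - {j}. 1 + s * side A i)" for A :: "'d box" and j s
  define \<Phi> where "\<Phi> A s = (\<Prod>j\<in>UNIV. 1 + s * side A j)" for A :: "'d box" and s
  define \<Phi>' where "\<Phi>' A s = (\<Sum>j\<in>UNIV. side A j * P A j s)" for A :: "'d box" and s
  have \<Phi>_P: "\<Phi> A s = (1 + s * side A j) * P A j s" for A j s
    unfolding \<Phi>_def P_def by (subst prod.remove[of _ j]) auto
  have P_nonneg: "0 \<le> P A j s" if "0 \<le> s" for A j s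
    using that unfolding P_def by (intro prod_nonneg) auto
  have nonneg: "0 \<le> \<Phi> A s" if "0 \<le> s" for A s
    using that unfolding \<Phi>_def by (intro prod_nonneg) auto
  have nonneg': "0 \<le> \<Phi>' A s" if "0 \<le> s" for A s
    unfolding \<Phi>'_def using that by (intro sum_nonneg mult_nonneg_nonneg P_nonneg) auto
  have [measurable]: "\<Phi> A \<in> borel_measurable borel" "P A j \<in> borel_measurable borel" for A j
    unfolding \<Phi>_def P_def by measurable
  let ?I = "\<lambda>A j s. \<integral>\<^sup>+\<nu>. (ennreal (\<Phi> (lower_box A j \<nu>) s) + ennreal (\<Phi> (upper_box A j \<nu>) s))
      * indicator {fst A $ j .. snd A $ j} \<nu> \<partial>lborel"
  have "(\<integral>\<^sup>+t. leaf_sum (\<lambda>_. 1) t A \<partial>split_cell m A \<tau> l) \<le> ennreal (\<Phi> A (l - \<tau>))"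
  proof (rule nn_integral_leaf_sum_split_cell_le[where \<Phi>'=\<Phi>'])
    fix A :: "'d box" and s :: real assume A: "proper A" and s: "0 \<le> s"
    show "0 \<le> lin_dim A * \<Phi> A s + \<Phi>' A s"
      using nonneg[OF s] nonneg'[OF s] by simp
    show "(\<Phi> A has_real_derivative \<Phi>' A s) (at s)"
      unfolding \<Phi>_def \<Phi>'_def P_def
      by (rule has_field_derivative_prod) (auto intro!: derivative_eq_intros)
    have "(\<Sum>j\<in>UNIV. ?I A j s) =
        (\<Sum>j\<in>UNIV. \<integral>\<^sup>+\<nu>. ennreal ((2 + s * side A j) * P A j s) * indicator {fst A $ j .. snd A $ j} \<nu> \<partial>lborel)"
    proof (intro sum.cong nn_integral_cong refl)
      fix j \<nu>
      show "(ennreal (\<Phi> (lower_box A j \<nu>) s) + ennreal (\<Phi> (upper_box A j \<nu>) s)) * indicator {fst A $ j .. snd A $ j} \<nu> =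
          ennreal ((2 + s * side A j) * P A j s) * indicator {fst A $ j .. snd A $ j} \<nu>"
      proof (cases "\<nu> \<in> {fst A $ j .. snd A $ j}")
        case True
        have "P (lower_box A j \<nu>) j s = P A j s" "P (upper_box A j \<nu>) j s = P A j s"
          unfolding P_def by (auto intro!: prod.cong simp: side_lower_upper[OF True])
        then have "\<Phi> (lower_box A j \<nu>) s + \<Phi> (upper_box A j \<nu>) s = (2 + s * side A j) * P A j s"
          using A by (simp add: \<Phi>_P[of _ _ j] side_lower_upper[OF True] proper_side algebra_simps)
        then show ?thesis
          using nonneg[OF s] by (simp add: ennreal_plus[symmetric] del: ennreal_plus)
      qed simp
    qed
    also have "\<dots> = (\<Sum>j\<in>UNIV. ennreal ((2 + s * side A j) * P A j s * side A j))"
      using A s by (intro sum.cong refl, subst nn_integral_cmult_indicator)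
        (auto simp: proper_side proper_def emeasure_lborel_Icc_eq ennreal_mult''[symmetric])
    also have "\<dots> = ennreal (\<Sum>j\<in>UNIV. (2 + s * side A j) * P A j s * side A j)"
      using s P_nonneg[OF s] by (subst sum_ennreal) auto
    also have "(\<Sum>j\<in>UNIV. (2 + s * side A j) * P A j s * side A j) =
        (\<Sum>j\<in>UNIV. side A j * \<Phi> A s + side A j * P A j s)"
    proof (intro sum.cong refl)
      fix j show "(2 + s * side A j) * P A j s * side A j = side A j * \<Phi> A s + side A j * P A j s"
        unfolding \<Phi>_P[of A s j] by (simp add: algebra_simps)
    qed
    also have "\<dots> = lin_dim A * \<Phi> A s + \<Phi>' A s"
      by (simp add: sum.distrib lin_dim_def \<Phi>'_def sum_distrib_right)
    finally show "(\<Sum>j\<in>UNIV. ?I A j s) \<le> ennreal (lin_dim A * \<Phi> A s + \<Phi>' A s)"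
      by simp
  next
    show "\<Phi>' A \<in> borel_measurable borel" for A
      unfolding \<Phi>'_def[abs_def] by measurable
  qed (use assms in \<open>auto simp: \<Phi>_def\<close>)
  then show ?thesis by (simp add: \<Phi>_def)
qed

text \<open>Dominates the squared distance from x to every point of the box. The value 0 for boxes
  without x makes a leaf sum ignore all leaves except those around x.\<close>

definition spread :: "real ^ 'd::finite \<Rightarrow> 'd box \<Rightarrow> real" where
  "spread x B = (if x \<in> cbox (fst B) (snd B) then \<Sum>j\<in>UNIV. (x $ j - fst B $ j)\<^sup>2 + (snd B $ j - x $ j)\<^sup>2 else 0)"

lemma measurable_spread [measurable (raw)]:
  assumes [measurable]: "f \<in> borel_measurable M" "g \<in> borel_measurable M"
  shows "(\<lambda>z. spread (f z) (g z)) \<in> borel_measurable M"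
  unfolding spread_def mem_box_cart by measurable

text \<open>A rational supersolution dominating \<open>E[min(r, E\<^sub>s)\<^sup>2]\<close>, where \<open>E\<^sub>s\<close> is exponential of rate \<open>s\<close>:
  this is the law of the distance from a point to the boundary of its cell in a given direction.\<close>

definition dist_bound :: "real \<Rightarrow> real \<Rightarrow> real" where
  "dist_bound r s = r\<^sup>2 / (1 + s * r / 3)\<^sup>2"

definition dist_bound' :: "real \<Rightarrow> real \<Rightarrow> real" where
  "dist_bound' r s = - (2 * r ^ 3) / (3 * (1 + s * r / 3) ^ 3)"

lemma measurable_dist_bound [measurable]:
  "dist_bound r \<in> borel_measurable borel" "dist_bound' r \<in> borel_measurable borel"
  unfolding dist_bound_def[abs_def] dist_bound'_def[abs_def] by measurable

lemma dist_bound_nonneg: "0 \<le> dist_bound r s"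
  by (simp add: dist_bound_def)

lemma dist_bound_le:
  assumes "0 \<le> r" "0 < s"
  shows "dist_bound r s \<le> 9 / s\<^sup>2"
proof -
  have "r \<le> 3 / s * (1 + s * r / 3)"
    using assms by (simp add: field_simps)
  moreover have "0 < 1 + s * r / 3"
    using mult_nonneg_nonneg[of s r] assms by linarith
  ultimately have "r / (1 + s * r / 3) \<le> 3 / s"
    by (simp add: pos_divide_le_eq)
  then have "(r / (1 + s * r / 3))\<^sup>2 \<le> (3 / s)\<^sup>2"
    using assms by (intro power_mono) auto
  then show ?thesis by (simp add: dist_bound_def power_divide)
qed

lemma has_derivative_dist_bound:
  assumes "0 \<le> r" "0 \<le> s"
  shows "(dist_bound r has_real_derivative dist_bound' r s) (at s)"
proof -
  obtain D where D: "1 + s * r / 3 = D" by blast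
  have "D \<noteq> 0"
    using mult_nonneg_nonneg[OF assms(2,1)] D by linarith
  have D': "((\<lambda>s. 1 + s * r / 3) has_real_derivative r / 3) (at s)"
    by (auto intro!: derivative_eq_intros)
  show ?thesis
    unfolding dist_bound_def[abs_def] dist_bound'_def
    by (rule DERIV_cong[OF DERIV_divide[OF DERIV_const DERIV_power[OF D', of 2]]], unfold D)
      (use \<open>D \<noteq> 0\<close> in \<open>simp_all add: field_simps eval_nat_numeral\<close>)
qed

text \<open>The one-dimensional supersolution inequality says that the integral of
  \<open>dist_bound u s\<close> over u from 0 to r is at most
  \<open>r * dist_bound r s + dist_bound' r s\<close>. Both sides vanish at r = 0, and this
  derivative exceeds \<open>dist_bound r s\<close> by a nonnegative term. For a slope k in place of
  1 / 3, the case s = 0 reads r^3 / 3 \<le> (1 - 2 k) r^3, so 1 / 3 is the largest admissible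
  slope.\<close>

lemma has_derivative_dist_bound_balance:
  assumes "0 \<le> r" "0 \<le> s"
  shows "((\<lambda>r. r * dist_bound r s + dist_bound' r s) has_real_derivative
    dist_bound r s + 2 * s * r ^ 3 / (3 * (1 + s * r / 3) ^ 4)) (at r)"
proof -
  obtain D where D: "1 + s * r / 3 = D" by blast
  have "D \<noteq> 0"
    using mult_nonneg_nonneg[OF assms(2,1)] D by linarith
  have D': "((\<lambda>r. 1 + s * r / 3) has_real_derivative s / 3) (at r)"
    by (auto intro!: derivative_eq_intros)
  have eq: "1 * (r\<^sup>2 / D\<^sup>2) + (of_nat 2 * (1 * r ^ (2 - Suc 0)) * D\<^sup>2 - r\<^sup>2 * (of_nat 2 * (s / 3 * D ^ (2 - Suc 0)))) / (D\<^sup>2 * D\<^sup>2) * r +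
      (- (2 * (of_nat 3 * (1 * r ^ (3 - Suc 0)))) * (3 * D ^ 3) - - (2 * r ^ 3) * (3 * (of_nat 3 * (s / 3 * D ^ (3 - Suc 0))))) / (3 * D ^ 3 * (3 * D ^ 3)) =
    r\<^sup>2 / D\<^sup>2 + 2 * s * r ^ 3 / (3 * D ^ 4)"
  proof (cases "r = 0")
    case False
    \<comment> \<open>Eliminating s leaves a rational identity in the independent quantities D and
      r.\<close>
    then have s: "s = 3 * (D - 1) / r" using D by (simp add: field_simps)
    show ?thesis
      unfolding s using \<open>D \<noteq> 0\<close> False by (simp add: field_simps eval_nat_numeral)
  qed simp
  show ?thesis
    unfolding dist_bound_def dist_bound'_def
    by (rule DERIV_cong[OF DERIV_add[OF DERIV_mult[OF DERIV_ident
        DERIV_divide[OF DERIV_power[OF DERIV_ident, of 2] DERIV_power[OF D', of 2]]]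
        DERIV_divide[OF DERIV_minus[OF DERIV_cmult[OF DERIV_power[OF DERIV_ident, of 3], of 2]]
          DERIV_cmult[OF DERIV_power[OF D', of 3], of 3]]]], unfold D)
      (use \<open>D \<noteq> 0\<close> eq in simp_all)
qed

lemma dist_bound_balance_nonneg:
  assumes "0 \<le> r" "0 \<le> s"
  shows "0 \<le> r * dist_bound r s + dist_bound' r s"
proof -
  obtain D where D: "1 + s * r / 3 = D" by blast
  have "1 \<le> D"
    using mult_nonneg_nonneg[OF assms(2,1)] D by linarith
  then have "r * dist_bound r s + dist_bound' r s = r ^ 3 * (3 * D - 2) / (3 * D ^ 3)"
    unfolding dist_bound_def dist_bound'_def D by (simp add: field_simps power2_eq_square power3_eq_cube)
  then show ?thesis using assms \<open>1 \<le> D\<close> by simp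
qed

text \<open>A threshold on one side of x moves only the face on that side, and C collects the
  untouched directions. On each side of x the moving term integrates to at most \<open>R\<close> of
  the old distance, and the fixed terms are multiplied by that distance; the two distances add up to
  b - a.\<close>

lemma nn_integral_dist_bound_split_le:
  assumes x: "a \<le> x" "x \<le> b" and s: "0 \<le> s" and C: "0 \<le> C"
  shows "(\<integral>\<^sup>+\<nu>. ennreal (C + (if x < \<nu> then dist_bound (x - a) s + dist_bound (\<nu> - x) s
        else dist_bound (x - \<nu>) s + dist_bound (b - x) s)) * indicator {a..b} \<nu> \<partial>lborel)
    \<le> ennreal ((b - a) * (C + dist_bound (x - a) s + dist_bound (b - x) s) +
        dist_bound' (x - a) s + dist_bound' (b - x) s)"
proof -
  define R where "R r = r * dist_bound r s + dist_bound' r s" for r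
  define R' where "R' r = dist_bound r s + 2 * s * r ^ 3 / (3 * (1 + s * r / 3) ^ 4)" for r
  have R0: "R 0 = 0" by (simp add: R_def dist_bound_def dist_bound'_def)
  have R: "(R has_real_derivative R' r) (at r)" if "0 \<le> r" for r
    using has_derivative_dist_bound_balance[OF that s] unfolding R_def[abs_def] R'_def .
  have R'_ge: "dist_bound r s \<le> R' r" if "0 \<le> r" for r
    unfolding R'_def using that s by simp
  have R'_nonneg: "0 \<le> R' r" if "0 \<le> r" for r
    using R'_ge[OF that] dist_bound_nonneg[of r s] by linarith
  have R_nonneg: "0 \<le> R r" if "0 \<le> r" for r
    unfolding R_def by (rule dist_bound_balance_nonneg[OF that s])
  have [measurable]: "R' \<in> borel_measurable borel" "(\<lambda>r. dist_bound r s) \<in> borel_measurable borel"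
    unfolding R'_def[abs_def] dist_bound_def by measurable
  let ?q = "dist_bound (x - a) s" and ?r = "dist_bound (b - x) s"
  have qr: "0 \<le> ?q" "0 \<le> ?r" by (simp_all add: dist_bound_nonneg)
  have D1: "((\<lambda>\<nu>. (C + ?r) * \<nu> - R (x - \<nu>)) has_real_derivative C + ?r + R' (x - \<nu>)) (at \<nu>)" if "\<nu> \<le> x" for \<nu>
  proof -
    have "((\<lambda>\<nu>. R (x - \<nu>)) has_real_derivative R' (x - \<nu>) * (- 1)) (at \<nu>)"
      by (rule DERIV_chain2[OF R]) (use that in \<open>auto intro!: derivative_eq_intros\<close>)
    from DERIV_diff[OF DERIV_cmult[OF DERIV_ident, of "C + ?r"] this] show ?thesis by simp
  qed
  have D2: "((\<lambda>\<nu>. (C + ?q) * \<nu> + R (\<nu> - x)) has_real_derivative C + ?q + R' (\<nu> - x)) (at \<nu>)" if "x \<le> \<nu>" for \<nu>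
  proof -
    have "((\<lambda>\<nu>. R (\<nu> - x)) has_real_derivative R' (\<nu> - x) * 1) (at \<nu>)"
      by (rule DERIV_chain2[OF R]) (use that in \<open>auto intro!: derivative_eq_intros\<close>)
    from DERIV_add[OF DERIV_cmult[OF DERIV_ident, of "C + ?q"] this] show ?thesis by simp
  qed
  have "(\<integral>\<^sup>+\<nu>. ennreal (C + (if x < \<nu> then ?q + dist_bound (\<nu> - x) s else dist_bound (x - \<nu>) s + ?r))
          * indicator {a..b} \<nu> \<partial>lborel)
      \<le> (\<integral>\<^sup>+\<nu>. ennreal (C + ?r + R' (x - \<nu>)) * indicator {a..x} \<nu> +
            ennreal (C + ?q + R' (\<nu> - x)) * indicator {x..b} \<nu> \<partial>lborel)"
  proof (rule nn_integral_mono)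
    fix \<nu>
    consider "\<nu> < a \<or> b < \<nu>" | "a \<le> \<nu>" "\<nu> \<le> x" | "x < \<nu>" "\<nu> \<le> b" by linarith
    then show "ennreal (C + (if x < \<nu> then ?q + dist_bound (\<nu> - x) s else dist_bound (x - \<nu>) s + ?r))
          * indicator {a..b} \<nu> \<le> ennreal (C + ?r + R' (x - \<nu>)) * indicator {a..x} \<nu> +
            ennreal (C + ?q + R' (\<nu> - x)) * indicator {x..b} \<nu>"
    proof cases
      case 1
      then have "\<nu> \<notin> {a..b}" by auto
      then show ?thesis by simp
    next
      case 2
      have "ennreal (C + (dist_bound (x - \<nu>) s + ?r)) \<le> ennreal (C + ?r + R' (x - \<nu>))"
        using R'_ge[of "x - \<nu>"] 2 by (intro ennreal_leI) simp
      then show ?thesis using 2 x by (simp add: add_increasing2)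
    next
      case 3
      have "ennreal (C + (?q + dist_bound (\<nu> - x) s)) \<le> ennreal (C + ?q + R' (\<nu> - x))"
        using R'_ge[of "\<nu> - x"] 3 by (intro ennreal_leI) simp
      then show ?thesis using 3 x by simp
    qed
  qed
  also have "\<dots> = (\<integral>\<^sup>+\<nu>. ennreal (C + ?r + R' (x - \<nu>)) * indicator {a..x} \<nu> \<partial>lborel) +
      (\<integral>\<^sup>+\<nu>. ennreal (C + ?q + R' (\<nu> - x)) * indicator {x..b} \<nu> \<partial>lborel)"
    by (rule nn_integral_add) measurable
  also have "(\<integral>\<^sup>+\<nu>. ennreal (C + ?r + R' (x - \<nu>)) * indicator {a..x} \<nu> \<partial>lborel) =
      ennreal (((C + ?r) * x - R (x - x)) - ((C + ?r) * a - R (x - a)))"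
    by (rule nn_integral_FTC_Icc[where F="\<lambda>\<nu>. (C + ?r) * \<nu> - R (x - \<nu>)"])
      (use x C qr R'_nonneg D1 in auto)
  also have "(\<integral>\<^sup>+\<nu>. ennreal (C + ?q + R' (\<nu> - x)) * indicator {x..b} \<nu> \<partial>lborel) =
      ennreal (((C + ?q) * b + R (b - x)) - ((C + ?q) * x + R (x - x)))"
    by (rule nn_integral_FTC_Icc[where F="\<lambda>\<nu>. (C + ?q) * \<nu> + R (\<nu> - x)"])
      (use x C qr R'_nonneg D2 in auto)
  also have "((C + ?r) * x - R (x - x)) - ((C + ?r) * a - R (x - a)) = (C + ?r) * (x - a) + R (x - a)"
    by (simp add: R0 algebra_simps)
  also have "((C + ?q) * b + R (b - x)) - ((C + ?q) * x + R (x - x)) = (C + ?q) * (b - x) + R (b - x)"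
    by (simp add: R0 algebra_simps)
  also have "ennreal ((C + ?r) * (x - a) + R (x - a)) + ennreal ((C + ?q) * (b - x) + R (b - x)) =
      ennreal (((C + ?r) * (x - a) + R (x - a)) + ((C + ?q) * (b - x) + R (b - x)))"
    using x C qr R_nonneg[of "x - a"] R_nonneg[of "b - x"]
    by (intro ennreal_plus[symmetric] add_nonneg_nonneg mult_nonneg_nonneg) auto
  also have "((C + ?r) * (x - a) + R (x - a)) + ((C + ?q) * (b - x) + R (b - x)) =
      (b - a) * (C + ?q + ?r) + dist_bound' (x - a) s + dist_bound' (b - x) s"
    by (simp add: R_def algebra_simps)
  finally show ?thesis .
qed

text \<open>The supersolution is a sum with one term for each face, and it is 0 on boxes without x.
  A cut in direction j affects only the two terms of that direction, which reduces the inequality to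
  one dimension.\<close>

lemma nn_integral_spread_split_cell_le:
  fixes A :: "'d::finite box"
  assumes "proper A" "\<tau> \<le> l" "x \<in> cbox (fst A) (snd A)"
  shows "(\<integral>\<^sup>+t. leaf_sum (\<lambda>B. ennreal (spread x B)) t A \<partial>split_cell m A \<tau> l) \<le>
    ennreal (\<Sum>j\<in>UNIV. dist_bound (x $ j - fst A $ j) (l - \<tau>) + dist_bound (snd A $ j - x $ j) (l - \<tau>))"
proof -
  define q where "q A j = x $ j - fst A $ j" for A :: "'d box" and j
  define r where "r A j = snd A $ j - x $ j" for A :: "'d box" and j
  define G where "G A s j = dist_bound (q A j) s + dist_bound (r A j) s" for A s j
  define \<Phi> where "\<Phi> A s = (if x \<in> cbox (fst A) (snd A) then \<Sum>j\<in>UNIV. G A s j else 0)" for A s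
  define \<Phi>' where "\<Phi>' A s = (if x \<in> cbox (fst A) (snd A)
      then \<Sum>j\<in>UNIV. dist_bound' (q A j) s + dist_bound' (r A j) s else 0)" for A s
  have qr: "0 \<le> q A j" "0 \<le> r A j" if "x \<in> cbox (fst A) (snd A)" for A j
    using that by (auto simp: q_def r_def mem_box_cart)
  have G_nonneg: "0 \<le> G A s j" for A s j
    by (simp add: G_def dist_bound_nonneg)
  have [measurable]: "(\<lambda>s. G A s j) \<in> borel_measurable borel" for A j
    unfolding G_def by measurable
  have balance: "lin_dim A * \<Phi> A s + \<Phi>' A s = (\<Sum>j\<in>UNIV. (snd A $ j - fst A $ j) * (\<Sum>j\<in>UNIV. G A s j) +
      dist_bound' (q A j) s + dist_bound' (r A j) s)"
    if "x \<in> cbox (fst A) (snd A)" "proper A" for A s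
    using that by (simp add: \<Phi>_def \<Phi>'_def lin_dim_def sum_distrib_right sum.distrib proper_side)
  have term_nonneg: "0 \<le> (snd A $ j - fst A $ j) * (\<Sum>j\<in>UNIV. G A s j) + dist_bound' (q A j) s + dist_bound' (r A j) s" 
    if True: "x \<in> cbox (fst A) (snd A)" and A: "proper A" and s: "0 \<le> s" for A s j
  proof -
    have "0 \<le> (q A j * dist_bound (q A j) s + dist_bound' (q A j) s) +
        (r A j * dist_bound (r A j) s + dist_bound' (r A j) s)"
      using qr[OF True] s by (intro add_nonneg_nonneg dist_bound_balance_nonneg) auto
    also have "\<dots> \<le> (q A j * G A s j + dist_bound' (q A j) s) + (r A j * G A s j + dist_bound' (r A j) s)"
      using qr[OF True, of j] by (intro add_mono mult_left_mono) (auto simp: G_def dist_bound_nonneg)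
    also have "\<dots> = (snd A $ j - fst A $ j) * G A s j + dist_bound' (q A j) s + dist_bound' (r A j) s"
      by (simp add: q_def r_def algebra_simps)
    also have "\<dots> \<le> (snd A $ j - fst A $ j) * (\<Sum>j\<in>UNIV. G A s j) + dist_bound' (q A j) s + dist_bound' (r A j) s"
      using A G_nonneg by (intro add_mono mult_left_mono member_le_sum) (auto simp: proper_def)
    finally show ?thesis .
  qed
  let ?I = "\<lambda>A j s. \<integral>\<^sup>+\<nu>. (ennreal (\<Phi> (lower_box A j \<nu>) s) + ennreal (\<Phi> (upper_box A j \<nu>) s))
      * indicator {fst A $ j .. snd A $ j} \<nu> \<partial>lborel"
  have "(\<integral>\<^sup>+t. leaf_sum (\<lambda>B. ennreal (spread x B)) t A \<partial>split_cell m A \<tau> l) \<le> ennreal (\<Phi> A (l - \<tau>))"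
  proof (rule nn_integral_leaf_sum_split_cell_le[where \<Phi>'=\<Phi>'])
    fix A :: "'d box" and s :: real assume A: "proper A" and s: "0 \<le> s"
    show "(\<Phi> A has_real_derivative \<Phi>' A s) (at s)"
      unfolding \<Phi>_def[abs_def] \<Phi>'_def G_def using qr[of A] s
      by (cases "x \<in> cbox (fst A) (snd A)") (auto intro!: derivative_intros has_derivative_dist_bound)
    show "0 \<le> lin_dim A * \<Phi> A s + \<Phi>' A s"
    proof (cases "x \<in> cbox (fst A) (snd A)")
      case True
      show ?thesis
        unfolding balance[OF True A] using term_nonneg[OF True A s] by (intro sum_nonneg) blast
    qed (simp add: \<Phi>_def \<Phi>'_def)
    show "(\<Sum>j\<in>UNIV. ?I A j s) \<le> ennreal (lin_dim A * \<Phi> A s + \<Phi>' A s)"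
    proof (cases "x \<in> cbox (fst A) (snd A)")
      case False
      \<comment> \<open>A box that does not contain x has no child that does.\<close>
      have "x \<notin> cbox (fst (lower_box A j \<nu>)) (snd (lower_box A j \<nu>)) \<and>
          x \<notin> cbox (fst (upper_box A j \<nu>)) (snd (upper_box A j \<nu>))" if "\<nu> \<in> {fst A $ j .. snd A $ j}" for j \<nu>
        using False that unfolding mem_box_cart lower_box_def upper_box_def
        by (auto split: if_splits) (metis order.trans)+
      then have "?I A j s = (\<integral>\<^sup>+(\<nu>::real). 0 \<partial>lborel)" for j
        by (intro nn_integral_cong) (auto simp: \<Phi>_def split: split_indicator)
      then show ?thesis by simp
    next
      case True
      have "?I A j s \<le>
        ennreal ((snd A $ j - fst A $ j) * (\<Sum>j\<in>UNIV. G A s j) + dist_bound' (q A j) s + dist_bound' (r A j) s)" for j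
      proof -
        define C where "C = (\<Sum>i\<in>UNIV - {j}. G A s i)"
        have "C \<ge> 0" unfolding C_def by (intro sum_nonneg G_nonneg)
        have sumG: "(\<Sum>i\<in>UNIV. G B s i) = (\<Sum>i\<in>UNIV - {j}. G B s i) + G B s j" for B
          by (subst sum.remove[of _ j]) auto
        have x: "fst A $ j \<le> x $ j" "x $ j \<le> snd A $ j" using True by (auto simp: mem_box_cart)
        \<comment> \<open>A threshold equal to the coordinate of x would put x into both closed
          children; such thresholds form a null set.\<close>
        have "AE \<nu> in lborel. \<nu> \<noteq> x $ j" by (rule AE_lborel_singleton)
        then have "?I A j s =
          (\<integral>\<^sup>+\<nu>. ennreal (C + (if x $ j < \<nu> then dist_bound (x $ j - fst A $ j) s + dist_bound (\<nu> - x $ j) s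
             else dist_bound (x $ j - \<nu>) s + dist_bound (snd A $ j - x $ j) s))
            * indicator {fst A $ j .. snd A $ j} \<nu> \<partial>lborel)"
        proof (intro nn_integral_cong_AE, elim eventually_mono)
          fix \<nu> assume neq: "\<nu> \<noteq> x $ j"
          show "(ennreal (\<Phi> (lower_box A j \<nu>) s) + ennreal (\<Phi> (upper_box A j \<nu>) s))
            * indicator {fst A $ j .. snd A $ j} \<nu> =
            ennreal (C + (if x $ j < \<nu> then dist_bound (x $ j - fst A $ j) s + dist_bound (\<nu> - x $ j) s
             else dist_bound (x $ j - \<nu>) s + dist_bound (snd A $ j - x $ j) s))
            * indicator {fst A $ j .. snd A $ j} \<nu>"
          proof (cases "\<nu> \<in> {fst A $ j .. snd A $ j}")
            case in_range: True
            have C: "(\<Sum>i\<in>UNIV - {j}. G (lower_box A j \<nu>) s i) = C" "(\<Sum>i\<in>UNIV - {j}. G (upper_box A j \<nu>) s i) = C"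
              unfolding C_def by (auto intro!: sum.cong simp: G_def q_def r_def lower_box_def upper_box_def)
            show ?thesis
            proof (cases "x $ j < \<nu>")
              case less: True
              have "x \<in> cbox (fst (lower_box A j \<nu>)) (snd (lower_box A j \<nu>))"
                 "x \<notin> cbox (fst (upper_box A j \<nu>)) (snd (upper_box A j \<nu>))"
                using less True by (auto simp: mem_box_cart lower_box_def upper_box_def intro!: exI[of _ j])
              then have "\<Phi> (lower_box A j \<nu>) s = C + (dist_bound (x $ j - fst A $ j) s + dist_bound (\<nu> - x $ j) s)"
                "\<Phi> (upper_box A j \<nu>) s = 0"
                by (auto simp: \<Phi>_def sumG[of "lower_box A j \<nu>"] C) (simp add: G_def q_def r_def lower_box_def)
              then show ?thesis using less by simp
            next
              case False
              with neq have less: "\<nu> < x $ j" by simp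
              have "x \<in> cbox (fst (upper_box A j \<nu>)) (snd (upper_box A j \<nu>))"
                 "x \<notin> cbox (fst (lower_box A j \<nu>)) (snd (lower_box A j \<nu>))"
                using less True by (auto simp: mem_box_cart lower_box_def upper_box_def intro!: exI[of _ j])
              then have "\<Phi> (upper_box A j \<nu>) s = C + (dist_bound (x $ j - \<nu>) s + dist_bound (snd A $ j - x $ j) s)"
                "\<Phi> (lower_box A j \<nu>) s = 0"
                by (auto simp: \<Phi>_def sumG[of "upper_box A j \<nu>"] C) (simp add: G_def q_def r_def upper_box_def)
              then show ?thesis using less by simp
            qed
          qed simp
        qed
        also have "\<dots> \<le> ennreal ((snd A $ j - fst A $ j) *
            (C + dist_bound (x $ j - fst A $ j) s + dist_bound (snd A $ j - x $ j) s) +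
            dist_bound' (x $ j - fst A $ j) s + dist_bound' (snd A $ j - x $ j) s)"
          by (rule nn_integral_dist_bound_split_le[OF x s \<open>C \<ge> 0\<close>])
        finally show ?thesis
          by (simp add: sumG[of A] C_def[symmetric]) (simp add: G_def q_def r_def add.assoc)
      qed
      then have "(\<Sum>j\<in>UNIV. ?I A j s) \<le>
        (\<Sum>j\<in>UNIV. ennreal ((snd A $ j - fst A $ j) * (\<Sum>j\<in>UNIV. G A s j) + dist_bound' (q A j) s + dist_bound' (r A j) s))"
        by (rule sum_mono)
      also have "\<dots> = ennreal (lin_dim A * \<Phi> A s + \<Phi>' A s)"
        unfolding balance[OF True A] using term_nonneg[OF True A s] by (subst sum_ennreal) auto
      finally show ?thesis .
    qed
  next
    fix A :: "'d box" assume "proper A"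
    show "ennreal (spread x A) \<le> ennreal (\<Phi> A 0)"
      by (auto simp: spread_def \<Phi>_def G_def q_def r_def dist_bound_def)
    show "0 \<le> \<Phi> A 0"
      by (simp add: \<Phi>_def sum_nonneg G_nonneg)
  next
    show "\<Phi> A \<in> borel_measurable borel" "\<Phi>' A \<in> borel_measurable borel" for A
      by (cases "x \<in> cbox (fst A) (snd A)"; simp add: \<Phi>_def[abs_def] \<Phi>'_def[abs_def])+
  next
    show "(\<lambda>B. ennreal (spread x B)) \<in> borel_measurable borel"
      by (rule measurable_compose[OF measurable_spread measurable_ennreal]) simp_all
  qed (fact assms(1,2))+
  also have "\<Phi> A (l - \<tau>) = (\<Sum>j\<in>UNIV. G A (l - \<tau>) j)"
    unfolding \<Phi>_def using assms(3) by (rule if_P)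
  finally show ?thesis unfolding G_def q_def r_def .
qed


section \<open>Leaf count and cell size for the unit cube\<close>

lemma proper_unit: "proper (0, 1 :: real ^ 'd::finite)"
  by (simp add: proper_def)

lemma measurable_leaf_sum_const:
  assumes "w \<in> borel_measurable borel"
  shows "(\<lambda>t. leaf_sum w t A) \<in> borel_measurable mtree_space"
  by (rule measurable_leaf_sum[of "\<lambda>_. w" "count_space UNIV", where p="\<lambda>_. ()"])
    (use assms in measurable)

lemma expected_leaves_MP_le:
  assumes "0 \<le> l"
  shows "(\<integral>\<^sup>+t. leaf_sum (\<lambda>_. 1) t (0, 1) \<partial>MP l (0, 1 :: real ^ 'd::finite)) \<le> ennreal ((1 + l) ^ CARD('d))"
  unfolding MP_def
proof (rule nn_integral_split_cell_law_le)
  show "(\<integral>\<^sup>+t. leaf_sum (\<lambda>_. 1) t (0, 1) \<partial>split_cell m (0, 1 :: real ^ 'd) 0 l) \<le> ennreal ((1 + l) ^ CARD('d))" for m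
    using expected_leaves_split_cell_le[OF proper_unit assms, of m] by (simp add: side_eq)
qed (rule measurable_leaf_sum_const, simp)

text \<open>Each direction has two faces, and each face contributes at most
  \<open>9 / l\<^sup>2\<close> at whatever distance it starts.\<close>

lemma expected_spread_MP_le:
  fixes x :: "real ^ 'd::finite"
  assumes "0 < l" "x \<in> cbox 0 1"
  shows "(\<integral>\<^sup>+t. leaf_sum (\<lambda>B. ennreal (spread x B)) t (0, 1) \<partial>MP l (0, 1)) \<le> ennreal (18 * CARD('d) / l\<^sup>2)"
  unfolding MP_def
proof (rule nn_integral_split_cell_law_le)
  fix m
  have "(\<integral>\<^sup>+t. leaf_sum (\<lambda>B. ennreal (spread x B)) t (0, 1) \<partial>split_cell m (0, 1) 0 l) \<le>
      ennreal (\<Sum>j\<in>UNIV. dist_bound (x $ j) l + dist_bound (1 - x $ j) l)"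
    using nn_integral_spread_split_cell_le[OF proper_unit, of 0 l x m] assms by simp
  also have "\<dots> \<le> ennreal (\<Sum>(j::'d)\<in>UNIV. 9 / l\<^sup>2 + 9 / l\<^sup>2)"
    using assms by (intro ennreal_leI sum_mono add_mono dist_bound_le) (auto simp: mem_box_cart)
  finally show "(\<integral>\<^sup>+t. leaf_sum (\<lambda>B. ennreal (spread x B)) t (0, 1) \<partial>split_cell m (0, 1) 0 l) \<le>
      ennreal (18 * CARD('d) / l\<^sup>2)"
    by (simp add: mult_ac)
qed (intro measurable_leaf_sum_const measurable_compose[OF measurable_spread measurable_ennreal]; simp)

section \<open>Risk of a fixed tree partition\<close>

text \<open>Replaces the set-valued recursion of \<open>leaf_cell\<close> by a predicate that is
  jointly measurable in the tree and both points.\<close>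

primrec same_leaf :: "'d mtree \<Rightarrow> real ^ 'd::finite \<Rightarrow> real ^ 'd \<Rightarrow> bool" where
  "same_leaf Leaf x y \<longleftrightarrow> True"
| "same_leaf (Node lt s rt) x y \<longleftrightarrow>
     (if x $ fst s \<le> snd s then y $ fst s \<le> snd s \<and> same_leaf lt x y
      else y $ fst s > snd s \<and> same_leaf rt x y)"

lemma leaf_cell_eq: "leaf_cell t A x = {y \<in> A. same_leaf t x y}"
  by (induction t arbitrary: A) auto

lemma measurable_same_leaf [measurable (raw)]:
  fixes x y :: "'x \<Rightarrow> real ^ 'd::finite"
  assumes t: "t \<in> M \<rightarrow>\<^sub>M mtree_space" and [measurable]: "x \<in> borel_measurable M" "y \<in> borel_measurable M"
  shows "Measurable.pred M (\<lambda>z. same_leaf (t z) (x z) (y z))"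
proof -
  have eq: "same_leaf t x y = rec_tree True (\<lambda>l s r a b. if x $ fst s \<le> snd s then y $ fst s \<le> snd s \<and> a
      else y $ fst s > snd s \<and> b) t" for t and x y :: "real ^ 'd"
    by (induction t) auto
  show ?thesis
    unfolding eq
  proof (rule measurable_rec_tree[OF t[unfolded mtree_space_def]])
    let ?B = "M \<Otimes>\<^sub>M tree_sigma (count_space UNIV \<Otimes>\<^sub>M borel) \<Otimes>\<^sub>M (count_space UNIV \<Otimes>\<^sub>M borel) \<Otimes>\<^sub>M
      tree_sigma (count_space UNIV \<Otimes>\<^sub>M borel) \<Otimes>\<^sub>M count_space UNIV \<Otimes>\<^sub>M count_space UNIV"
    have [measurable]: "(\<lambda>z. fst (fst (snd (snd z)))) \<in> ?B \<rightarrow>\<^sub>M count_space (UNIV :: 'd set)"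
      by measurable
    have nth: "(\<lambda>z. x (fst z) $ fst (fst (snd (snd z)))) \<in> borel_measurable ?B"
      if [measurable]: "x \<in> borel_measurable M" for x :: "'x \<Rightarrow> real ^ 'd"
      by (rule measurable_compose_countable'[where g="\<lambda>z. fst (fst (snd (snd z)))" and I=UNIV])
        (auto intro: countable_finite)
    note [measurable] = nth[OF assms(2)] nth[OF assms(3)]
    show "(\<lambda>(z, l, s, r, a, b). if x z $ fst s \<le> snd s then y z $ fst s \<le> snd s \<and> a
      else y z $ fst s > snd s \<and> b) \<in> ?B \<rightarrow>\<^sub>M count_space UNIV"
      unfolding case_prod_unfold by measurable
  qed simp
qed

text \<open>The leaf reached by x is one of the summands and the others are nonnegative. The
  half-open cell A is tracked together with a closed box B around it, since \<open>leaf_sum\<close>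
  works with closed boxes.\<close>

lemma dist_leaf_cell_le:
  fixes x :: "real ^ 'd::finite"
  assumes "A \<subseteq> cbox (fst B) (snd B)" "x \<in> A" "y \<in> leaf_cell t A x"
  shows "ennreal ((dist x y)\<^sup>2) \<le> leaf_sum (\<lambda>B. ennreal (spread x B)) t B"
  using assms
proof (induction t arbitrary: A B)
  case Leaf
  have "(dist x y)\<^sup>2 = (\<Sum>j\<in>UNIV. (x $ j - y $ j)\<^sup>2)"
    by (simp add: dist_vec_def L2_set_def dist_real_def sum_nonneg)
  also have "\<dots> \<le> (\<Sum>j\<in>UNIV. (x $ j - fst B $ j)\<^sup>2 + (snd B $ j - x $ j)\<^sup>2)"
  proof (rule sum_mono)
    fix j
    have "fst B $ j \<le> y $ j" "y $ j \<le> snd B $ j" "fst B $ j \<le> x $ j" "x $ j \<le> snd B $ j"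
      using Leaf by (auto simp: subset_iff mem_box_cart)
    \<comment> \<open>The point y lies between x and one of the two faces, so the distance to that
      face dominates.\<close>
    then have "(x $ j - y $ j)\<^sup>2 \<le> (x $ j - fst B $ j)\<^sup>2 \<or> (x $ j - y $ j)\<^sup>2 \<le> (snd B $ j - x $ j)\<^sup>2"
      by (cases "y $ j \<le> x $ j") (auto simp: abs_le_square_iff[symmetric])
    then show "(x $ j - y $ j)\<^sup>2 \<le> (x $ j - fst B $ j)\<^sup>2 + (snd B $ j - x $ j)\<^sup>2"
      by (auto intro: add_increasing add_increasing2)
  qed
  also have "\<dots> = spread x B"
    using Leaf by (auto simp: spread_def)
  finally show ?case by (simp add: ennreal_leI)
next
  case (Node lt s rt)
  show ?case
  proof (cases "x $ fst s \<le> snd s")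
    case True
    have "{y \<in> A. y $ fst s \<le> snd s} \<subseteq> cbox (fst (lower_box B (fst s) (snd s))) (snd (lower_box B (fst s) (snd s)))"
      using Node.prems(1) by (auto simp: lower_box_def mem_box_cart subset_iff)
    from Node.IH(1)[OF this] Node.prems True show ?thesis
      by (auto intro: add_increasing2)
  next
    case False
    have "{y \<in> A. y $ fst s > snd s} \<subseteq> cbox (fst (upper_box B (fst s) (snd s))) (snd (upper_box B (fst s) (snd s)))"
      using Node.prems(1) by (auto simp: upper_box_def mem_box_cart subset_iff intro: less_imp_le)
    from Node.IH(2)[OF this] Node.prems False show ?thesis
      by (auto intro: add_increasing)
  qed
qed

text \<open>Over a cell of positive mass the inverse of that mass integrates to 1. Over a cell of
  mass 0 the integrand is infinite on a null set and contributes nothing. The integral thus counts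
  the cells of positive mass. The box B is arbitrary because the constant weight ignores it.\<close>

lemma nn_integral_inverse_leaf_cell_le:
  fixes Q :: "(real ^ 'd::finite) measure"
  assumes "prob_space Q" and sets [measurable_cong]: "sets Q = sets borel" and A: "A \<in> sets borel"
  shows "(\<integral>\<^sup>+x. indicator A x * inverse (emeasure Q (leaf_cell t A x)) \<partial>Q) \<le> leaf_sum (\<lambda>_. 1) t B"
  using A
proof (induction t arbitrary: A B)
  case Leaf
  interpret prob_space Q by fact
  have "(\<integral>\<^sup>+x. indicator A x * inverse (emeasure Q A) \<partial>Q) = inverse (emeasure Q A) * emeasure Q A"
    using Leaf by (subst mult.commute) (simp add: nn_integral_cmult_indicator sets)
  also have "\<dots> \<le> 1"
    by (cases "emeasure Q A = 0") (auto simp: ennreal_inverse_mult emeasure_eq_measure inverse_ennreal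
        ennreal_mult[symmetric] zero_less_measure_iff less_le)
  finally show ?case by simp
next
  case (Node lt s rt)
  interpret prob_space Q by fact
  note [measurable] = Node.prems
  define A1 where "A1 = {y \<in> A. y $ fst s \<le> snd s}"
  define A2 where "A2 = {y \<in> A. y $ fst s > snd s}"
  have [measurable]: "A1 \<in> sets borel" "A2 \<in> sets borel"
    unfolding A1_def A2_def by measurable
  have m: "(\<lambda>x. inverse (emeasure Q (leaf_cell t' C x))) \<in> borel_measurable Q"
    if [measurable]: "C \<in> sets borel" for t' C
  proof -
    have "{z \<in> space (Q \<Otimes>\<^sub>M Q). snd z \<in> C \<and> same_leaf t' (fst z) (snd z)} \<in> sets (Q \<Otimes>\<^sub>M Q)"
      by measurable
    from measurable_emeasure_Pair[OF this] show ?thesis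
      using sets_eq_imp_space_eq[OF sets] by (simp add: leaf_cell_eq vimage_def space_pair_measure)
  qed
  have "(\<integral>\<^sup>+x. indicator A x * inverse (emeasure Q (leaf_cell (Node lt s rt) A x)) \<partial>Q) =
     (\<integral>\<^sup>+x. indicator A1 x * inverse (emeasure Q (leaf_cell lt A1 x)) +
       indicator A2 x * inverse (emeasure Q (leaf_cell rt A2 x)) \<partial>Q)"
    by (intro nn_integral_cong) (auto simp: A1_def A2_def split: split_indicator)
  also have "\<dots> = (\<integral>\<^sup>+x. indicator A1 x * inverse (emeasure Q (leaf_cell lt A1 x)) \<partial>Q) +
      (\<integral>\<^sup>+x. indicator A2 x * inverse (emeasure Q (leaf_cell rt A2 x)) \<partial>Q)"
    by (rule nn_integral_add) (auto intro!: borel_measurable_times_ennreal m)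
  also have "\<dots> \<le> leaf_sum (\<lambda>_. 1) (Node lt s rt) B"
    unfolding leaf_sum.simps by (intro add_mono Node.IH) auto
  finally show ?case .
qed

lemma tree_estimate_eq:
  "tree_estimate D n t x =
    (\<Sum>i=1..n. of_bool (fst (D i) \<in> leaf_cell t (cbox 0 1) x \<and> snd (D i) = 1)) /
    (\<Sum>i=1..n. of_bool (fst (D i) \<in> leaf_cell t (cbox 0 1) x))"
proof -
  let ?N = "{i \<in> {1..n}. fst (D i) \<in> leaf_cell t (cbox 0 1) x}"
  have "{i \<in> ?N. snd (D i) = 1} = {i \<in> {1..n}. fst (D i) \<in> leaf_cell t (cbox 0 1) x \<and> snd (D i) = 1}"
    by auto
  then show ?thesis
    unfolding tree_estimate_def Let_def
    by (auto simp: sum_of_bool_eq Int_def)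
qed

text \<open>With \<open>g\<close> the local average and \<open>N\<close> the cell count, \<open>N (g - e)\<close> is the centred label sum; so
  \<open>q (g - e)\<close> equals that sum up to \<open>(N - q)(g - e)\<close>. This avoids the random denominator.\<close>

lemma local_average_error_le:
  fixes b :: "'i \<Rightarrow> bool" and y :: "'i \<Rightarrow> real"
  assumes "finite I" "\<And>i. i \<in> I \<Longrightarrow> y i \<in> {0, 1}" "0 \<le> e" "e \<le> 1"
  defines "g \<equiv> (\<Sum>i\<in>I. of_bool (b i \<and> y i = 1)) / (\<Sum>i\<in>I. of_bool (b i))"
  shows "q\<^sup>2 * (e - g)\<^sup>2 \<le> 2 * (\<Sum>i\<in>I. of_bool (b i) * (y i - e))\<^sup>2 + 2 * ((\<Sum>i\<in>I. of_bool (b i)) - q)\<^sup>2"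
proof -
  define N :: real where "N = (\<Sum>i\<in>I. of_bool (b i))"
  define S where "S = (\<Sum>i\<in>I. of_bool (b i) * (y i - e))"
  define Z :: real where "Z = (\<Sum>i\<in>I. of_bool (b i \<and> y i = 1))"
  have Z: "0 \<le> Z" "Z \<le> N"
    unfolding Z_def N_def by (auto intro!: sum_nonneg sum_mono)
  have "Z = (\<Sum>i\<in>I. of_bool (b i) * y i)"
    unfolding Z_def using assms(2) by (intro sum.cong) auto
  then have S: "S = Z - N * e"
    by (simp add: S_def N_def right_diff_distrib sum_subtractf sum_distrib_right)
  have g: "g = Z / N" by (simp add: g_def Z_def N_def)
  \<comment> \<open>For an empty cell N = 0 forces Z = 0, so this also covers the default value 0 of
    the quotient.\<close>
  have Ng: "N * g = Z" using Z by (auto simp: g)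
  have "0 \<le> g" "g \<le> 1" using Z by (auto simp: g divide_le_eq_1)
  then have "\<bar>e - g\<bar> \<le> 1" using assms(3,4) by linarith
  then have le1: "(e - g)\<^sup>2 \<le> 1" by (simp add: abs_square_le_1)
  have "q * (e - g) = - S - (N - q) * (e - g)"
    using Ng S by (simp add: algebra_simps)
  then have "q\<^sup>2 * (e - g)\<^sup>2 = (- S - (N - q) * (e - g))\<^sup>2"
    by (simp add: power_mult_distrib[symmetric])
  also have "\<dots> \<le> 2 * S\<^sup>2 + 2 * ((N - q) * (e - g))\<^sup>2"
    using sum_squares_bound[of "S" "(N - q) * (e - g)"] by (simp add: power2_eq_square algebra_simps)
  also have "((N - q) * (e - g))\<^sup>2 \<le> (N - q)\<^sup>2"
    using mult_left_mono[OF le1, of "(N - q)\<^sup>2"] by (simp add: power_mult_distrib)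
  finally show ?thesis by (simp add: S_def N_def)
qed

text \<open>Expanding the square, independence turns the off-diagonal terms into squares of the
  mean. Adding the missing diagonal squares completes them to the square of the mean of the
  sum.\<close>

lemma second_moment_sum_PiM_le:
  fixes \<psi> :: "'a \<Rightarrow> real"
  assumes "prob_space P" and [measurable]: "\<psi> \<in> borel_measurable P" and b: "\<And>z. z \<in> space P \<Longrightarrow> \<bar>\<psi> z\<bar> \<le> 1" and "finite I"
  shows "(\<integral>D. (\<Sum>i\<in>I. \<psi> (D i))\<^sup>2 \<partial>PiM I (\<lambda>_. P)) \<le>
    card I * (\<integral>z. (\<psi> z)\<^sup>2 \<partial>P) + (card I * (\<integral>z. \<psi> z \<partial>P))\<^sup>2"
proof -
  interpret P: prob_space P by fact
  interpret product_sigma_finite "\<lambda>_. P" ..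
  interpret PI: prob_space "PiM I (\<lambda>_. P)" by (intro prob_space_PiM P.prob_space_axioms)
  define m where "m = (\<integral>z. \<psi> z \<partial>P)"
  define v where "v = (\<integral>z. (\<psi> z)\<^sup>2 \<partial>P)"
  have "integrable P \<psi>"
    by (rule P.integrable_const_bound[where B=1]) (use b in auto)
  have b2: "\<bar>(\<psi> z)\<^sup>2\<bar> \<le> 1" if "z \<in> space P" for z
    using b[OF that] by (simp add: abs_square_le_1)
  have int2: "integrable P (\<lambda>z. (\<psi> z)\<^sup>2)"
    by (rule P.integrable_const_bound[where B=1]) (use b2 in auto)
  have "0 \<le> v" unfolding v_def by (intro integral_nonneg_AE) auto
  have pair: "(\<integral>D. \<psi> (D i) * \<psi> (D j) \<partial>PiM I (\<lambda>_. P)) = (if i = j then v else m\<^sup>2)" if ij: "i \<in> I" "j \<in> I" for i j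
  proof -
    \<comment> \<open>Writes the product of two coordinates as a product over all of I, so that one
      product formula serves the diagonal and the off-diagonal terms.\<close>
    define f where "f k = (if k = i \<and> k = j then (\<lambda>z. (\<psi> z)\<^sup>2) else if k = i \<or> k = j then \<psi> else (\<lambda>_. 1))" for k
    have P2: "(\<Prod>k\<in>I. h k) = (if i = j then h i else h i * h j)" if "\<And>k. k \<in> I \<Longrightarrow> k \<noteq> i \<Longrightarrow> k \<noteq> j \<Longrightarrow> h k = 1" for h :: "'b \<Rightarrow> real"
    proof -
      have "(\<Prod>k\<in>I. h k) = (\<Prod>k\<in>{i, j}. h k)"
        using that ij \<open>finite I\<close> by (intro prod.mono_neutral_right) auto
      then show ?thesis by simp
    qed
    have "(\<integral>D. (\<Prod>k\<in>I. f k (D k)) \<partial>PiM I (\<lambda>_. P)) = (\<Prod>k\<in>I. \<integral>z. f k z \<partial>P)"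
      by (rule product_integral_prod) (use \<open>finite I\<close> \<open>integrable P \<psi>\<close> int2 in \<open>auto simp: f_def\<close>)
    also have "(\<lambda>D. \<Prod>k\<in>I. f k (D k)) = (\<lambda>D. \<psi> (D i) * \<psi> (D j))"
      by (rule ext, subst P2) (auto simp: f_def power2_eq_square)
    also have "(\<Prod>k\<in>I. \<integral>z. f k z \<partial>P) = (if i = j then v else m\<^sup>2)"
      by (subst P2) (auto simp: f_def v_def m_def power2_eq_square P.prob_space)
    finally show ?thesis .
  qed
  have int: "integrable (PiM I (\<lambda>_. P)) (\<lambda>D. \<psi> (D i) * \<psi> (D j))" if ij: "i \<in> I" "j \<in> I" for i j
  proof (rule PI.integrable_const_bound[where B=1])
    have "\<bar>\<psi> (D i) * \<psi> (D j)\<bar> \<le> 1" if "D \<in> space (PiM I (\<lambda>_. P))" for D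
      using ij that b[of "D i"] b[of "D j"] by (auto simp: abs_mult space_PiM PiE_iff intro!: mult_le_one)
    then show "AE D in PiM I (\<lambda>_. P). norm (\<psi> (D i) * \<psi> (D j)) \<le> 1" by auto
  qed (use ij in measurable)
  have "(\<integral>D. (\<Sum>i\<in>I. \<psi> (D i))\<^sup>2 \<partial>PiM I (\<lambda>_. P)) = (\<integral>D. (\<Sum>i\<in>I. \<Sum>j\<in>I. \<psi> (D i) * \<psi> (D j)) \<partial>PiM I (\<lambda>_. P))"
    by (simp add: power2_eq_square sum_product)
  also have "\<dots> = (\<Sum>i\<in>I. \<Sum>j\<in>I. if i = j then v else m\<^sup>2)"
    using int pair by (simp add: Bochner_Integration.integral_sum)
  also have "\<dots> \<le> (\<Sum>i\<in>I. \<Sum>j\<in>I. (if i = j then v else 0) + m\<^sup>2)"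
    using \<open>0 \<le> v\<close> by (intro sum_mono) auto
  also have "\<dots> = card I * v + (card I * m)\<^sup>2"
    using \<open>finite I\<close> by (simp add: sum.distrib power2_eq_square algebra_simps)
  finally show ?thesis by (simp add: v_def m_def)
qed


text \<open>The regression property is kept in integrated form, tested on events about X. This form
  is available both for the law of the data and for the members of
  \<open>lipschitz_class\<close>.\<close>

locale regression_model =
  fixes P :: "((real ^ 'd::finite) \<times> real) measure" and \<eta> :: "real ^ 'd \<Rightarrow> real" and L :: real
  assumes prob_space_P: "prob_space P" and sets_P: "sets P = sets obs_space"
    and range: "x \<in> cbox 0 1 \<Longrightarrow> \<eta> x \<in> {0..1}" and lipschitz: "L-lipschitz_on (cbox 0 1) \<eta>"
    and regression: "A \<in> sets borel \<Longrightarrow>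
      (\<integral>z. indicator A (fst z) * snd z \<partial>P) = (\<integral>z. indicator A (fst z) * \<eta> (fst z) \<partial>P)"
begin

sublocale prob_space P by (rule prob_space_P)

lemma space_P: "space P = cbox 0 1 \<times> {0, 1}"
  using sets_eq_imp_space_eq[OF sets_P] by (simp add: obs_space_def space_restrict_space)

lemma measurable_P_borel: "f \<in> borel_measurable borel \<Longrightarrow> f \<in> borel_measurable P"
  unfolding measurable_cong_sets[OF sets_P refl] obs_space_def by (rule measurable_restrict_space1)

lemma measurable_fst_P [measurable]: "fst \<in> borel_measurable P"
  and measurable_snd_P [measurable]: "snd \<in> borel_measurable P"
  by (intro measurable_P_borel, measurable)+

lemma measurable_eta [measurable]: "(\<lambda>z. \<eta> (fst z)) \<in> borel_measurable P"
proof -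
  have "continuous_on (cbox 0 1 \<times> {0, 1::real}) (\<lambda>z. \<eta> (fst z))"
    by (rule continuous_on_compose2[OF lipschitz_on_continuous_on[OF lipschitz]])
      (auto intro!: continuous_intros)
  from borel_measurable_continuous_on_restrict[OF this] show ?thesis
    unfolding measurable_cong_sets[OF sets_P refl] obs_space_def .
qed

text \<open>Applies \<open>local_average_error_le\<close> with q = n p, the mean of the cell count.
  The second moment of the label sum is at most n p plus the square of its mean, and that mean is at
  most n p L \<delta>; the centred count has second moment at most n p. Dividing by q^2 gives 4 / (n
  p) for the fluctuations and 2 (L \<delta>)^2 for the bias.\<close>

lemma local_average_risk_le:
  fixes C :: "(real ^ 'd) set" and n :: nat and p \<delta> :: real
  assumes C [measurable]: "C \<in> sets borel" and x: "x \<in> cbox 0 1"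
    and \<delta>: "\<And>y. y \<in> C \<Longrightarrow> y \<in> cbox 0 1 \<and> dist x y \<le> \<delta>"
    and p: "p = measure P {z \<in> space P. fst z \<in> C}" "0 < p" and n: "0 < n"
    and g: "\<And>D. g D = (\<Sum>i=1..n. of_bool (fst (D i) \<in> C \<and> snd (D i) = 1)) / (\<Sum>i=1..n. of_bool (fst (D i) \<in> C))"
  shows "(\<integral>\<^sup>+D. ennreal ((\<eta> x - g D)\<^sup>2) \<partial>PiM {1..n} (\<lambda>_. P)) \<le> ennreal (4 / (n * p) + 2 * (L * \<delta>)\<^sup>2)"
proof -
  let ?\<Pi> = "PiM {1..n} (\<lambda>_. P)"
  define \<psi>1 where "\<psi>1 z = of_bool (fst z \<in> C) * (snd z - \<eta> x)" for z :: "(real ^ 'd) \<times> real"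
  define \<psi>2 :: "(real ^ 'd) \<times> real \<Rightarrow> real" where "\<psi>2 z = of_bool (fst z \<in> C) - p" for z
  have p1: "p \<le> 1" unfolding p by (rule prob_le_1)
  have ind: "indicator C (fst z) = (of_bool (fst z \<in> C) :: real)" for z :: "(real ^ 'd) \<times> real"
    by simp
  have [measurable]: "(\<lambda>z. of_bool (fst z \<in> C) :: real) \<in> borel_measurable P"
    unfolding of_bool_def by measurable
  have m1 [measurable]: "\<psi>1 \<in> borel_measurable P" unfolding \<psi>1_def by measurable
  have m2 [measurable]: "\<psi>2 \<in> borel_measurable P" unfolding \<psi>2_def by measurable
  have b1: "\<bar>\<psi>1 z\<bar> \<le> of_bool (fst z \<in> C)" if "z \<in> space P" for z
    using that range[OF x] by (auto simp: \<psi>1_def space_P)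
  have b1': "\<bar>\<psi>1 z\<bar> \<le> 1" if "z \<in> space P" for z
    using b1[OF that] by (rule order_trans) simp
  have b2: "\<bar>\<psi>2 z\<bar> \<le> 1" for z
    using p1 p(2) by (auto simp: \<psi>2_def)
  have int_bounded: "integrable P f" if [measurable]: "f \<in> borel_measurable P" and "\<And>z. z \<in> space P \<Longrightarrow> \<bar>f z\<bar> \<le> 1" for f :: "_ \<Rightarrow> real"
    by (rule integrable_const_bound[where B=1]) (use that in auto)
  have EC: "(\<integral>z. of_bool (fst z \<in> C) \<partial>P) = p"
  proof -
    have "(\<integral>z. of_bool (fst z \<in> C) \<partial>P) = (\<integral>z. indicator {z \<in> space P. fst z \<in> C} z \<partial>P)"
      by (intro Bochner_Integration.integral_cong) auto
    also have "\<dots> = measure P ({z \<in> space P. fst z \<in> C} \<inter> space P)"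
      by (rule Bochner_Integration.integral_indicator)
    also have "{z \<in> space P. fst z \<in> C} \<inter> space P = {z \<in> space P. fst z \<in> C}" by auto
    finally show ?thesis unfolding p .
  qed
  have E\<psi>1: "\<bar>\<integral>z. \<psi>1 z \<partial>P\<bar> \<le> p * (L * \<delta>)"
  proof -
    have i: "integrable P (\<lambda>z. of_bool (fst z \<in> C) * snd z)" "integrable P (\<lambda>z. of_bool (fst z \<in> C) * \<eta> (fst z))"
       "integrable P (\<lambda>z. of_bool (fst z \<in> C) * \<eta> x)"
      using range x by (auto intro!: int_bounded simp: space_P) 
    have "(\<integral>z. \<psi>1 z \<partial>P) = (\<integral>z. of_bool (fst z \<in> C) * snd z \<partial>P) - (\<integral>z. of_bool (fst z \<in> C) * \<eta> x \<partial>P)"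
      unfolding \<psi>1_def right_diff_distrib by (rule Bochner_Integration.integral_diff[OF i(1,3)])
    \<comment> \<open>Tested on C, the regression property replaces the labels by \<eta>; what
      remains is the deviation of \<eta> from its value at x.\<close>
    also have "(\<integral>z. of_bool (fst z \<in> C) * snd z \<partial>P) = (\<integral>z. of_bool (fst z \<in> C) * \<eta> (fst z) \<partial>P)"
      using regression[OF C] by (simp only: ind)
    also have "\<dots> - (\<integral>z. of_bool (fst z \<in> C) * \<eta> x \<partial>P) = (\<integral>z. of_bool (fst z \<in> C) * (\<eta> (fst z) - \<eta> x) \<partial>P)"
      unfolding right_diff_distrib by (rule Bochner_Integration.integral_diff[OF i(2,3), symmetric])
    finally have "\<bar>\<integral>z. \<psi>1 z \<partial>P\<bar> \<le> (\<integral>z. \<bar>of_bool (fst z \<in> C) * (\<eta> (fst z) - \<eta> x)\<bar> \<partial>P)"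
      using integral_abs_bound[of P "\<lambda>z. of_bool (fst z \<in> C) * (\<eta> (fst z) - \<eta> x)"] by simp
    also have "\<dots> \<le> (\<integral>z. of_bool (fst z \<in> C) * (L * \<delta>) \<partial>P)"
    proof (rule integral_mono)
      show "integrable P (\<lambda>z. \<bar>of_bool (fst z \<in> C) * (\<eta> (fst z) - \<eta> x)\<bar>)"
        using Bochner_Integration.integrable_diff[OF i(2,3)] by (simp add: right_diff_distrib)
      show "integrable P (\<lambda>z. of_bool (fst z \<in> C) * (L * \<delta>))"
        by (intro integrable_mult_left int_bounded) auto
      fix z assume "z \<in> space P"
      have "\<bar>\<eta> (fst z) - \<eta> x\<bar> \<le> L * \<delta>" if "fst z \<in> C"
      proof -
        have "\<bar>\<eta> (fst z) - \<eta> x\<bar> \<le> L * dist (fst z) x"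
          using lipschitz_onD[OF lipschitz, of "fst z" x] \<delta>[OF that] x by (simp add: dist_real_def)
        also have "\<dots> \<le> L * \<delta>"
          using \<delta>[OF that] lipschitz_on_nonneg[OF lipschitz] by (intro mult_left_mono) (auto simp: dist_commute)
        finally show ?thesis .
      qed
      then show "\<bar>of_bool (fst z \<in> C) * (\<eta> (fst z) - \<eta> x)\<bar> \<le> of_bool (fst z \<in> C) * (L * \<delta>)" by auto
    qed
    also have "\<dots> = p * (L * \<delta>)" by (simp only: integral_mult_left_zero EC)
    finally show ?thesis .
  qed
  have E\<psi>1_sq: "(\<integral>z. (\<psi>1 z)\<^sup>2 \<partial>P) \<le> p"
  proof -
    have "(\<psi>1 z)\<^sup>2 \<le> of_bool (fst z \<in> C)" if "z \<in> space P" for z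
      using b1[OF that] by (auto simp: abs_square_le_1)
    moreover have "(\<psi>1 z)\<^sup>2 \<le> 1" if "z \<in> space P" for z
      using b1'[OF that] by (simp add: abs_square_le_1)
    ultimately have "(\<integral>z. (\<psi>1 z)\<^sup>2 \<partial>P) \<le> (\<integral>z. of_bool (fst z \<in> C) \<partial>P)"
      by (intro integral_mono int_bounded) auto
    then show ?thesis by (simp only: EC)
  qed
  have iC: "integrable P (\<lambda>z. of_bool (fst z \<in> C) :: real)"
    by (intro int_bounded) auto
  have E\<psi>2: "(\<integral>z. \<psi>2 z \<partial>P) = 0"
    unfolding \<psi>2_def using iC by (subst Bochner_Integration.integral_diff) (simp_all only: EC, simp_all add: prob_space)
  have E\<psi>2_sq: "(\<integral>z. (\<psi>2 z)\<^sup>2 \<partial>P) \<le> p"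
  proof -
    have "(\<psi>2 z)\<^sup>2 = (1 - 2 * p) * of_bool (fst z \<in> C) + p\<^sup>2" for z
      by (auto simp: \<psi>2_def power2_eq_square algebra_simps)
    then have "(\<integral>z. (\<psi>2 z)\<^sup>2 \<partial>P) = (\<integral>z. (1 - 2 * p) * of_bool (fst z \<in> C) + p\<^sup>2 \<partial>P)"
      by simp
    also have "\<dots> = (1 - 2 * p) * p + p\<^sup>2"
      using iC by (subst Bochner_Integration.integral_add) (simp_all only: EC integral_mult_right_zero, simp_all add: prob_space)
    also have "\<dots> \<le> p" by (simp add: power2_eq_square algebra_simps)
    finally show ?thesis .
  qed
  define q where "q = n * p"
  have q: "0 < q" using n p(2) by (simp add: q_def)
  interpret \<Pi>: prob_space ?\<Pi> by (intro prob_space_PiM prob_space_P)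
  define S1 where "S1 D = (\<Sum>i=1..n. \<psi>1 (D i))" for D
  define S2 where "S2 D = (\<Sum>i=1..n. \<psi>2 (D i))" for D
  have bS: "\<bar>S1 D\<bar> \<le> n" "\<bar>S2 D\<bar> \<le> n" if "D \<in> space ?\<Pi>" for D
  proof -
    have "D i \<in> space P" if "i \<in> {1..n}" for i
      using that \<open>D \<in> space ?\<Pi>\<close> by (auto simp: space_PiM PiE_iff)
    then have "\<bar>\<psi>1 (D i)\<bar> \<le> 1" if "i \<in> {1..n}" for i
      using b1'[of "D i"] that by blast
    then show "\<bar>S1 D\<bar> \<le> n" "\<bar>S2 D\<bar> \<le> n"
      unfolding S1_def S2_def using sum_bounded_above[of "{1..n}" "\<lambda>i. \<bar>\<psi>1 (D i)\<bar>" 1] sum_bounded_above[of "{1..n}" "\<lambda>i. \<bar>\<psi>2 (D i)\<bar>" 1] b2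
      by (auto intro: order_trans[OF sum_abs])
  qed
  have [measurable]: "S1 \<in> borel_measurable ?\<Pi>" "S2 \<in> borel_measurable ?\<Pi>"
    unfolding S1_def S2_def by measurable
  have int_sq: "integrable ?\<Pi> (\<lambda>D. (S D)\<^sup>2)"
    if [measurable]: "S \<in> borel_measurable ?\<Pi>" and S: "\<And>D. D \<in> space ?\<Pi> \<Longrightarrow> \<bar>S D\<bar> \<le> n"
    for S :: "(nat \<Rightarrow> (real ^ 'd) \<times> real) \<Rightarrow> real"
  proof (rule \<Pi>.integrable_const_bound[where B="(real n)\<^sup>2"])
    show "AE D in ?\<Pi>. norm ((S D)\<^sup>2) \<le> (real n)\<^sup>2"
    proof (rule AE_I2)
      fix D assume "D \<in> space ?\<Pi>"
      from S[OF this] show "norm ((S D)\<^sup>2) \<le> (real n)\<^sup>2"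
        by (simp add: abs_le_square_iff[symmetric])
    qed
  qed measurable
  have iS: "integrable ?\<Pi> (\<lambda>D. (S1 D)\<^sup>2)" "integrable ?\<Pi> (\<lambda>D. (S2 D)\<^sup>2)"
    using bS by (auto intro!: int_sq simp del: One_nat_def)
  have "q\<^sup>2 * (\<eta> x - g D)\<^sup>2 \<le> 2 * (S1 D)\<^sup>2 + 2 * (S2 D)\<^sup>2" if D: "D \<in> space ?\<Pi>" for D
  proof -
    have "D i \<in> space P" if "i \<in> {1..n}" for i
      using that D by (auto simp: space_PiM PiE_iff)
    then have "snd (D i) \<in> {0, 1}" if "i \<in> {1..n}" for i
      using that unfolding space_P by (auto simp: mem_Times_iff)
    then have "q\<^sup>2 * (\<eta> x - g D)\<^sup>2 \<le> 2 * (\<Sum>i=1..n. of_bool (fst (D i) \<in> C) * (snd (D i) - \<eta> x))\<^sup>2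
        + 2 * ((\<Sum>i=1..n. of_bool (fst (D i) \<in> C)) - q)\<^sup>2"
      unfolding g using range[OF x] by (intro local_average_error_le) auto
    also have "(\<Sum>i=1..n. of_bool (fst (D i) \<in> C)) - q = S2 D"
      by (simp add: S2_def \<psi>2_def sum_subtractf q_def del: sum_of_bool_eq)
    finally show ?thesis by (simp add: S1_def \<psi>1_def)
  qed
  then have "(\<eta> x - g D)\<^sup>2 \<le> (2 * (S1 D)\<^sup>2 + 2 * (S2 D)\<^sup>2) / q\<^sup>2" if D: "D \<in> space ?\<Pi>" for D
    using q D by (simp add: pos_le_divide_eq mult.commute)
  then have "(\<integral>\<^sup>+D. ennreal ((\<eta> x - g D)\<^sup>2) \<partial>?\<Pi>) \<le> (\<integral>\<^sup>+D. ennreal ((2 * (S1 D)\<^sup>2 + 2 * (S2 D)\<^sup>2) / q\<^sup>2) \<partial>?\<Pi>)"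
    by (intro nn_integral_mono ennreal_leI) (auto simp del: One_nat_def)
  also have "\<dots> = ennreal (\<integral>D. (2 * (S1 D)\<^sup>2 + 2 * (S2 D)\<^sup>2) / q\<^sup>2 \<partial>?\<Pi>)"
    using iS by (intro nn_integral_eq_integral) auto
  also have "(\<integral>D. (2 * (S1 D)\<^sup>2 + 2 * (S2 D)\<^sup>2) / q\<^sup>2 \<partial>?\<Pi>) = (2 * (\<integral>D. (S1 D)\<^sup>2 \<partial>?\<Pi>) + 2 * (\<integral>D. (S2 D)\<^sup>2 \<partial>?\<Pi>)) / q\<^sup>2"
    using iS by simp
  also have "\<dots> \<le> (2 * (n * p + (n * (p * (L * \<delta>)))\<^sup>2) + 2 * (n * p)) / q\<^sup>2"
  proof -
    have "(\<integral>D. (S1 D)\<^sup>2 \<partial>?\<Pi>) \<le> card {1..n} * (\<integral>z. (\<psi>1 z)\<^sup>2 \<partial>P) + (card {1..n} * (\<integral>z. \<psi>1 z \<partial>P))\<^sup>2"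
      unfolding S1_def by (rule second_moment_sum_PiM_le[OF prob_space_P m1]) (use b1' in auto)
    also have "\<dots> \<le> n * p + (n * (p * (L * \<delta>)))\<^sup>2"
    proof -
      have "\<bar>\<integral>z. \<psi>1 z \<partial>P\<bar> \<le> \<bar>p * (L * \<delta>)\<bar>"
        using E\<psi>1 abs_ge_self by (rule order_trans)
      then have "(\<integral>z. \<psi>1 z \<partial>P)\<^sup>2 \<le> (p * (L * \<delta>))\<^sup>2"
        by (simp only: abs_le_square_iff)
      then have "(n * (\<integral>z. \<psi>1 z \<partial>P))\<^sup>2 \<le> (n * (p * (L * \<delta>)))\<^sup>2"
        unfolding power_mult_distrib[of "real n"] by (rule mult_left_mono) simp
      then show ?thesis
        using mult_left_mono[OF E\<psi>1_sq, of n] by simp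
    qed
    finally have 1: "(\<integral>D. (S1 D)\<^sup>2 \<partial>?\<Pi>) \<le> n * p + (n * (p * (L * \<delta>)))\<^sup>2" .
    have "(\<integral>D. (S2 D)\<^sup>2 \<partial>?\<Pi>) \<le> card {1..n} * (\<integral>z. (\<psi>2 z)\<^sup>2 \<partial>P) + (card {1..n} * (\<integral>z. \<psi>2 z \<partial>P))\<^sup>2"
      unfolding S2_def by (rule second_moment_sum_PiM_le[OF prob_space_P m2 b2]) simp
    also have "\<dots> \<le> n * p"
      unfolding E\<psi>2 using E\<psi>2_sq by (simp add: mult_left_mono)
    finally show ?thesis
      using 1 by (intro divide_right_mono add_mono mult_left_mono) auto
  qed
  also have "\<dots> = 4 / (n * p) + 2 * (L * \<delta>)\<^sup>2"
    using n p(2) by (simp add: q_def field_simps power2_eq_square)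
  finally show ?thesis by (simp add: ennreal_leI)
qed

end

section \<open>Risk of a Mondrian tree\<close>

lemma tree_estimate_cong:
  "(\<And>i. i \<in> {1..n} \<Longrightarrow> D i = D' i) \<Longrightarrow> tree_estimate D n t x = tree_estimate D' n t x"
  unfolding tree_estimate_eq by (intro arg_cong2[where f="(/)"] sum.cong) auto

lemma tree_estimate_in_unit: "tree_estimate D n t x \<in> {0..1}"
proof -
  let ?a = "\<Sum>i=1..n. of_bool (fst (D i) \<in> leaf_cell t (cbox 0 1) x \<and> snd (D i) = 1) :: real"
  let ?b = "\<Sum>i=1..n. of_bool (fst (D i) \<in> leaf_cell t (cbox 0 1) x) :: real"
  have "0 \<le> ?a" by (intro sum_nonneg) simp
  moreover have "?a \<le> ?b" by (intro sum_mono) auto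
  ultimately show ?thesis
    unfolding tree_estimate_eq atLeastAtMost_iff
    by (intro conjI divide_nonneg_nonneg divide_le_eq_1[THEN iffD2]) linarith+
qed

lemma measurable_obs_fst [measurable]: "fst \<in> obs_space \<rightarrow>\<^sub>M borel"
  and measurable_obs_snd [measurable]: "snd \<in> obs_space \<rightarrow>\<^sub>M borel"
  unfolding obs_space_def by (intro measurable_restrict_space1; measurable)+

lemma measurable_tree_estimate [measurable (raw)]:
  assumes D: "D \<in> M \<rightarrow>\<^sub>M PiM {1..n} (\<lambda>_. obs_space)"
    and t [measurable]: "t \<in> M \<rightarrow>\<^sub>M mtree_space" and x [measurable]: "x \<in> borel_measurable M"
  shows "(\<lambda>\<omega>. tree_estimate (D \<omega>) n (t \<omega>) (x \<omega>)) \<in> borel_measurable M"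
proof -
  have Di: "(\<lambda>\<omega>. D \<omega> i) \<in> M \<rightarrow>\<^sub>M obs_space" if "i \<in> {1..n}" for i
    by (rule measurable_compose[OF D measurable_component_singleton[OF that]])
  have "Measurable.pred M (\<lambda>\<omega>. fst (D \<omega> i) \<in> leaf_cell (t \<omega>) (cbox 0 1) (x \<omega>))"
    "Measurable.pred M (\<lambda>\<omega>. fst (D \<omega> i) \<in> leaf_cell (t \<omega>) (cbox 0 1) (x \<omega>) \<and> snd (D \<omega> i) = 1)"
    if "i \<in> {1..n}" for i
  proof -
    note [measurable] = Di[OF that]
    show "Measurable.pred M (\<lambda>\<omega>. fst (D \<omega> i) \<in> leaf_cell (t \<omega>) (cbox 0 1) (x \<omega>))"
      unfolding leaf_cell_eq mem_Collect_eq by measurable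
    then show "Measurable.pred M (\<lambda>\<omega>. fst (D \<omega> i) \<in> leaf_cell (t \<omega>) (cbox 0 1) (x \<omega>) \<and> snd (D \<omega> i) = 1)"
      by measurable
  qed
  then show ?thesis
    unfolding tree_estimate_eq of_bool_def
    by (intro borel_measurable_divide borel_measurable_sum measurable_If) auto
qed

abbreviation tree_loss :: "(real ^ 'd::finite \<Rightarrow> real) \<Rightarrow> nat \<Rightarrow>
    (nat \<Rightarrow> (real ^ 'd) \<times> real) \<times> ((real ^ 'd) \<times> real) \<times> 'd mtree \<Rightarrow> ennreal" where
  "tree_loss \<eta> n \<equiv> \<lambda>\<omega>. ennreal ((\<eta> (fst (fst (snd \<omega>))) - tree_estimate (fst \<omega>) n (snd (snd \<omega>)) (fst (fst (snd \<omega>))))\<^sup>2)"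

context regression_model
begin

definition X_law :: "(real ^ 'd) measure" where "X_law = distr P borel fst"

lemma prob_space_X_law: "prob_space X_law"
  unfolding X_law_def by (rule prob_space_distr) measurable

lemma sets_X_law [simp, measurable_cong]: "sets X_law = sets borel"
  by (simp add: X_law_def)

text \<open>The radius of the cell around x is bounded by the square root of the leaf sum of
  \<open>spread\<close>. The cases of an empty cell mass and of an infinite leaf sum are trivial
  because the right-hand side is infinite, except when L = 0.\<close>

lemma tree_risk_at_le:
  assumes x: "x \<in> cbox 0 1" and n: "0 < n"
  shows "(\<integral>\<^sup>+D. ennreal ((\<eta> x - tree_estimate D n t x)\<^sup>2) \<partial>PiM {1..n} (\<lambda>_. P)) \<le>
    ennreal (4 / n) * inverse (emeasure X_law (leaf_cell t (cbox 0 1) x)) +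
    ennreal (2 * L\<^sup>2) * leaf_sum (\<lambda>B. ennreal (spread x B)) t (0, 1)" (is "?I \<le> ?R + _ * ?W")
proof -
  let ?C = "leaf_cell t (cbox 0 1) x"
  define p where "p = measure P {z \<in> space P. fst z \<in> ?C}"
  have t: "t \<in> space mtree_space" by simp
  have C: "?C \<in> sets borel"
  proof -
    have "{y \<in> space borel. y \<in> cbox 0 1 \<and> same_leaf t x y} \<in> sets borel"
      using t by measurable
    then show ?thesis by (simp add: leaf_cell_eq)
  qed
  have p: "emeasure X_law ?C = ennreal p"
    unfolding X_law_def p_def by (simp add: emeasure_distr C emeasure_eq_measure vimage_def Int_def conj_commute)
  have "0 \<le> p" by (simp add: p_def)
  show ?thesis
  proof (cases "p = 0")
    case True
    then have "?R = \<infinity>" using n unfolding p by (simp add: ennreal_mult_top)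
    then show ?thesis by simp
  next
    case False
    with \<open>0 \<le> p\<close> have "0 < p" by simp
    show ?thesis
    proof (cases "L = 0")
      \<comment> \<open>In \<open>ennreal\<close> the product of 0 and infinity is 0, so for L = 0
        an infinite leaf sum would not make the bound trivial. Any radius will do here, and the
        diameter of the cube is one that is surely finite.\<close>
      case True
      have "?I \<le> ennreal (4 / (n * p) + 2 * (L * sqrt (real CARD('d)))\<^sup>2)"
      proof (rule local_average_risk_le[OF C x _ p_def \<open>0 < p\<close> n tree_estimate_eq])
        fix y assume "y \<in> ?C"
        then have y: "y \<in> cbox 0 1" by (simp add: leaf_cell_eq)
        have "\<bar>x $ i - y $ i\<bar> \<le> 1" for i
        proof -
          have "0 \<le> x $ i" "x $ i \<le> 1" "0 \<le> y $ i" "y $ i \<le> 1"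
            using x y by (auto simp: mem_box_cart)
          then show ?thesis by linarith
        qed
        then have "dist x y \<le> sqrt (\<Sum>(i::'d)\<in>UNIV. 1)"
          unfolding dist_vec_def L2_set_def
          by (intro real_sqrt_le_mono sum_mono) (simp add: dist_real_def abs_square_le_1)
        then show "y \<in> cbox 0 1 \<and> dist x y \<le> sqrt (real CARD('d))" using y by simp
      qed
      then show ?thesis
        using True \<open>0 < p\<close> n unfolding p
        by (simp add: inverse_ennreal ennreal_mult'[symmetric] divide_inverse mult_ac)
    next
      case False
      show ?thesis
      proof (cases "?W = \<infinity>")
        case True
        then have "ennreal (2 * L\<^sup>2) * ?W = \<infinity>" using False by (simp add: ennreal_mult_top)
        then show ?thesis by simp
      next
        case False
        define w where "w = enn2real ?W"
        have W: "?W = ennreal w" and "0 \<le> w"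
          using False by (simp_all add: w_def less_top)
        have "?I \<le> ennreal (4 / (n * p) + 2 * (L * sqrt w)\<^sup>2)"
        proof (rule local_average_risk_le[OF C x _ p_def \<open>0 < p\<close> n tree_estimate_eq])
          fix y assume y: "y \<in> ?C"
          have "ennreal ((dist x y)\<^sup>2) \<le> ennreal w"
            using dist_leaf_cell_le[of "cbox 0 1" "(0, 1)" x y t] x y by (simp add: W)
          then have "(dist x y)\<^sup>2 \<le> w" using \<open>0 \<le> w\<close> by simp
          then show "y \<in> cbox 0 1 \<and> dist x y \<le> sqrt w"
            using y by (auto simp: leaf_cell_eq intro: real_le_rsqrt)
        qed
        also have "\<dots> = ?R + ennreal (2 * L\<^sup>2) * ?W"
          using \<open>0 < p\<close> \<open>0 \<le> w\<close> n unfolding p W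
          by (simp add: inverse_ennreal ennreal_mult'[symmetric] ennreal_plus[symmetric] divide_inverse power_mult_distrib mult_ac del: ennreal_plus)
        finally show ?thesis .
      qed
    qed
  qed
qed

lemma measurable_loss:
  "tree_loss \<eta> n
    \<in> borel_measurable (PiM {1..n} (\<lambda>_. P) \<Otimes>\<^sub>M (P \<Otimes>\<^sub>M MP l (0, 1)))"
proof -
  let ?\<Pi> = "PiM {1..n} (\<lambda>_. P)" and ?\<mu> = "MP l (0, 1 :: real ^ 'd)"
  have sets_\<Pi>: "sets ?\<Pi> = sets (PiM {1..n} (\<lambda>_. obs_space))"
    by (intro sets_PiM_cong refl sets_P)
  have "fst \<in> (?\<Pi> \<Otimes>\<^sub>M (P \<Otimes>\<^sub>M ?\<mu>)) \<rightarrow>\<^sub>M PiM {1..n} (\<lambda>_. obs_space)"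
    using measurable_fst[of ?\<Pi> "P \<Otimes>\<^sub>M ?\<mu>"] by (simp only: measurable_cong_sets[OF refl sets_\<Pi>])
  then have "(\<lambda>\<omega>. tree_estimate (fst \<omega>) n (snd (snd \<omega>)) (fst (fst (snd \<omega>)))) \<in> borel_measurable (?\<Pi> \<Otimes>\<^sub>M (P \<Otimes>\<^sub>M ?\<mu>))"
    by (rule measurable_tree_estimate) measurable
  moreover have "(\<lambda>\<omega>. \<eta> (fst (fst (snd \<omega>)))) \<in> borel_measurable (?\<Pi> \<Otimes>\<^sub>M (P \<Otimes>\<^sub>M ?\<mu>))"
    by (rule measurable_compose[OF _ measurable_eta]) measurable
  ultimately show ?thesis
    by (intro measurable_compose[OF _ measurable_ennreal] borel_measurable_power borel_measurable_diff)
qed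

text \<open>Tonelli is used in two orders. In the variance term X is integrated first, for a fixed
  tree, which yields the number of leaves. In the bias term the tree is integrated first, for a
  fixed point, which yields the expected squared cell size. The constant 36 is 2 times 18.\<close>

lemma mondrian_tree_risk_le:
  assumes \<mu>: "prob_space (MP l (0, 1 :: real ^ 'd))" (is "prob_space ?\<mu>") and l: "0 < l" and n: "0 < n"
  shows "(\<integral>\<^sup>+\<omega>. tree_loss \<eta> n \<omega>
      \<partial>(PiM {1..n} (\<lambda>_. P) \<Otimes>\<^sub>M (P \<Otimes>\<^sub>M MP l (0, 1))))
    \<le> ennreal (4 * (1 + l) ^ CARD('d) / n + 36 * L\<^sup>2 * CARD('d) / l\<^sup>2)" (is "?I \<le> _")
proof -
  let ?\<Pi> = "PiM {1..n} (\<lambda>_. P)"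
  interpret \<mu>: prob_space ?\<mu> by fact
  interpret \<Pi>: prob_space ?\<Pi> by (intro prob_space_PiM prob_space_P)
  interpret P\<mu>: pair_prob_space P ?\<mu> ..
  interpret \<Pi>P\<mu>: pair_prob_space ?\<Pi> "P \<Otimes>\<^sub>M ?\<mu>" ..
  interpret X: prob_space X_law by (rule prob_space_X_law)
  note loss = measurable_loss[of n l]
  let ?inv = "\<lambda>z t. inverse (emeasure X_law (leaf_cell t (cbox 0 1) (fst z)))"
  let ?W = "\<lambda>z t. leaf_sum (\<lambda>B. ennreal (spread (fst z) B)) t (0, 1)"
  have inv_m: "(\<lambda>\<omega>. ?inv (fst \<omega>) (snd \<omega>)) \<in> borel_measurable (P \<Otimes>\<^sub>M ?\<mu>)"
  proof -
    have "{\<omega> \<in> space ((P \<Otimes>\<^sub>M ?\<mu>) \<Otimes>\<^sub>M X_law). snd \<omega> \<in> cbox 0 1 \<and> same_leaf (snd (fst \<omega>)) (fst (fst (fst \<omega>))) (snd \<omega>)}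
        \<in> sets ((P \<Otimes>\<^sub>M ?\<mu>) \<Otimes>\<^sub>M X_law)"
      by measurable
    from X.measurable_emeasure_Pair[OF this]
    have "(\<lambda>\<omega>. emeasure X_law (leaf_cell (snd \<omega>) (cbox 0 1) (fst (fst \<omega>)))) \<in> borel_measurable (P \<Otimes>\<^sub>M ?\<mu>)"
      by (rule measurable_cong[THEN iffD1, rotated])
        (auto simp: space_pair_measure X_law_def leaf_cell_eq intro!: arg_cong2[where f=emeasure])
    then show ?thesis by measurable
  qed
  have W_m: "(\<lambda>\<omega>. ?W (fst \<omega>) (snd \<omega>)) \<in> borel_measurable (P \<Otimes>\<^sub>M ?\<mu>)"
    by (rule measurable_leaf_sum[where w="\<lambda>x B. ennreal (spread x B)" and p="\<lambda>\<omega>. fst (fst \<omega>)" and N=borel])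
       measurable
  have "?I = (\<integral>\<^sup>+\<omega>. \<integral>\<^sup>+D. ennreal ((\<eta> (fst (fst \<omega>)) - tree_estimate D n (snd \<omega>) (fst (fst \<omega>)))\<^sup>2) \<partial>?\<Pi> \<partial>(P \<Otimes>\<^sub>M ?\<mu>))"
    unfolding \<Pi>P\<mu>.nn_integral_snd[OF loss, symmetric] by simp
  also have "\<dots> \<le> (\<integral>\<^sup>+\<omega>. ennreal (4 / n) * ?inv (fst \<omega>) (snd \<omega>) + ennreal (2 * L\<^sup>2) * ?W (fst \<omega>) (snd \<omega>) \<partial>(P \<Otimes>\<^sub>M ?\<mu>))"
    by (intro nn_integral_mono tree_risk_at_le n) (auto simp: space_pair_measure space_P)
  also have "\<dots> = ennreal (4 / n) * (\<integral>\<^sup>+\<omega>. ?inv (fst \<omega>) (snd \<omega>) \<partial>(P \<Otimes>\<^sub>M ?\<mu>)) +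
      ennreal (2 * L\<^sup>2) * (\<integral>\<^sup>+\<omega>. ?W (fst \<omega>) (snd \<omega>) \<partial>(P \<Otimes>\<^sub>M ?\<mu>))"
    using inv_m W_m by (simp add: nn_integral_add nn_integral_cmult)
  also have "\<dots> \<le> ennreal (4 / n) * ennreal ((1 + l) ^ CARD('d)) + ennreal (2 * L\<^sup>2) * ennreal (18 * CARD('d) / l\<^sup>2)"
  proof (intro add_mono mult_left_mono)
    have "(\<integral>\<^sup>+\<omega>. ?inv (fst \<omega>) (snd \<omega>) \<partial>(P \<Otimes>\<^sub>M ?\<mu>)) = (\<integral>\<^sup>+t. \<integral>\<^sup>+z. ?inv z t \<partial>P \<partial>?\<mu>)"
      using inv_m by (subst P\<mu>.nn_integral_snd[symmetric]) simp_all
    also have "\<dots> \<le> (\<integral>\<^sup>+t. leaf_sum (\<lambda>_. 1) t (0, 1) \<partial>?\<mu>)"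
    proof (rule nn_integral_mono)
      fix t :: "'d mtree"
      have m: "(\<lambda>x. emeasure X_law (leaf_cell t (cbox 0 1) x)) \<in> borel_measurable X_law"
      proof -
        have t: "t \<in> space mtree_space" by simp
        have "{\<omega> \<in> space (X_law \<Otimes>\<^sub>M X_law). snd \<omega> \<in> cbox 0 1 \<and> same_leaf t (fst \<omega>) (snd \<omega>)}
            \<in> sets (X_law \<Otimes>\<^sub>M X_law)"
          using t by measurable
        from X.measurable_emeasure_Pair[OF this] show ?thesis
          by (simp add: leaf_cell_eq vimage_def space_pair_measure X_law_def)
      qed
      have "(\<integral>\<^sup>+z. ?inv z t \<partial>P) = (\<integral>\<^sup>+z. indicator (cbox 0 1) (fst z) * ?inv z t \<partial>P)"
        by (intro nn_integral_cong) (auto simp: space_P)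
      also have "\<dots> = (\<integral>\<^sup>+x. indicator (cbox 0 1) x * inverse (emeasure X_law (leaf_cell t (cbox 0 1) x)) \<partial>X_law)"
        unfolding X_law_def using m[unfolded X_law_def] by (subst nn_integral_distr) auto
      also have "\<dots> \<le> leaf_sum (\<lambda>_. 1) t (0, 1)"
        by (rule nn_integral_inverse_leaf_cell_le[OF prob_space_X_law]) simp_all
      finally show "(\<integral>\<^sup>+z. ?inv z t \<partial>P) \<le> leaf_sum (\<lambda>_. 1) t (0, 1)" .
    qed
    also have "\<dots> \<le> ennreal ((1 + l) ^ CARD('d))"
      by (rule expected_leaves_MP_le) (use l in simp)
    finally show "(\<integral>\<^sup>+\<omega>. ?inv (fst \<omega>) (snd \<omega>) \<partial>(P \<Otimes>\<^sub>M ?\<mu>)) \<le> ennreal ((1 + l) ^ CARD('d))" .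
    have "(\<integral>\<^sup>+\<omega>. ?W (fst \<omega>) (snd \<omega>) \<partial>(P \<Otimes>\<^sub>M ?\<mu>)) = (\<integral>\<^sup>+z. \<integral>\<^sup>+t. ?W z t \<partial>?\<mu> \<partial>P)"
      using W_m by (subst \<mu>.nn_integral_fst[symmetric]) simp_all
    also have "\<dots> \<le> (\<integral>\<^sup>+z. ennreal (18 * CARD('d) / l\<^sup>2) \<partial>P)"
      by (intro nn_integral_mono expected_spread_MP_le l) (auto simp: space_P)
    finally show "(\<integral>\<^sup>+\<omega>. ?W (fst \<omega>) (snd \<omega>) \<partial>(P \<Otimes>\<^sub>M ?\<mu>)) \<le> ennreal (18 * CARD('d) / l\<^sup>2)"
      by (simp add: emeasure_space_1)
  qed auto
  also have "\<dots> = ennreal (4 * (1 + l) ^ CARD('d) / n + 36 * L\<^sup>2 * CARD('d) / l\<^sup>2)"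
    using l n by (simp add: ennreal_mult'[symmetric] ennreal_plus[symmetric] del: ennreal_plus)
  finally show ?thesis .
qed

end

section \<open>Reduction to a product measure\<close>

text \<open>Outside the cube \<eta> is arbitrary, so measurability goes through the restriction to
  the cube, where X takes its values.\<close>

lemma measurable_compose_continuous_on_cbox:
  fixes X :: "'w \<Rightarrow> real ^ 'd::finite" and \<eta> :: "real ^ 'd \<Rightarrow> real"
  assumes "continuous_on (cbox 0 1) \<eta>" "X \<in> borel_measurable M" "\<And>\<omega>. \<omega> \<in> space M \<Longrightarrow> X \<omega> \<in> cbox 0 1"
  shows "(\<lambda>\<omega>. \<eta> (X \<omega>)) \<in> borel_measurable M"
  by (rule measurable_compose[OF _ borel_measurable_continuous_on_restrict[OF assms(1)]])
    (intro measurable_restrict_space2, use assms in auto)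

lemma obs_space_components:
  assumes "(\<lambda>\<omega>. (X \<omega>, Y \<omega>)) \<in> M \<rightarrow>\<^sub>M obs_space"
  shows "X \<in> borel_measurable M" "Y \<in> borel_measurable M"
    and "\<omega> \<in> space M \<Longrightarrow> X \<omega> \<in> cbox 0 1" "\<omega> \<in> space M \<Longrightarrow> Y \<omega> = 0 \<or> Y \<omega> = 1"
  using measurable_compose[OF assms measurable_obs_fst] measurable_compose[OF assms measurable_obs_snd]
    measurable_space[OF assms] by (auto simp: obs_space_def space_restrict_space)

text \<open>On an event about X the conditional expectation integrates like the indicator of Y = 1,
  and this indicator is Y itself because the labels are 0 or 1.\<close>

lemma cond_prob_function_integral:
  fixes X :: "'w \<Rightarrow> real ^ 'd::finite"
  assumes "prob_space M" and Z: "(\<lambda>\<omega>. (X \<omega>, Y \<omega>)) \<in> M \<rightarrow>\<^sub>M obs_space"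
    and c: "cond_prob_function M X Y \<eta>" and \<eta>: "continuous_on (cbox 0 1) \<eta>" and A [measurable]: "A \<in> sets borel"
  shows "(\<integral>\<omega>. indicator A (X \<omega>) * Y \<omega> \<partial>M) = (\<integral>\<omega>. indicator A (X \<omega>) * \<eta> (X \<omega>) \<partial>M)"
proof -
  interpret prob_space M by fact
  let ?F = "vimage_algebra (space M) X borel"
  note [measurable] = obs_space_components(1,2)[OF Z]
  have [measurable]: "(\<lambda>\<omega>. \<eta> (X \<omega>)) \<in> borel_measurable M"
    by (rule measurable_compose_continuous_on_cbox[OF \<eta> obs_space_components(1,3)[OF Z]])
  have "subalgebra M ?F"
    unfolding subalgebra_def by (auto simp: sets_vimage_algebra2 intro: measurable_sets[OF obs_space_components(1)[OF Z]])
  then interpret finite_measure_subalgebra M ?F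
    by unfold_locales
  let ?f = "indicator {\<omega> \<in> space M. Y \<omega> = 1} :: 'w \<Rightarrow> real"
  have B: "X -` A \<inter> space M \<in> sets ?F"
    by (rule in_vimage_algebra) fact
  have "(\<integral>\<omega>. indicator A (X \<omega>) * Y \<omega> \<partial>M) = (\<integral>\<omega>\<in>X -` A \<inter> space M. ?f \<omega> \<partial>M)"
    unfolding set_lebesgue_integral_def
    using obs_space_components(4)[OF Z]
    by (intro Bochner_Integration.integral_cong) (auto split: split_indicator)
  also have "\<dots> = (\<integral>\<omega>\<in>X -` A \<inter> space M. real_cond_exp M ?F ?f \<omega> \<partial>M)"
    by (rule real_cond_exp_intA[OF _ B]) (auto intro!: integrable_real_indicator simp: less_top[symmetric])
  also have "\<dots> = (\<integral>\<omega>. indicator A (X \<omega>) * real_cond_exp M ?F ?f \<omega> \<partial>M)"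
    unfolding set_lebesgue_integral_def
    by (intro Bochner_Integration.integral_cong) (auto split: split_indicator)
  also have "\<dots> = (\<integral>\<omega>. indicator A (X \<omega>) * \<eta> (X \<omega>) \<partial>M)"
    using c by (intro integral_cong_AE) (auto simp: cond_prob_function_def)
  finally show ?thesis .
qed

lemma regression_model_distr:
  fixes X :: "'w \<Rightarrow> real ^ 'd::finite"
  assumes "prob_space M" and Z: "(\<lambda>\<omega>. (X \<omega>, Y \<omega>)) \<in> M \<rightarrow>\<^sub>M obs_space"
    and c: "cond_prob_function M X Y \<eta>" and L: "L-lipschitz_on (cbox 0 1) \<eta>"
  shows "regression_model (distr M obs_space (\<lambda>\<omega>. (X \<omega>, Y \<omega>))) \<eta> L"
proof (rule regression_model.intro)
  interpret prob_space M by fact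
  let ?P = "distr M obs_space (\<lambda>\<omega>. (X \<omega>, Y \<omega>))"
  show "prob_space ?P" by (rule prob_space_distr[OF Z])
  note \<eta> = lipschitz_on_continuous_on[OF L]
  show "\<eta> x \<in> {0..1}" if "x \<in> cbox 0 1" for x
    using c that by (auto simp: cond_prob_function_def)
  have [measurable]: "(\<lambda>z. \<eta> (fst z)) \<in> borel_measurable obs_space"
    by (rule measurable_compose_continuous_on_cbox[OF \<eta>])
      (auto simp: obs_space_def space_restrict_space intro!: measurable_restrict_space1)
  fix A :: "(real ^ 'd) set" assume [measurable]: "A \<in> sets borel"
  show "(\<integral>z. indicator A (fst z) * snd z \<partial>?P) = (\<integral>z. indicator A (fst z) * \<eta> (fst z) \<partial>?P)"
    using cond_prob_function_integral[OF assms(1) Z c \<eta> \<open>A \<in> sets borel\<close>]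
    by (simp add: integral_distr[OF Z])
qed (use L in simp_all)

text \<open>Disjoint blocks of independent intersection-stable generators generate independent
  sigma-algebras. Variables measurable with respect to one block each therefore have a product law,
  even when each combines several sources.\<close>

lemma (in prob_space) distr_pair_of_indep_sets:
  assumes E: "indep_sets E (I1 \<union> I2)" and disj: "I1 \<inter> I2 = {}"
    and stable: "\<And>i. i \<in> I1 \<union> I2 \<Longrightarrow> Int_stable (E i)"
    and X: "X \<in> sigma (space M) (\<Union>i\<in>I1. E i) \<rightarrow>\<^sub>M S" and Y: "Y \<in> sigma (space M) (\<Union>i\<in>I2. E i) \<rightarrow>\<^sub>M T"
  shows "distr M (S \<Otimes>\<^sub>M T) (\<lambda>\<omega>. (X \<omega>, Y \<omega>)) = distr M S X \<Otimes>\<^sub>M distr M T Y"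
proof -
  let ?\<sigma> = "\<lambda>I. sigma_sets (space M) (\<Union>i\<in>I. E i)"
  have ev: "E i \<subseteq> events" if "i \<in> I1 \<union> I2" for i
    using E that by (auto simp: indep_sets_def)
  have sub: "(\<Union>i\<in>I. E i) \<subseteq> Pow (space M)" if "I \<subseteq> I1 \<union> I2" for I
    using ev that sets.sets_into_space by blast
  have rv: "random_variable N V" and pre: "A \<in> sets N \<Longrightarrow> V -` A \<inter> space M \<in> ?\<sigma> I"
    if "I \<subseteq> I1 \<union> I2" and V: "V \<in> sigma (space M) (\<Union>i\<in>I. E i) \<rightarrow>\<^sub>M N" for I V A and N :: "'x measure"
  proof -
    have s: "sets (sigma (space M) (\<Union>i\<in>I. E i)) = ?\<sigma> I"
      by (rule sets_measure_of[OF sub[OF that(1)]])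
    have sp: "space (sigma (space M) (\<Union>i\<in>I. E i)) = space M"
      by (rule space_measure_of[OF sub[OF that(1)]])
    have pre': "V -` A \<inter> space M \<in> ?\<sigma> I" if "A \<in> sets N" for A
      using measurable_sets[OF V that] by (simp add: s sp)
    then show "A \<in> sets N \<Longrightarrow> V -` A \<inter> space M \<in> ?\<sigma> I" .
    have "?\<sigma> I \<subseteq> events"
      using ev that(1) by (intro sets.sigma_sets_subset) auto
    then show "random_variable N V"
      using pre' measurable_space[OF V] by (intro measurableI) (auto simp: sp)
  qed
  have [measurable]: "random_variable S X" "random_variable T Y"
    using rv[OF _ X] rv[OF _ Y] by auto
  have "indep_sets (\<lambda>b. ?\<sigma> (case b of True \<Rightarrow> I1 | False \<Rightarrow> I2)) UNIV"
  proof (rule indep_sets_collect_sigma)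
    have "(\<Union>b. case b of True \<Rightarrow> I1 | False \<Rightarrow> I2) = I1 \<union> I2"
      by (auto split: bool.splits)
    then show "indep_sets E (\<Union>b. case b of True \<Rightarrow> I1 | False \<Rightarrow> I2)" using E by simp
    show "disjoint_family (case_bool I1 I2)"
      using disj by (auto simp: disjoint_family_on_def split: bool.splits)
  qed (auto split: bool.splits intro: stable)
  moreover have "(\<lambda>b. ?\<sigma> (case b of True \<Rightarrow> I1 | False \<Rightarrow> I2)) = case_bool (?\<sigma> I1) (?\<sigma> I2)"
    by (rule ext) (simp split: bool.split)
  ultimately have indep: "indep_set (?\<sigma> I1) (?\<sigma> I2)"
    by (simp only: indep_set_def)
  interpret X: prob_space "distr M S X" by (rule prob_space_distr) measurable
  interpret Y: prob_space "distr M T Y" by (rule prob_space_distr) measurable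
  show ?thesis
  proof (rule pair_measure_eqI[symmetric])
    fix A B assume "A \<in> sets (distr M S X)" "B \<in> sets (distr M T Y)"
    then have [measurable]: "A \<in> sets S" "B \<in> sets T" by auto
    have "prob ((X -` A \<inter> space M) \<inter> (Y -` B \<inter> space M)) = prob (X -` A \<inter> space M) * prob (Y -` B \<inter> space M)"
      by (rule indep_setD[OF indep]) (auto intro: pre[OF _ X] pre[OF _ Y])
    moreover have "(\<lambda>\<omega>. (X \<omega>, Y \<omega>)) -` (A \<times> B) \<inter> space M = (X -` A \<inter> space M) \<inter> (Y -` B \<inter> space M)"
      by auto
    ultimately show "emeasure (distr M S X) A * emeasure (distr M T Y) B = emeasure (distr M (S \<Otimes>\<^sub>M T) (\<lambda>\<omega>. (X \<omega>, Y \<omega>))) (A \<times> B)"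
      by (simp add: emeasure_distr emeasure_eq_measure ennreal_mult)
  qed (simp_all add: X.sigma_finite_measure_axioms Y.sigma_finite_measure_axioms)
qed

text \<open>The sources are separated in blocks: the sample from the rest, then the generic
  observation from the tree. Within the sample, joint independence gives the product of n copies of
  P.\<close>

lemma (in prob_space) sample_tree_distr:
  fixes Z :: "'a \<Rightarrow> (real ^ 'd::finite) \<times> real" and D :: "nat \<Rightarrow> 'a \<Rightarrow> (real ^ 'd) \<times> real"
    and T :: "nat \<Rightarrow> nat \<Rightarrow> 'a \<Rightarrow> 'd mtree"
  assumes ind: "mutually_independent M Z D K T"
    and Z: "Z \<in> M \<rightarrow>\<^sub>M obs_space" and D: "\<And>i. i \<ge> 1 \<Longrightarrow> D i \<in> M \<rightarrow>\<^sub>M obs_space"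
    and P: "\<And>i. i \<ge> 1 \<Longrightarrow> distr M obs_space (D i) = P" "distr M obs_space Z = P"
    and k: "k \<in> {1..K}" and T: "\<And>n. T k n \<in> M \<rightarrow>\<^sub>M mtree_space" and n: "n \<ge> 1"
  shows "distr M (PiM {1..n} (\<lambda>_. obs_space) \<Otimes>\<^sub>M (obs_space \<Otimes>\<^sub>M mtree_space)) (\<lambda>\<omega>. (\<lambda>i\<in>{1..n}. D i \<omega>, Z \<omega>, T k n \<omega>)) =
    PiM {1..n} (\<lambda>_. P) \<Otimes>\<^sub>M (P \<Otimes>\<^sub>M distr M mtree_space (T k n))"
proof -
  define E where "E s = (case s of
          Generic \<Rightarrow> sets (vimage_algebra (space M) Z obs_space)
        | Sample i \<Rightarrow> sets (vimage_algebra (space M) (D i) obs_space)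
        | Tree k \<Rightarrow> sets (vimage_algebra (space M) (\<lambda>\<omega> n. T k n \<omega>) (PiM UNIV (\<lambda>_. mtree_space))))" for s
  let ?I = "{Generic} \<union> Sample ` {1..n} \<union> {Tree k}"
  have E: "indep_sets E ?I"
  proof (rule indep_sets_mono_index)
    show "indep_sets E ({Generic} \<union> Sample ` {1..} \<union> Tree ` {1..K})"
      using ind unfolding mutually_independent_def E_def[abs_def] .
  qed (use k in auto)
  have stable: "Int_stable (E i)" for i
    unfolding E_def by (auto split: source.split intro!: Int_stableI)
  have E_space: "(\<Union>i\<in>I. E i) \<subseteq> Pow (space M)" for I
  proof -
    have "E s \<subseteq> Pow (space M)" for s
      using sets.space_closed[of "vimage_algebra (space M) Z obs_space"]
        sets.space_closed[of "vimage_algebra (space M) (D _) obs_space"]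
        sets.space_closed[of "vimage_algebra (space M) (\<lambda>\<omega> n. T _ n \<omega>) (PiM UNIV (\<lambda>_. mtree_space))"]
      unfolding E_def by (cases s) simp_all
    then show ?thesis by blast
  qed
  have gen: "V \<in> sigma (space M) (\<Union>i\<in>I. E i) \<rightarrow>\<^sub>M N"
    if "s \<in> I" "E s = sets (vimage_algebra (space M) V N)" "V \<in> space M \<rightarrow> space N" for s I V and N :: "'x measure"
  proof (rule measurableI)
    fix A assume "A \<in> sets N"
    then have "V -` A \<inter> space M \<in> E s"
      unfolding that(2) by (rule in_vimage_algebra)
    then show "V -` A \<inter> space (sigma (space M) (\<Union>i\<in>I. E i)) \<in> sets (sigma (space M) (\<Union>i\<in>I. E i))"
      using that(1) by (auto simp: space_measure_of[OF E_space] sets_measure_of[OF E_space])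
  qed (use that(3) in \<open>auto simp: space_measure_of[OF E_space]\<close>)
  have Zg: "Z \<in> sigma (space M) (\<Union>i\<in>I. E i) \<rightarrow>\<^sub>M obs_space" if "Generic \<in> I" for I
    by (rule gen[OF that]) (use measurable_space[OF Z] in \<open>auto simp: E_def\<close>)
  have Dg: "D i \<in> sigma (space M) (\<Union>i\<in>I. E i) \<rightarrow>\<^sub>M obs_space" if "Sample i \<in> I" "i \<ge> 1" for i I
    by (rule gen[OF that(1)]) (use measurable_space[OF D[OF that(2)]] in \<open>auto simp: E_def\<close>)
  have Tg: "T k n \<in> sigma (space M) (\<Union>i\<in>I. E i) \<rightarrow>\<^sub>M mtree_space" if "Tree k \<in> I" for I
  proof -
    \<comment> \<open>The source of a tree is its whole growth path, and the tree at time n is one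
      coordinate of it.\<close>
    have "(\<lambda>\<omega> n. T k n \<omega>) \<in> sigma (space M) (\<Union>i\<in>I. E i) \<rightarrow>\<^sub>M PiM UNIV (\<lambda>_. mtree_space)"
      by (rule gen[OF that]) (auto simp: E_def space_PiM)
    from measurable_compose[OF this measurable_component_singleton[of n UNIV]] show ?thesis by simp
  qed
  have 1: "distr M (PiM {1..n} (\<lambda>_. obs_space) \<Otimes>\<^sub>M (obs_space \<Otimes>\<^sub>M mtree_space)) (\<lambda>\<omega>. (\<lambda>i\<in>{1..n}. D i \<omega>, Z \<omega>, T k n \<omega>)) =
      distr M (PiM {1..n} (\<lambda>_. obs_space)) (\<lambda>\<omega>. \<lambda>i\<in>{1..n}. D i \<omega>) \<Otimes>\<^sub>M
      distr M (obs_space \<Otimes>\<^sub>M mtree_space) (\<lambda>\<omega>. (Z \<omega>, T k n \<omega>))"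
  proof (rule distr_pair_of_indep_sets[of E "Sample ` {1..n}" "{Generic, Tree k}"])
    show "indep_sets E (Sample ` {1..n} \<union> {Generic, Tree k})"
      by (rule indep_sets_mono_index[OF _ E]) auto
    show "(\<lambda>\<omega>. \<lambda>i\<in>{1..n}. D i \<omega>) \<in> sigma (space M) (\<Union>i\<in>Sample ` {1..n}. E i) \<rightarrow>\<^sub>M PiM {1..n} (\<lambda>_. obs_space)"
      by (rule measurable_restrict, rule Dg) auto
    show "(\<lambda>\<omega>. (Z \<omega>, T k n \<omega>)) \<in> sigma (space M) (\<Union>i\<in>{Generic, Tree k}. E i) \<rightarrow>\<^sub>M obs_space \<Otimes>\<^sub>M mtree_space"
      by (intro measurable_Pair Zg Tg) blast+
  qed (auto intro: stable)
  have 2: "distr M (obs_space \<Otimes>\<^sub>M mtree_space) (\<lambda>\<omega>. (Z \<omega>, T k n \<omega>)) = P \<Otimes>\<^sub>M distr M mtree_space (T k n)"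
    unfolding P(2)[symmetric]
  proof (rule distr_pair_of_indep_sets[of E "{Generic}" "{Tree k}"])
    show "indep_sets E ({Generic} \<union> {Tree k})"
      by (rule indep_sets_mono_index[OF _ E]) auto
    show "Z \<in> sigma (space M) (\<Union>i\<in>{Generic}. E i) \<rightarrow>\<^sub>M obs_space"
      by (intro Zg) blast
    show "T k n \<in> sigma (space M) (\<Union>i\<in>{Tree k}. E i) \<rightarrow>\<^sub>M mtree_space"
      by (intro Tg) blast
  qed (auto intro: stable)
  have "indep_sets (\<lambda>i. E (Sample i)) {1..n}"
  proof (rule indep_setsI)
    show "E (Sample i) \<subseteq> events" if "i \<in> {1..n}" for i
      using E that by (auto simp: indep_sets_def)
    fix A J assume J: "J \<noteq> {}" "J \<subseteq> {1..n}" "finite J" "\<forall>j\<in>J. A j \<in> E (Sample j)"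
    \<comment> \<open>Transports a family indexed by sample numbers to one indexed by sources; the
      value on the other sources is a dummy.\<close>
    define A' where "A' s = (case s of Sample i \<Rightarrow> A i | _ \<Rightarrow> {})" for s
    have "prob (\<Inter>s\<in>Sample ` J. A' s) = (\<Prod>s\<in>Sample ` J. prob (A' s))"
      by (rule indep_setsD[OF E]) (use J in \<open>auto simp: A'_def\<close>)
    then show "prob (\<Inter>j\<in>J. A j) = (\<Prod>j\<in>J. prob (A j))"
      by (simp add: A'_def prod.reindex inj_on_def)
  qed
  then have "indep_vars (\<lambda>_. obs_space) D {1..n}"
  proof (unfold indep_vars_def2, intro conjI ballI)
    assume *: "indep_sets (\<lambda>i. E (Sample i)) {1..n}"
    have "{D i -` A \<inter> space M |A. A \<in> sets obs_space} = E (Sample i)" if "i \<ge> 1" for i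
      unfolding E_def source.case
      by (rule sets_vimage_algebra2[symmetric]) (use measurable_space[OF D[OF that]] in auto)
    then show "indep_sets (\<lambda>i. {D i -` A \<inter> space M |A. A \<in> sets obs_space}) {1..n}"
      by (intro indep_sets_mono_sets[OF *]) simp
  qed (use D in simp)
  then have 3: "distr M (PiM {1..n} (\<lambda>_. obs_space)) (\<lambda>\<omega>. \<lambda>i\<in>{1..n}. D i \<omega>) = PiM {1..n} (\<lambda>_. P)"
  proof -
    assume *: "indep_vars (\<lambda>_. obs_space) D {1..n}"
    have "distr M (PiM {1..n} (\<lambda>_. obs_space)) (\<lambda>\<omega>. \<lambda>i\<in>{1..n}. D i \<omega>) = PiM {1..n} (\<lambda>i. distr M obs_space (D i))"
      by (rule indep_vars_iff_distr_eq_PiM'[THEN iffD1, OF _ _ *]) (use n D in auto)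
    also have "\<dots> = PiM {1..n} (\<lambda>_. P)"
      by (intro PiM_cong refl P(1)) simp
    finally show ?thesis .
  qed
  show ?thesis using 1 unfolding 2 3 by simp
qed

section \<open>Upper bounds\<close>

lemma forest_sq_error_le:
  assumes "K \<ge> 1"
  shows "(e - forest_estimate D n K t x)\<^sup>2 \<le> (1 / real K) * (\<Sum>k=1..K. (e - tree_estimate D n (t k) x)\<^sup>2)"
proof -
  have K: "real K > 0" using assms by simp
  have "e - forest_estimate D n K t x = (1 / real K) * (\<Sum>k=1..K. e - tree_estimate D n (t k) x)"
    using K by (simp add: forest_estimate_def sum_subtractf field_simps)
  then have "(e - forest_estimate D n K t x)\<^sup>2 = (1 / real K)\<^sup>2 * (\<Sum>k=1..K. e - tree_estimate D n (t k) x)\<^sup>2"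
    by (simp only: power_mult_distrib)
  also have "\<dots> \<le> (1 / real K)\<^sup>2 * ((\<Sum>k=1..K. (e - tree_estimate D n (t k) x)\<^sup>2) * card {1..K})"
    by (intro mult_left_mono sum_squared_le_sum_of_squares) simp
  also have "\<dots> = (1 / real K) * (\<Sum>k=1..K. (e - tree_estimate D n (t k) x)\<^sup>2)"
    using K by (simp add: power2_eq_square field_simps)
  finally show ?thesis .
qed

lemma mondrian_forest_risk_le:
  fixes M :: "'w measure"
    and X :: "'w \<Rightarrow> real ^ 'd::finite" and Y :: "'w \<Rightarrow> real"
    and XS :: "nat \<Rightarrow> 'w \<Rightarrow> real ^ 'd" and YS :: "nat \<Rightarrow> 'w \<Rightarrow> real"
    and T :: "nat \<Rightarrow> nat \<Rightarrow> 'w \<Rightarrow> 'd mtree"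
  assumes "prob_space M"
    and Z: "(\<lambda>\<omega>. (X \<omega>, Y \<omega>)) \<in> M \<rightarrow>\<^sub>M obs_space"
    and c: "cond_prob_function M X Y \<eta>"
    and L: "L-lipschitz_on (cbox 0 1) \<eta>"
    and D: "\<And>i. i \<ge> 1 \<Longrightarrow> (\<lambda>\<omega>. (XS i \<omega>, YS i \<omega>)) \<in> M \<rightarrow>\<^sub>M obs_space"
    and law: "\<And>i. i \<ge> 1 \<Longrightarrow> distr M obs_space (\<lambda>\<omega>. (XS i \<omega>, YS i \<omega>)) =
                        distr M obs_space (\<lambda>\<omega>. (X \<omega>, Y \<omega>))"
    and K: "K \<ge> 1"
    and T: "\<And>k. k \<in> {1..K} \<Longrightarrow> mondrian_tree_process M lam (T k)"
    and ind: "mutually_independent M (\<lambda>\<omega>. (X \<omega>, Y \<omega>)) (\<lambda>i \<omega>. (XS i \<omega>, YS i \<omega>)) K T"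
    and n: "n \<ge> 1" and lam: "lam n > 0"
  shows "(\<integral>\<omega>. (\<eta> (X \<omega>) - forest_estimate (\<lambda>i. (XS i \<omega>, YS i \<omega>)) n K (\<lambda>k. T k n \<omega>) (X \<omega>))\<^sup>2 \<partial>M)
    \<le> 4 * (1 + lam n) ^ CARD('d) / n + 36 * L\<^sup>2 * CARD('d) / (lam n)\<^sup>2" (is "_ \<le> ?b")
proof -
  interpret prob_space M by fact
  let ?P = "distr M obs_space (\<lambda>\<omega>. (X \<omega>, Y \<omega>))"
  interpret R: regression_model ?P \<eta> L
    by (rule regression_model_distr) fact+
  let ?D = "\<lambda>\<omega> i. (XS i \<omega>, YS i \<omega>)"
  let ?r = "\<lambda>k \<omega>. (\<eta> (X \<omega>) - tree_estimate (?D \<omega>) n (T k n \<omega>) (X \<omega>))\<^sup>2"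
  note [measurable] = obs_space_components(1,2)[OF Z]
  note X01 = obs_space_components(3)[OF Z]
  have [measurable]: "(\<lambda>\<omega>. \<eta> (X \<omega>)) \<in> borel_measurable M"
    by (rule measurable_compose_continuous_on_cbox[OF lipschitz_on_continuous_on[OF L]]) (use X01 in auto)
  have \<eta>01: "\<eta> (X \<omega>) \<in> {0..1}" if "\<omega> \<in> space M" for \<omega>
    using c X01[OF that] by (auto simp: cond_prob_function_def)
  have Dm: "(\<lambda>\<omega>. \<lambda>i\<in>{1..n}. ?D \<omega> i) \<in> M \<rightarrow>\<^sub>M PiM {1..n} (\<lambda>_. obs_space)"
    by (rule measurable_restrict, rule D) simp
  \<comment> \<open>The estimate reads only the first n observations, so the infinite sample can be
    replaced by its restriction, which lies in the product space.\<close>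
  have tree_D: "tree_estimate (?D \<omega>) n t x = tree_estimate (\<lambda>i\<in>{1..n}. ?D \<omega> i) n t x" for \<omega> t x
    by (rule tree_estimate_cong) simp
  have b: "0 \<le> ?b" using lam by simp
  have tree: "?r k \<in> borel_measurable M" "integrable M (?r k)" "(\<integral>\<omega>. ?r k \<omega> \<partial>M) \<le> ?b" if k: "k \<in> {1..K}" for k
  proof -
    have Tm [measurable]: "T k m \<in> M \<rightarrow>\<^sub>M mtree_space" for m
      using T[OF k] by (simp add: mondrian_tree_process_def)
    have MP: "distr M mtree_space (T k n) = MP (lam n) (0, 1)"
      using T[OF k] n by (simp add: mondrian_tree_process_def)
    \<comment> \<open>That the recursion stops almost surely is contained in this: the supremum of
      the truncated laws is the law of a random tree and so has total mass 1.\<close>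
    have prob_MP: "prob_space (MP (lam n) (0, 1 :: real ^ 'd))"
      unfolding MP[symmetric] by (rule prob_space_distr) measurable
    have [measurable]: "(\<lambda>\<omega>. tree_estimate (?D \<omega>) n (T k n \<omega>) (X \<omega>)) \<in> borel_measurable M"
      unfolding tree_D by (rule measurable_tree_estimate[OF Dm]) measurable
    show m: "?r k \<in> borel_measurable M" by measurable
    have bound: "?r k \<omega> \<le> 1" if "\<omega> \<in> space M" for \<omega>
    proof -
      have "\<bar>\<eta> (X \<omega>) - tree_estimate (?D \<omega>) n (T k n \<omega>) (X \<omega>)\<bar> \<le> 1"
        using \<eta>01[OF that] tree_estimate_in_unit[of "?D \<omega>" n "T k n \<omega>" "X \<omega>"] by auto
      then show ?thesis by (simp add: abs_square_le_1)
    qed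
    show int: "integrable M (?r k)"
      by (rule integrable_const_bound[where B=1]) (use bound m in auto)
    let ?\<Omega> = "PiM {1..n} (\<lambda>_. obs_space) \<Otimes>\<^sub>M (obs_space \<Otimes>\<^sub>M mtree_space) :: (_ \<times> _ \<times> 'd mtree) measure"
    have \<eta>m: "(\<lambda>z. \<eta> (fst z)) \<in> borel_measurable obs_space"
      using R.measurable_eta by simp
    have loss [measurable]: "tree_loss \<eta> n \<in> borel_measurable ?\<Omega>"
    proof -
      have "(\<lambda>\<omega>. tree_estimate (fst \<omega>) n (snd (snd \<omega>)) (fst (fst (snd \<omega>)))) \<in> borel_measurable ?\<Omega>"
        by (rule measurable_tree_estimate) measurable
      moreover have "(\<lambda>\<omega>. \<eta> (fst (fst (snd \<omega>)))) \<in> borel_measurable ?\<Omega>"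
        by (rule measurable_compose[OF _ \<eta>m]) measurable
      ultimately show ?thesis
        by (intro measurable_compose[OF _ measurable_ennreal] borel_measurable_power borel_measurable_diff)
    qed
    have "ennreal (\<integral>\<omega>. ?r k \<omega> \<partial>M) = (\<integral>\<^sup>+\<omega>. ennreal (?r k \<omega>) \<partial>M)"
      using int by (intro nn_integral_eq_integral[symmetric]) auto
    also have "\<dots> = (\<integral>\<^sup>+\<omega>. tree_loss \<eta> n (\<lambda>i\<in>{1..n}. ?D \<omega> i, (X \<omega>, Y \<omega>), T k n \<omega>) \<partial>M)"
      by (simp add: tree_D)
    also have "\<dots> = (\<integral>\<^sup>+\<omega>. tree_loss \<eta> n \<omega> \<partial>distr M ?\<Omega> (\<lambda>\<omega>. (\<lambda>i\<in>{1..n}. ?D \<omega> i, (X \<omega>, Y \<omega>), T k n \<omega>)))"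
    proof (rule nn_integral_distr[symmetric])
      show "(\<lambda>\<omega>. (\<lambda>i\<in>{1..n}. ?D \<omega> i, (X \<omega>, Y \<omega>), T k n \<omega>)) \<in> M \<rightarrow>\<^sub>M ?\<Omega>"
        by (intro measurable_Pair Dm Z Tm)
    qed (unfold measurable_distr_eq1, rule loss)
    also have "distr M ?\<Omega> (\<lambda>\<omega>. (\<lambda>i\<in>{1..n}. ?D \<omega> i, (X \<omega>, Y \<omega>), T k n \<omega>)) =
        PiM {1..n} (\<lambda>_. ?P) \<Otimes>\<^sub>M (?P \<Otimes>\<^sub>M MP (lam n) (0, 1))"
      unfolding MP[symmetric] by (rule sample_tree_distr[OF ind Z D law refl k Tm n])
    also have "(\<integral>\<^sup>+\<omega>. tree_loss \<eta> n \<omega> \<partial>(PiM {1..n} (\<lambda>_. ?P) \<Otimes>\<^sub>M (?P \<Otimes>\<^sub>M MP (lam n) (0, 1)))) \<le> ennreal ?b"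
      by (rule R.mondrian_tree_risk_le[OF prob_MP lam]) (use n in simp)
    finally show "(\<integral>\<omega>. ?r k \<omega> \<partial>M) \<le> ?b"
      using b by simp
  qed
  have "(\<integral>\<omega>. (\<eta> (X \<omega>) - forest_estimate (?D \<omega>) n K (\<lambda>k. T k n \<omega>) (X \<omega>))\<^sup>2 \<partial>M)
      \<le> (\<integral>\<omega>. (1 / real K) * (\<Sum>k=1..K. ?r k \<omega>) \<partial>M)"
  proof (rule integral_mono_AE')
    show "integrable M (\<lambda>\<omega>. (1 / real K) * (\<Sum>k=1..K. ?r k \<omega>))"
      by (intro integrable_mult_right Bochner_Integration.integrable_sum tree(2))
    show "AE \<omega> in M. (\<eta> (X \<omega>) - forest_estimate (?D \<omega>) n K (\<lambda>k. T k n \<omega>) (X \<omega>))\<^sup>2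
        \<le> (1 / real K) * (\<Sum>k=1..K. ?r k \<omega>)"
      by (rule AE_I2) (rule forest_sq_error_le[OF K, of _ _ _ "\<lambda>k. T k n _"])
    show "AE \<omega> in M. 0 \<le> (1 / real K) * (\<Sum>k=1..K. ?r k \<omega>)"
      by (rule AE_I2) (intro mult_nonneg_nonneg sum_nonneg; simp)
  qed
  also have "\<dots> = (1 / real K) * (\<Sum>k=1..K. \<integral>\<omega>. ?r k \<omega> \<partial>M)"
    using tree(2) by (simp add: Bochner_Integration.integral_sum)
  also have "\<dots> \<le> (1 / real K) * (\<Sum>k=1..K. ?b)"
    by (intro mult_left_mono sum_mono tree(3)) auto
  also have "\<dots> = ?b" using K by simp
  finally show ?thesis .
qed

section \<open>An upper bound for the minimax risk\<close>

lemma (in prob_space) square_integral_le: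
  fixes f :: "'a \<Rightarrow> real"
  assumes [measurable]: "f \<in> borel_measurable M" and b: "\<And>x. x \<in> space M \<Longrightarrow> \<bar>f x\<bar> \<le> 1"
  shows "(\<integral>x. f x \<partial>M)\<^sup>2 \<le> (\<integral>x. (f x)\<^sup>2 \<partial>M)" "integrable M (\<lambda>x. (f x)\<^sup>2)"
proof -
  have "integrable M f"
    by (rule integrable_const_bound[where B=1]) (use b in auto)
  moreover show i: "integrable M (\<lambda>x. (f x)\<^sup>2)"
    by (rule integrable_const_bound[where B=1]) (use b in \<open>auto simp: abs_square_le_1\<close>)
  ultimately show "(\<integral>x. f x \<partial>M)\<^sup>2 \<le> (\<integral>x. (f x)\<^sup>2 \<partial>M)"
    using variance_positive[of f] variance_eq[of f] by simp
qed

lemma regression_model_lipschitz_class: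
  assumes "(P, \<eta>) \<in> lipschitz_class L"
  shows "regression_model P \<eta> L"
proof -
  have P: "prob_space P" "sets P = sets obs_space" "cond_prob_function P fst snd \<eta>" "L-lipschitz_on (cbox 0 1) \<eta>"
    using assms by (auto simp: lipschitz_class_def)
  have "(\<lambda>z. (fst z, snd z)) \<in> P \<rightarrow>\<^sub>M obs_space"
    using P(2) by (simp add: measurable_ident_sets)
  from regression_model_distr[OF P(1) this P(3,4)] show ?thesis
    using P(2) by (simp add: distr_id2)
qed

text \<open>The witness averages the tree estimate over the law of the tree; its risk is bounded by Jensen.\<close>

lemma minimax_risk_le:
  assumes \<mu>: "prob_space (MP l (0, 1 :: real ^ 'd::finite))" and l: "0 < l" and n: "n \<ge> 1"
  shows "minimax_risk TYPE('d) L n \<le> ennreal (4 * (1 + l) ^ CARD('d) / n + 36 * L\<^sup>2 * CARD('d) / l\<^sup>2)"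
    (is "_ \<le> ?b")
proof -
  let ?\<mu> = "MP l (0, 1 :: real ^ 'd)"
  interpret \<mu>: prob_space ?\<mu> by fact
  define f where "f D x = (\<integral>t. tree_estimate D n t x \<partial>?\<mu>)" for D x
  have "case_prod f \<in> borel_measurable (PiM {1..n} (\<lambda>_. obs_space) \<Otimes>\<^sub>M restrict_space borel (cbox 0 1))"
  proof -
    have "(\<lambda>(p, t). tree_estimate (fst p) n t (snd p)) \<in> borel_measurable
        ((PiM {1..n} (\<lambda>_. obs_space) \<Otimes>\<^sub>M restrict_space borel (cbox 0 1)) \<Otimes>\<^sub>M ?\<mu>)"
      unfolding case_prod_unfold
    proof (rule measurable_tree_estimate)
      have id: "(\<lambda>x::real ^ 'd. x) \<in> restrict_space borel (cbox 0 1) \<rightarrow>\<^sub>M borel"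
        by (rule measurable_restrict_space1) simp
      show "(\<lambda>x. snd (fst x)) \<in> borel_measurable ((PiM {1..n} (\<lambda>_. obs_space :: ((real ^ 'd) \<times> real) measure) \<Otimes>\<^sub>M restrict_space borel (cbox 0 (1 :: real ^ 'd))) \<Otimes>\<^sub>M ?\<mu>)"
        by (rule measurable_compose[where g="\<lambda>x. x", OF _ id]) measurable
    qed measurable
    from \<mu>.borel_measurable_lebesgue_integral[OF this] show ?thesis
      by (simp add: f_def case_prod_unfold)
  qed
  then have f: "f \<in> estimators n" by (simp add: estimators_def)
  have "quadratic_risk n f P \<eta> \<le> ?b" if "(P, \<eta>) \<in> lipschitz_class L" for P \<eta>
  proof -
    interpret R: regression_model P \<eta> L
      by (rule regression_model_lipschitz_class) fact
    let ?\<Pi> = "PiM {1..n} (\<lambda>_. P)"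
    interpret \<Pi>: prob_space ?\<Pi> by (intro prob_space_PiM R.prob_space_P)
    interpret P\<mu>: pair_prob_space P ?\<mu> ..
    have sets_\<Pi>: "sets ?\<Pi> = sets (PiM {1..n} (\<lambda>_. obs_space))"
      by (intro sets_PiM_cong refl R.sets_P)
    have loss: "tree_loss \<eta> n \<in> borel_measurable (?\<Pi> \<Otimes>\<^sub>M (P \<Otimes>\<^sub>M ?\<mu>))"
      by (rule R.measurable_loss)
    have "quadratic_risk n f P \<eta> \<le> (\<integral>\<^sup>+D. \<integral>\<^sup>+z. \<integral>\<^sup>+t. tree_loss \<eta> n (D, z, t) \<partial>?\<mu> \<partial>P \<partial>?\<Pi>)"
      unfolding quadratic_risk_def
    proof (intro nn_integral_mono)
      fix D z assume D: "D \<in> space ?\<Pi>" and z: "z \<in> space P"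
      have D': "D \<in> space (PiM {1..n} (\<lambda>_. obs_space))"
        using D sets_eq_imp_space_eq[OF sets_\<Pi>] by simp
      let ?g = "\<lambda>t. \<eta> (fst z) - tree_estimate D n t (fst z)"
      have te [measurable]: "(\<lambda>t. tree_estimate D n t (fst z)) \<in> borel_measurable ?\<mu>"
        by (rule measurable_tree_estimate[OF measurable_const[OF D'] measurable_ident_sets borel_measurable_const]) simp
      have x: "fst z \<in> cbox 0 1" using z unfolding R.space_P by (simp add: mem_Times_iff)
      have g: "\<bar>?g t\<bar> \<le> 1" for t
        using R.range[OF x] tree_estimate_in_unit[of D n t "fst z"]
        unfolding atLeastAtMost_iff by linarith
      have "integrable ?\<mu> (\<lambda>t. tree_estimate D n t (fst z))"
        by (rule \<mu>.integrable_const_bound[where B=1])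
          (use tree_estimate_in_unit[of D n _ "fst z"] te in auto)
      then have "\<eta> (fst z) - f D (fst z) = (\<integral>t. ?g t \<partial>?\<mu>)"
        by (simp add: f_def \<mu>.prob_space)
      then have "ennreal ((\<eta> (fst z) - f D (fst z))\<^sup>2) \<le> ennreal (\<integral>t. (?g t)\<^sup>2 \<partial>?\<mu>)"
        using \<mu>.square_integral_le(1)[of ?g] g by (intro ennreal_leI) simp
      also have "\<dots> = (\<integral>\<^sup>+t. ennreal ((?g t)\<^sup>2) \<partial>?\<mu>)"
        using \<mu>.square_integral_le(2)[of ?g] g by (intro nn_integral_eq_integral[symmetric]) auto
      finally show "ennreal ((\<eta> (fst z) - f D (fst z))\<^sup>2) \<le> (\<integral>\<^sup>+t. tree_loss \<eta> n (D, z, t) \<partial>?\<mu>)"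
        by simp
    qed
    also have "\<dots> = (\<integral>\<^sup>+D. \<integral>\<^sup>+\<omega>. tree_loss \<eta> n (D, \<omega>) \<partial>(P \<Otimes>\<^sub>M ?\<mu>) \<partial>?\<Pi>)"
    proof (rule nn_integral_cong)
      fix D assume "D \<in> space ?\<Pi>"
      then have "(\<lambda>\<omega>. tree_loss \<eta> n (D, \<omega>)) \<in> borel_measurable (P \<Otimes>\<^sub>M ?\<mu>)"
        using measurable_compose[OF measurable_Pair1' loss] by simp
      from \<mu>.nn_integral_fst[OF this] show "(\<integral>\<^sup>+z. \<integral>\<^sup>+t. tree_loss \<eta> n (D, z, t) \<partial>?\<mu> \<partial>P) = (\<integral>\<^sup>+\<omega>. tree_loss \<eta> n (D, \<omega>) \<partial>(P \<Otimes>\<^sub>M ?\<mu>))" .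
    qed
    also have "\<dots> = (\<integral>\<^sup>+\<omega>. tree_loss \<eta> n \<omega> \<partial>(?\<Pi> \<Otimes>\<^sub>M (P \<Otimes>\<^sub>M ?\<mu>)))"
      by (rule P\<mu>.nn_integral_fst[OF loss])
    also have "\<dots> \<le> ?b"
      by (rule R.mondrian_tree_risk_le[OF \<mu> l]) (use n in simp)
    finally show ?thesis .
  qed
  then show ?thesis
    unfolding minimax_risk_def by (intro INF_lower2[OF f] SUP_least) auto
qed

section \<open>Balancing variance and bias\<close>

lemma powr_rate:
  fixes n d :: nat
  assumes n: "n \<ge> 1"
  defines "N \<equiv> real n powr (1 / (real d + 2))"
  shows "1 \<le> N" "real n = N ^ (d + 2)" "real n powr (- 2 / (real d + 2)) = 1 / N\<^sup>2"
proof -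
  show N: "1 \<le> N" using n by (simp add: N_def ge_one_powr_ge_zero)
  have "N ^ (d + 2) = N powr real (d + 2)"
    using N by (intro powr_realpow[symmetric]) simp
  also have "\<dots> = real n powr (1 / (real d + 2) * real (d + 2))"
    by (simp only: N_def powr_powr)
  also have "1 / (real d + 2) * real (d + 2) = 1" by simp
  finally show "real n = N ^ (d + 2)" using n by simp
  have "real n powr (- 2 / (real d + 2)) = N powr (- 2)"
    by (simp add: N_def powr_powr)
  also have "\<dots> = 1 / N\<^sup>2"
    using N by (simp add: powr_minus divide_inverse powr_numeral)
  finally show "real n powr (- 2 / (real d + 2)) = 1 / N\<^sup>2" .
qed

text \<open>With N = n powr (1 / (d + 2)) one has n = N^(d + 2) and N \<ge> 1, so 1 + l \<le> (1 +
  C) N. The first term is then of order N^d / N^(d + 2) and the second of order 1 / N^2, which is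
  the same.\<close>

lemma rate_bound:
  fixes n d :: nat and l c C B :: real
  assumes n: "n \<ge> 1" and c: "0 < c" and B: "0 \<le> B"
    and l: "c * real n powr (1 / (real d + 2)) \<le> l" "l \<le> C * real n powr (1 / (real d + 2))"
  shows "4 * (1 + l) ^ d / n + B / l\<^sup>2 \<le> (4 * (1 + C) ^ d + B / c\<^sup>2) * real n powr (- 2 / (real d + 2))"
proof -
  define N where "N = real n powr (1 / (real d + 2))"
  note N = powr_rate(1)[OF n, of d, folded N_def] and n_eq = powr_rate(2)[OF n, of d, folded N_def]
    and rate = powr_rate(3)[OF n, of d, folded N_def]
  have "0 < l" using l(1) c N unfolding N_def[symmetric] by (smt (verit) mult_pos_pos)
  have "1 + l \<le> (1 + C) * N" using l(2) N unfolding N_def[symmetric] by (simp add: algebra_simps)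
  then have "(1 + l) ^ d \<le> (1 + C) ^ d * N ^ d"
    using \<open>0 < l\<close> by (subst power_mult_distrib[symmetric], intro power_mono) auto
  then have "4 * (1 + l) ^ d / n \<le> 4 * ((1 + C) ^ d * N ^ d) / N ^ (d + 2)"
    using N unfolding n_eq by (intro divide_right_mono mult_left_mono) auto
  also have "\<dots> = 4 * (1 + C) ^ d / N\<^sup>2"
    using N by (simp add: power_add power2_eq_square)
  finally have 1: "4 * (1 + l) ^ d / n \<le> 4 * (1 + C) ^ d / N\<^sup>2" .
  have "(c * N)\<^sup>2 \<le> l\<^sup>2" using l(1) c N unfolding N_def[symmetric] by (intro power_mono) auto
  then have "B / l\<^sup>2 \<le> B / (c * N)\<^sup>2"
    using B c N \<open>0 < l\<close> by (intro divide_left_mono) auto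
  then show ?thesis
    using 1 unfolding rate by (simp add: power_mult_distrib add_divide_distrib)
qed

section \<open>A hypercube of regression functions\<close>

text \<open>Numerators start at 1, which gives exactly m values for each coordinate.\<close>

definition grid :: "nat \<Rightarrow> (real ^ 'd::finite) set" where
  "grid m = {x. \<forall>i. x $ i \<in> (\<lambda>k. real k / real m) ` {1..m}}"

lemma grid_eq_image:
  "grid m = (\<lambda>f. \<chi> i. f i) ` (UNIV \<rightarrow>\<^sub>E (\<lambda>k. real k / real m) ` {1..m})"
proof -
  have "x \<in> (\<lambda>f. \<chi> i. f i) ` (UNIV \<rightarrow>\<^sub>E (\<lambda>k. real k / real m) ` {1..m})" if "x \<in> grid m" for x :: "real ^ 'd"
    by (rule image_eqI[of _ _ "\<lambda>i. x $ i"]) (use that in \<open>auto simp: grid_def\<close>)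
  then show ?thesis by (auto simp: grid_def PiE_iff)
qed

lemma finite_grid: "finite (grid m :: (real ^ 'd::finite) set)"
  unfolding grid_eq_image by (intro finite_imageI finite_PiE) auto

lemma card_grid:
  assumes "m \<ge> 1"
  shows "card (grid m :: (real ^ 'd::finite) set) = m ^ CARD('d)"
proof -
  have "inj_on (\<lambda>f. \<chi> i. f i :: real ^ 'd) A" for A
    by (rule inj_onI) (auto simp: vec_eq_iff fun_eq_iff)
  then have "card (grid m :: (real ^ 'd) set) = card (UNIV \<rightarrow>\<^sub>E (\<lambda>k. real k / real m) ` {1..m} :: ('d \<Rightarrow> real) set)"
    unfolding grid_eq_image by (rule card_image)
  also have "\<dots> = (\<Prod>i\<in>(UNIV :: 'd set). card ((\<lambda>k. real k / real m) ` {1..m}))"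
    by (rule card_PiE) simp
  also have "card ((\<lambda>k. real k / real m) ` {1..m}) = m"
    using assms by (subst card_image) (auto simp: inj_on_def)
  finally show ?thesis by simp
qed

lemma grid_subset_cbox: "grid m \<subseteq> cbox 0 1"
  unfolding grid_def mem_box_cart subset_iff
proof (intro allI impI)
  fix x :: "real ^ 'd" and i assume "x \<in> {x. \<forall>i. x $ i \<in> (\<lambda>k. real k / real m) ` {1..m}}"
  then have "x $ i \<in> (\<lambda>k. real k / real m) ` {1..m}" by blast
  then obtain k where "x $ i = real k / real m" "k \<in> {1..m}" by (rule imageE)
  then show "0 $ i \<le> x $ i \<and> x $ i \<le> 1 $ i" by simp
qed

lemma dist_grid_ge:
  assumes "x \<in> grid m" "y \<in> grid m" "x \<noteq> y"
  shows "1 / m \<le> dist x y"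
proof -
  obtain i where i: "x $ i \<noteq> y $ i" using assms(3) by (auto simp: vec_eq_iff)
  obtain k l where kl: "x $ i = real k / m" "y $ i = real l / m"
    using assms(1,2) unfolding grid_def by blast
  then have "k \<noteq> l" using i by auto
  then have "1 \<le> \<bar>real k - real l\<bar>" by linarith
  then have "1 / m \<le> \<bar>real k - real l\<bar> / m" by (intro divide_right_mono) auto
  also have "\<dots> = dist (x $ i) (y $ i)"
    by (simp add: kl dist_real_def diff_divide_distrib[symmetric])
  also have "\<dots> \<le> dist x y" by (rule dist_vec_nth_le)
  finally show ?thesis .
qed

text \<open>The point \<open>(3, \<dots>, 3)\<close>, far from the cube, keeps the set nonempty: \<open>infdist x {} = 0\<close>.\<close>

definition bump :: "real \<Rightarrow> nat \<Rightarrow> (real ^ 'd::finite) set \<Rightarrow> real ^ 'd \<Rightarrow> real" where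
  "bump L m S x = 1 / 2 + max 0 (L / m - L * infdist x (insert (\<chi> i. 3) S))"

lemma bump_lipschitz:
  assumes "0 \<le> L"
  shows "L-lipschitz_on A (bump L m S)"
proof (rule lipschitz_onI[OF _ assms])
  fix x y
  have "dist (bump L m S x) (bump L m S y) \<le> \<bar>L * infdist x (insert (\<chi> i. 3) S) - L * infdist y (insert (\<chi> i. 3) S)\<bar>"
    by (auto simp: bump_def dist_real_def)
  also have "\<dots> = L * \<bar>infdist x (insert (\<chi> i. 3) S) - infdist y (insert (\<chi> i. 3) S)\<bar>"
    using assms by (simp add: right_diff_distrib[symmetric] abs_mult)
  also have "\<dots> \<le> L * dist x y"
    using assms by (intro mult_left_mono infdist_triangle_abs)
  finally show "dist (bump L m S x) (bump L m S y) \<le> L * dist x y" .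
qed

lemma bump_range:
  assumes "0 \<le> L" "L / m \<le> 1 / 2"
  shows "bump L m S x \<in> {0..1}"
proof -
  have "max 0 (L / m - L * infdist x (insert (\<chi> i. 3) S)) \<le> 1 / 2"
    using assms(2) mult_nonneg_nonneg[OF assms(1) infdist_nonneg[of x "insert (\<chi> i. 3) S"]]
    by (intro max.boundedI) linarith+
  moreover have "0 \<le> max 0 (L / m - L * infdist x (insert (\<chi> i. 3) S))" by simp
  ultimately show ?thesis
    unfolding bump_def atLeastAtMost_iff by linarith
qed

text \<open>The tents have slope L and height L / m, hence radius 1 / m, and distinct grid points
  are at least that far apart. So a tent over one grid point vanishes at all others.\<close>

lemma bump_grid:
  assumes m: "m \<ge> 1" and L: "0 < L" and x: "x \<in> grid m" and S: "S \<subseteq> grid m"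
  shows "bump L m S x = (if x \<in> S then 1 / 2 + L / m else 1 / 2)"
proof (cases "x \<in> S")
  case True
  then have "infdist x (insert (\<chi> i. 3) S) = 0" by simp
  then show ?thesis using True L by (simp add: bump_def)
next
  case False
  have "1 / m \<le> infdist x (insert (\<chi> i. 3) S)"
    unfolding infdist_notempty[OF insert_not_empty]
  proof (rule cINF_greatest)
    fix y :: "real ^ 'a" assume "y \<in> insert (\<chi> i. 3) S"
    then consider "y = (\<chi> i. 3)" | "y \<in> S" by auto
    then show "1 / real m \<le> dist x y"
    proof cases
      case 1
      \<comment> \<open>Any coordinate separates x from the far point: it is at most 1 for x and 3
        for that point.\<close>
      obtain i :: 'a where True by simp
      have "x $ i \<le> 1" using grid_subset_cbox[of m] x by (auto simp: mem_box_cart)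
      then have "1 \<le> dist (x $ i) (y $ i)" by (simp add: 1 dist_real_def)
      also have "\<dots> \<le> dist x y" by (rule dist_vec_nth_le)
      finally show ?thesis using m by (auto intro: order_trans[of _ 1])
    next
      case 2
      then show ?thesis using dist_grid_ge[OF x, of y] S False by auto
    qed
  qed simp
  then have "L * (1 / m) \<le> L * infdist x (insert (\<chi> i. 3) S)"
    using L by (intro mult_left_mono) auto
  then show ?thesis using False by (simp add: bump_def)
qed

section \<open>Laws with X uniform on a finite set\<close>

definition bernoulli_weight :: "(real ^ 'd::finite) set \<Rightarrow> (real ^ 'd \<Rightarrow> real) \<Rightarrow> (real ^ 'd) \<times> real \<Rightarrow> real" where
  "bernoulli_weight G \<eta> z = (if snd z = 1 then \<eta> (fst z) else 1 - \<eta> (fst z)) / card G"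

text \<open>A point measure is defined on all subsets of its support; pushing it forward along the
  identity gives it the sigma-algebra of \<open>obs_space\<close>, as \<open>lipschitz_class\<close>
  demands.\<close>

definition bernoulli_law :: "(real ^ 'd::finite) set \<Rightarrow> (real ^ 'd \<Rightarrow> real) \<Rightarrow> ((real ^ 'd) \<times> real) measure" where
  "bernoulli_law G \<eta> = distr (point_measure (G \<times> {0, 1}) (\<lambda>z. ennreal (bernoulli_weight G \<eta> z))) obs_space (\<lambda>z. z)"

lemma sets_bernoulli_law [simp, measurable_cong]: "sets (bernoulli_law G \<eta>) = sets obs_space"
  by (simp add: bernoulli_law_def)

lemma space_obs_space: "space obs_space = cbox 0 1 \<times> {0, 1}"
  by (simp add: obs_space_def space_restrict_space)

lemma measurable_point_measure_obs:
  assumes "G \<subseteq> cbox 0 1"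
  shows "(\<lambda>z. z) \<in> point_measure (G \<times> {0, 1}) w \<rightarrow>\<^sub>M obs_space"
  using assms by (auto simp: measurable_def space_obs_space space_point_measure sets_point_measure)

lemma nn_integral_bernoulli_law:
  assumes G: "finite G" "G \<subseteq> cbox 0 1" and f: "f \<in> borel_measurable obs_space"
  shows "(\<integral>\<^sup>+z. f z \<partial>bernoulli_law G \<eta>) = (\<Sum>z\<in>G \<times> {0, 1}. ennreal (bernoulli_weight G \<eta> z) * f z)"
  unfolding bernoulli_law_def using G f
  by (simp add: nn_integral_distr[OF measurable_point_measure_obs] nn_integral_point_measure_finite)

lemma integral_bernoulli_law:
  fixes f :: "_ \<Rightarrow> real"
  assumes G: "finite G" "G \<subseteq> cbox 0 1" and \<eta>: "\<And>x. \<eta> x \<in> {0..1}" and f: "f \<in> borel_measurable obs_space"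
  shows "(\<integral>z. f z \<partial>bernoulli_law G \<eta>) = (\<Sum>z\<in>G \<times> {0, 1}. bernoulli_weight G \<eta> z * f z)"
  unfolding bernoulli_law_def using G f \<eta>
  by (simp add: integral_distr[OF measurable_point_measure_obs] lebesgue_integral_point_measure_finite bernoulli_weight_def)

lemma sum_bernoulli_weight:
  fixes f :: "real ^ 'd::finite \<Rightarrow> real"
  shows "(\<Sum>z\<in>G \<times> {0, 1}. bernoulli_weight G \<eta> z * f (fst z)) = (\<Sum>x\<in>G. f x) / card G"
  unfolding sum.cartesian_product' 
  by (simp add: bernoulli_weight_def sum_divide_distrib algebra_simps add_divide_distrib[symmetric])

text \<open>At each point of G the two labels together have mass \<open>1 / card G\<close>, of which
  label 1 takes the share \<eta>. Summing over the points selected by an event about X gives the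
  characteristic property of the conditional expectation.\<close>

lemma bernoulli_law_in_lipschitz_class:
  fixes G :: "(real ^ 'd::finite) set"
  assumes G: "finite G" "G \<noteq> {}" "G \<subseteq> cbox 0 1" and \<eta>: "\<And>x. \<eta> x \<in> {0..1}" and L: "L-lipschitz_on UNIV \<eta>"
  shows "(bernoulli_law G \<eta>, \<eta>) \<in> lipschitz_class L"
proof -
  let ?P = "bernoulli_law G \<eta>"
  have space_P: "space ?P = cbox 0 1 \<times> {0, 1}"
    by (simp add: bernoulli_law_def space_obs_space)
  have w: "0 \<le> bernoulli_weight G \<eta> z" for z
    using \<eta>[of "fst z"] by (simp add: bernoulli_weight_def)
  have card: "0 < card G" using G by (simp add: card_gt_0_iff)
  have "emeasure ?P (space ?P) = (\<integral>\<^sup>+z. 1 \<partial>?P)" by simp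
  also have "\<dots> = (\<Sum>z\<in>G \<times> {0, 1}. ennreal (bernoulli_weight G \<eta> z) * 1)"
    by (rule nn_integral_bernoulli_law[OF G(1,3)]) simp
  also have "\<dots> = ennreal (\<Sum>z\<in>G \<times> {0, 1}. bernoulli_weight G \<eta> z)"
    using w by simp
  also have "(\<Sum>z\<in>G \<times> {0, 1}. bernoulli_weight G \<eta> z) = 1"
    using sum_bernoulli_weight[of G \<eta> "\<lambda>_. 1"] card by simp
  finally interpret prob_space ?P by (intro prob_spaceI) simp
  have \<eta>_cont: "continuous_on (cbox 0 1) \<eta>"
    using lipschitz_on_continuous_on[OF L] by (rule continuous_on_subset) simp
  let ?F = "vimage_algebra (space ?P) fst (borel :: (real ^ 'd) measure)"
  have fst_P: "fst \<in> borel_measurable ?P"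
    unfolding measurable_cong_sets[OF sets_bernoulli_law refl] by (rule measurable_obs_fst)
  have "subalgebra ?P ?F"
    unfolding subalgebra_def
    using measurable_sets[OF fst_P] by (auto simp: sets_vimage_algebra2)
  then interpret finite_measure_subalgebra ?P ?F by unfold_locales
  have fst_F: "fst \<in> ?F \<rightarrow>\<^sub>M borel" by (rule measurable_vimage_algebra1) simp
  have \<eta>_F: "(\<lambda>z. \<eta> (fst z)) \<in> borel_measurable ?F"
    by (rule measurable_compose_continuous_on_cbox[OF \<eta>_cont fst_F]) (auto simp: space_P)
  have \<eta>_P [measurable]: "(\<lambda>z. \<eta> (fst z)) \<in> borel_measurable obs_space"
    by (rule measurable_compose_continuous_on_cbox[OF \<eta>_cont measurable_obs_fst]) (auto simp: space_obs_space)
  let ?f = "indicator {\<omega> \<in> space ?P. snd \<omega> = 1} :: _ \<Rightarrow> real"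
  have f_P [measurable]: "?f \<in> borel_measurable obs_space"
    unfolding space_P space_obs_space[symmetric] by measurable
  have "AE \<omega> in ?P. real_cond_exp ?P ?F ?f \<omega> = \<eta> (fst \<omega>)"
  proof (rule real_cond_exp_charact)
    fix B assume "B \<in> sets ?F"
    then obtain A where A [measurable]: "A \<in> sets borel" and B: "B = fst -` A \<inter> space ?P"
      by (auto simp: sets_vimage_algebra2)
    have "(\<integral>z\<in>B. ?f z \<partial>?P) = (\<integral>z. indicator A (fst z) * ?f z \<partial>?P)"
      unfolding set_lebesgue_integral_def B
      by (intro Bochner_Integration.integral_cong) (auto split: split_indicator)
    also have "\<dots> = (\<Sum>z\<in>G \<times> {0, 1}. bernoulli_weight G \<eta> z * (indicator A (fst z) * ?f z))"
      by (rule integral_bernoulli_law[OF G(1,3) \<eta>]) measurable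
    also have "\<dots> = (\<Sum>z\<in>G \<times> {0, 1}. bernoulli_weight G \<eta> z * (indicator A (fst z) * \<eta> (fst z)))"
      unfolding sum.cartesian_product'
    proof (rule sum.cong[OF refl])
      fix x assume "x \<in> G"
      then have "x \<in> cbox 0 1" using G(3) by auto
      then show "(\<Sum>y\<in>{0, 1}. bernoulli_weight G \<eta> (x, y) * (indicator A (fst (x, y)) * ?f (x, y))) =
          (\<Sum>y\<in>{0, 1}. bernoulli_weight G \<eta> (x, y) * (indicator A (fst (x, y)) * \<eta> (fst (x, y))))"
        by (cases "x \<in> A") (simp_all add: bernoulli_weight_def space_P add_divide_distrib[symmetric] algebra_simps)
    qed
    also have "\<dots> = (\<integral>z. indicator A (fst z) * \<eta> (fst z) \<partial>?P)"
      by (rule integral_bernoulli_law[OF G(1,3) \<eta>, symmetric]) measurable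
    also have "\<dots> = (\<integral>z\<in>B. \<eta> (fst z) \<partial>?P)"
      unfolding set_lebesgue_integral_def B
      by (intro Bochner_Integration.integral_cong) (auto split: split_indicator)
    finally show "(\<integral>z\<in>B. ?f z \<partial>?P) = (\<integral>z\<in>B. \<eta> (fst z) \<partial>?P)" .
  next
    show "integrable ?P ?f"
      by (rule integrable_const_bound[where B=1]) (auto split: split_indicator)
    show "integrable ?P (\<lambda>z. \<eta> (fst z))"
      by (rule integrable_const_bound[where B=1]) (use \<eta> in auto)
  qed (rule \<eta>_F)
  then have "cond_prob_function ?P fst snd \<eta>"
    using \<eta> by (auto simp: cond_prob_function_def)
  moreover have "L-lipschitz_on (cbox 0 1) \<eta>" using L by (rule lipschitz_on_subset) simp
  ultimately show ?thesis
    by (auto simp: lipschitz_class_def prob_space_axioms)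
qed

section \<open>Two hypotheses compared through their likelihood ratio\<close>

lemma PiM_density:
  fixes r :: "'a \<Rightarrow> ennreal"
  assumes "prob_space P" "prob_space (density P r)" and I: "finite I" and r [measurable]: "r \<in> borel_measurable P"
  shows "PiM I (\<lambda>_. density P r) = density (PiM I (\<lambda>_. P)) (\<lambda>D. \<Prod>i\<in>I. r (D i))"
proof -
  interpret P: prob_space P by fact
  interpret R: prob_space "density P r" by fact
  interpret \<Pi>P: product_sigma_finite "\<lambda>_. P" ..
  interpret \<Pi>R: product_sigma_finite "\<lambda>_. density P r" ..
  have m: "(\<lambda>D. \<Prod>i\<in>I. r (D i)) \<in> borel_measurable (PiM I (\<lambda>_. P))"
    by measurable
  show ?thesis
  \<comment> \<open>A product measure is determined by rectangles, and on a rectangle the integral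
    of the product density factorises.\<close>
  proof (rule \<Pi>R.PiM_eqI[symmetric, OF I])
    show "sets (density (PiM I (\<lambda>_. P)) (\<lambda>D. \<Prod>i\<in>I. r (D i))) = sets (PiM I (\<lambda>_. density P r))"
      by (simp cong: sets_PiM_cong)
    fix A assume A: "\<And>i. i \<in> I \<Longrightarrow> A i \<in> sets (density P r)"
    then have [measurable]: "PiE I A \<in> sets (PiM I (\<lambda>_. P))"
      using I by (intro sets_PiM_I_finite) auto
    have "emeasure (density (PiM I (\<lambda>_. P)) (\<lambda>D. \<Prod>i\<in>I. r (D i))) (PiE I A) =
        (\<integral>\<^sup>+D. (\<Prod>i\<in>I. r (D i)) * indicator (PiE I A) D \<partial>PiM I (\<lambda>_. P))"
      by (rule emeasure_density[OF m]) measurable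
    also have "\<dots> = (\<integral>\<^sup>+D. (\<Prod>i\<in>I. r (D i) * indicator (A i) (D i)) \<partial>PiM I (\<lambda>_. P))"
    proof (rule nn_integral_cong)
      fix D assume "D \<in> space (PiM I (\<lambda>_. P))"
      then have "indicator (PiE I A) D = (\<Prod>i\<in>I. indicator (A i) (D i) :: ennreal)"
        using I by (auto simp: indicator_def PiE_iff space_PiM prod_zero_iff split: if_splits)
      then show "(\<Prod>i\<in>I. r (D i)) * indicator (PiE I A) D = (\<Prod>i\<in>I. r (D i) * indicator (A i) (D i))"
        by (simp add: prod.distrib)
    qed
    also have "\<dots> = (\<Prod>i\<in>I. \<integral>\<^sup>+z. r z * indicator (A i) z \<partial>P)"
      using A by (intro \<Pi>P.product_nn_integral_prod I) auto
    also have "\<dots> = (\<Prod>i\<in>I. emeasure (density P r) (A i))"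
      using A by (intro prod.cong refl emeasure_density[symmetric]) auto
    finally show "emeasure (density (PiM I (\<lambda>_. P)) (\<lambda>D. \<Prod>i\<in>I. r (D i))) (PiE I A) = (\<Prod>i\<in>I. emeasure (density P r) (A i))" .
  qed
qed


text \<open>An estimate cannot be close to v under one law and close to v + h under the other while
  the likelihood ratio \<rho> of the samples has a moderate second moment. That ratio is a product
  over the sample, so its second moment is the power \<open>b ^ card I\<close>.\<close>

lemma two_point_risk_ge:
  fixes r :: "'a \<Rightarrow> real" and a :: "('i \<Rightarrow> 'a) \<Rightarrow> real"
  assumes P: "prob_space P" and r [measurable]: "r \<in> borel_measurable P" and r0: "\<And>z. z \<in> space P \<Longrightarrow> 0 \<le> r z"
    and r1: "(\<integral>\<^sup>+z. ennreal (r z) \<partial>P) = 1" and r2: "(\<integral>\<^sup>+z. ennreal ((r z)\<^sup>2) \<partial>P) = ennreal b" and b: "0 \<le> b" and I: "finite I"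
    and a [measurable]: "a \<in> borel_measurable (PiM I (\<lambda>_. P))"
  shows "ennreal (h\<^sup>2 / (1 + b ^ card I)) \<le>
    (\<integral>\<^sup>+D. ennreal ((v - a D)\<^sup>2) \<partial>PiM I (\<lambda>_. P)) +
    (\<integral>\<^sup>+D. ennreal ((v + h - a D)\<^sup>2) \<partial>PiM I (\<lambda>_. density P (\<lambda>z. ennreal (r z))))"
    (is "_ \<le> ?R0 + ?R1")
proof -
  interpret P: prob_space P by fact
  let ?\<Pi> = "PiM I (\<lambda>_. P)"
  interpret \<Pi>P: product_sigma_finite "\<lambda>_. P" ..
  interpret \<Pi>: prob_space ?\<Pi> by (intro prob_space_PiM P)
  have dens: "prob_space (density P (\<lambda>z. ennreal (r z)))"
  proof
    have "emeasure (density P (\<lambda>z. ennreal (r z))) (space P) = (\<integral>\<^sup>+z. ennreal (r z) * indicator (space P) z \<partial>P)"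
      by (rule emeasure_density) auto
    also have "\<dots> = (\<integral>\<^sup>+z. ennreal (r z) \<partial>P)"
      by (intro nn_integral_cong) auto
    finally show "emeasure (density P (\<lambda>z. ennreal (r z))) (space (density P (\<lambda>z. ennreal (r z)))) = 1"
      using r1 by simp
  qed
  define \<rho> where "\<rho> D = (\<Prod>i\<in>I. r (D i))" for D
  \<comment> \<open>The estimate below yields
    \<open>h\<^sup>2 * (2 * u - u\<^sup>2 * (1 + b ^ card I))\<close> for every positive u; this u
    maximises it.\<close>
  define u where "u = 1 / (1 + b ^ card I)"
  have u: "0 < u" "u * (1 + b ^ card I) = 1"
  proof -
    have "0 < 1 + b ^ card I" using zero_le_power[OF b, of "card I"] by linarith
    then show "0 < u" "u * (1 + b ^ card I) = 1" by (simp_all add: u_def)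
  qed
  have D_space: "D i \<in> space P" if "D \<in> space ?\<Pi>" "i \<in> I" for D i
    using that by (auto simp: space_PiM PiE_iff)
  have \<rho>_nonneg: "0 \<le> \<rho> D" if "D \<in> space ?\<Pi>" for D
    unfolding \<rho>_def by (intro prod_nonneg ballI r0 D_space[OF that])
  have \<rho>_ennreal: "ennreal (\<rho> D) = (\<Prod>i\<in>I. ennreal (r (D i)))" if "D \<in> space ?\<Pi>" for D
    unfolding \<rho>_def by (intro prod_ennreal[symmetric] r0 D_space[OF that])
  have [measurable]: "\<rho> \<in> borel_measurable ?\<Pi>"
    unfolding \<rho>_def[abs_def] by measurable
  have E\<rho>: "(\<integral>\<^sup>+D. ennreal (\<rho> D) \<partial>?\<Pi>) = 1"
  proof -
    have "(\<integral>\<^sup>+D. ennreal (\<rho> D) \<partial>?\<Pi>) = (\<integral>\<^sup>+D. (\<Prod>i\<in>I. ennreal (r (D i))) \<partial>?\<Pi>)"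
      by (intro nn_integral_cong \<rho>_ennreal)
    also have "\<dots> = (\<Prod>i\<in>I. \<integral>\<^sup>+z. ennreal (r z) \<partial>P)"
      by (rule \<Pi>P.product_nn_integral_prod) (use I in auto)
    finally show ?thesis by (simp add: r1)
  qed
  have E\<rho>_sq: "(\<integral>\<^sup>+D. ennreal ((\<rho> D)\<^sup>2) \<partial>?\<Pi>) = ennreal (b ^ card I)"
  proof -
    have "(\<integral>\<^sup>+D. ennreal ((\<rho> D)\<^sup>2) \<partial>?\<Pi>) = (\<integral>\<^sup>+D. (\<Prod>i\<in>I. ennreal ((r (D i))\<^sup>2)) \<partial>?\<Pi>)"
      by (intro nn_integral_cong) (simp add: \<rho>_def prod_power_distrib prod_ennreal)
    also have "\<dots> = (\<Prod>i\<in>I. \<integral>\<^sup>+z. ennreal ((r z)\<^sup>2) \<partial>P)"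
      by (rule \<Pi>P.product_nn_integral_prod) (use I in auto)
    finally show ?thesis using b by (simp add: r2 ennreal_power)
  qed
  have R1: "?R1 = (\<integral>\<^sup>+D. ennreal (\<rho> D * (v + h - a D)\<^sup>2) \<partial>?\<Pi>)"
  proof -
    have "?R1 = (\<integral>\<^sup>+D. (\<Prod>i\<in>I. ennreal (r (D i))) * ennreal ((v + h - a D)\<^sup>2) \<partial>?\<Pi>)"
      unfolding PiM_density[OF P dens I measurable_compose[OF r measurable_ennreal]]
      by (rule nn_integral_density) measurable
    also have "\<dots> = (\<integral>\<^sup>+D. ennreal (\<rho> D * (v + h - a D)\<^sup>2) \<partial>?\<Pi>)"
    proof (rule nn_integral_cong)
      fix D assume D: "D \<in> space ?\<Pi>"
      show "(\<Prod>i\<in>I. ennreal (r (D i))) * ennreal ((v + h - a D)\<^sup>2) = ennreal (\<rho> D * (v + h - a D)\<^sup>2)"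
        unfolding ennreal_mult'[OF \<rho>_nonneg[OF D]] \<rho>_ennreal[OF D] ..
    qed
    finally show ?thesis .
  qed
  \<comment> \<open>Minimising over \<open>a D\<close> leaves \<open>h\<^sup>2 \<rho> / (1 + \<rho>)\<close>, and \<open>1 / (1 + \<rho>) \<ge> 2 u - u\<^sup>2 (1 + \<rho>)\<close> turns this
    into a bound that only needs the first two moments of \<open>\<rho>\<close>.\<close>
  have point: "2 * u * h\<^sup>2 * \<rho> D \<le> (v - a D)\<^sup>2 + \<rho> D * (v + h - a D)\<^sup>2 + h\<^sup>2 * u\<^sup>2 * (\<rho> D + (\<rho> D)\<^sup>2)" if D: "D \<in> space ?\<Pi>" for D
  proof -
    define w where "w = \<rho> D"
    define e where "e = a D - v"
    have w: "0 \<le> w" using \<rho>_nonneg[OF D] by (simp add: w_def)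
    \<comment> \<open>The first square completes the square in e, and the second is the gap in the
      linearisation of 1 / (1 + w).\<close>
    have "(1 + w) * (e\<^sup>2 + w * (h - e)\<^sup>2 + h\<^sup>2 * u\<^sup>2 * (w + w\<^sup>2) - 2 * u * h\<^sup>2 * w) =
        ((1 + w) * e - w * h)\<^sup>2 + w * (h * (1 - u * (1 + w)))\<^sup>2"
      by algebra
    also have "\<dots> \<ge> 0" using w by (intro add_nonneg_nonneg mult_nonneg_nonneg) auto
    finally have ge: "0 \<le> e\<^sup>2 + w * (h - e)\<^sup>2 + h\<^sup>2 * u\<^sup>2 * (w + w\<^sup>2) - 2 * u * h\<^sup>2 * w"
      using w by (simp add: zero_le_mult_iff)
    have eq: "(v - a D)\<^sup>2 = e\<^sup>2" "(v + h - a D)\<^sup>2 = (h - e)\<^sup>2"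
      by (simp_all add: e_def power2_eq_square algebra_simps)
    show ?thesis
      unfolding eq w_def[symmetric] using ge by linarith
  qed
  have "ennreal (2 * u * h\<^sup>2) = (\<integral>\<^sup>+D. ennreal (2 * u * h\<^sup>2) * ennreal (\<rho> D) \<partial>?\<Pi>)"
    by (simp add: nn_integral_cmult E\<rho>)
  also have "\<dots> \<le> (\<integral>\<^sup>+D. ennreal ((v - a D)\<^sup>2) + ennreal (\<rho> D * (v + h - a D)\<^sup>2) +
      ennreal (h\<^sup>2 * u\<^sup>2) * (ennreal (\<rho> D) + ennreal ((\<rho> D)\<^sup>2)) \<partial>?\<Pi>)"
  proof (rule nn_integral_mono)
    fix D assume D: "D \<in> space ?\<Pi>"
    have "ennreal (2 * u * h\<^sup>2) * ennreal (\<rho> D) = ennreal (2 * u * h\<^sup>2 * \<rho> D)"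
      using u by (simp add: ennreal_mult')
    also have "\<dots> \<le> ennreal ((v - a D)\<^sup>2 + \<rho> D * (v + h - a D)\<^sup>2 + h\<^sup>2 * u\<^sup>2 * (\<rho> D + (\<rho> D)\<^sup>2))"
      by (rule ennreal_leI[OF point[OF D]])
    also have "\<dots> = ennreal ((v - a D)\<^sup>2) + ennreal (\<rho> D * (v + h - a D)\<^sup>2) +
      ennreal (h\<^sup>2 * u\<^sup>2) * (ennreal (\<rho> D) + ennreal ((\<rho> D)\<^sup>2))"
      using \<rho>_nonneg[OF D] by (simp add: ennreal_mult')
    finally show "ennreal (2 * u * h\<^sup>2) * ennreal (\<rho> D) \<le> \<dots>" .
  qed
  also have "\<dots> = ?R0 + ?R1 + ennreal (h\<^sup>2 * u\<^sup>2) * (1 + ennreal (b ^ card I))"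
    unfolding R1 by (simp add: nn_integral_add nn_integral_cmult E\<rho> E\<rho>_sq)
  also have "ennreal (h\<^sup>2 * u\<^sup>2) * (1 + ennreal (b ^ card I)) = ennreal (h\<^sup>2 * u)"
  proof -
    have "1 + ennreal (b ^ card I) = ennreal (1 + b ^ card I)" using b by simp
    then have "ennreal (h\<^sup>2 * u\<^sup>2) * (1 + ennreal (b ^ card I)) = ennreal (h\<^sup>2 * u\<^sup>2 * (1 + b ^ card I))"
      by (simp only: ennreal_mult'[symmetric] zero_le_power2 mult_nonneg_nonneg)
    also have "h\<^sup>2 * u\<^sup>2 * (1 + b ^ card I) = h\<^sup>2 * (u * (u * (1 + b ^ card I)))"
      by (simp add: power2_eq_square)
    finally show ?thesis unfolding u(2) by simp
  qed
  finally have "ennreal (h\<^sup>2 * u) + ennreal (h\<^sup>2 * u) \<le> ennreal (h\<^sup>2 * u) + (?R0 + ?R1)"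
    using u(1) by (subst ennreal_plus[symmetric]) (auto simp: add.commute mult_ac)
  then have "ennreal (h\<^sup>2 * u) \<le> ?R0 + ?R1"
    by (rule ennreal_add_left_cancel_le[THEN iffD1, THEN disjE]) simp_all
  then show ?thesis by (simp add: u_def)
qed

section \<open>Lower bound and conclusion\<close>

lemma bump_law_in_lipschitz_class:
  assumes m: "m \<ge> 1" and L: "0 < L" "L / m \<le> 1 / 2"
  shows "(bernoulli_law (grid m) (bump L m S), bump L m S :: real ^ 'd::finite \<Rightarrow> real) \<in> lipschitz_class L"
proof (rule bernoulli_law_in_lipschitz_class[OF finite_grid _ grid_subset_cbox])
  show "grid m \<noteq> ({} :: (real ^ 'd) set)"
    using card_grid[OF m, where 'd='d] m by (metis card.empty power_not_zero not_one_le_zero)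
  show "bump L m S x \<in> {0..1}" for x
    by (rule bump_range[OF less_imp_le[OF L(1)] L(2)])
  show "L-lipschitz_on UNIV (bump L m S)"
    by (rule bump_lipschitz[OF less_imp_le[OF L(1)]])
qed

text \<open>Adding g to S changes the probability of label 1 at g from 1 / 2 to 1 / 2 + L / m and
  nothing else on the grid. The ratio of the weights is therefore 1 + 2 L / m or 1 - 2 L / m at g,
  and 1 elsewhere.\<close>

lemma bernoulli_law_insert:
  fixes g :: "real ^ 'd::finite"
  assumes m: "m \<ge> 1" and L: "0 < L" "L / m \<le> 1 / 2" and S: "S \<subseteq> grid m" and g: "g \<in> grid m" "g \<notin> S"
  defines "r \<equiv> \<lambda>z. if fst z = g then if snd z = 1 then 1 + 2 * (L / m) else 1 - 2 * (L / m) else 1"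
  shows "bernoulli_law (grid m) (bump L m (insert g S)) =
    density (bernoulli_law (grid m) (bump L m S)) (\<lambda>z. ennreal (r z))"
proof (rule measure_eqI)
  let ?w = "bernoulli_weight (grid m) (bump L m S)" and ?w' = "bernoulli_weight (grid m) (bump L m (insert g S))"
  have r [measurable]: "r \<in> borel_measurable obs_space"
    unfolding r_def by measurable
  fix A assume "A \<in> sets (bernoulli_law (grid m) (bump L m (insert g S)))"
  then have A [measurable]: "A \<in> sets obs_space" by simp
  have "ennreal (?w' z) = ennreal (?w z) * ennreal (r z)" if "z \<in> grid m \<times> {0, 1}" for z
  proof -
    have x: "fst z \<in> grid m" using that by auto
    have "?w' z = ?w z * r z"
      using S g by (auto simp: bernoulli_weight_def r_def bump_grid[OF m L(1) x] bump_grid[OF m L(1) g(1)] field_simps)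
    moreover have "0 \<le> ?w z"
      using bump_range[OF less_imp_le[OF L(1)] L(2), of S "fst z"] by (simp add: bernoulli_weight_def)
    ultimately show ?thesis by (simp add: ennreal_mult')
  qed
  then have "(\<integral>\<^sup>+z. indicator A z \<partial>bernoulli_law (grid m) (bump L m (insert g S))) =
      (\<integral>\<^sup>+z. ennreal (r z) * indicator A z \<partial>bernoulli_law (grid m) (bump L m S))"
    by (subst (1 2) nn_integral_bernoulli_law[OF finite_grid grid_subset_cbox]; (measurable)?)
      (auto intro!: sum.cong simp: mult.assoc)
  then show "emeasure (bernoulli_law (grid m) (bump L m (insert g S))) A =
      emeasure (density (bernoulli_law (grid m) (bump L m S)) (\<lambda>z. ennreal (r z))) A"
    by (simp add: emeasure_density)
qed simp

text \<open>At g both labels have probability 1 / 2, so the squared ratio averages to 1 + 4 (L /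
  m)^2 there. Since g carries mass 1 / m^d, the second moment for one observation is 1 + 4 (L / m)^2
  / m^d.\<close>

lemma assouad_pair_risk_ge:
  fixes g :: "real ^ 'd::finite"
  assumes m: "m \<ge> 1" and L: "0 < L" "L / m \<le> 1 / 2" and S: "S \<subseteq> grid m" and g: "g \<in> grid m" "g \<notin> S"
    and a: "a \<in> borel_measurable (PiM {1..n} (\<lambda>_. obs_space))"
  shows "ennreal ((L / m)\<^sup>2 / (1 + (1 + 4 * (L / m)\<^sup>2 / real m ^ CARD('d)) ^ n)) \<le>
    (\<integral>\<^sup>+D. ennreal ((bump L m S g - a D)\<^sup>2) \<partial>PiM {1..n} (\<lambda>_. bernoulli_law (grid m) (bump L m S))) +
    (\<integral>\<^sup>+D. ennreal ((bump L m (insert g S) g - a D)\<^sup>2) \<partial>PiM {1..n} (\<lambda>_. bernoulli_law (grid m) (bump L m (insert g S))))"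
proof -
  let ?P = "\<lambda>S. bernoulli_law (grid m) (bump L m S)"
  define r where "r z = (if fst z = g then if snd z = 1 then 1 + 2 * (L / m) else 1 - 2 * (L / m) else 1)"
    for z :: "(real ^ 'd) \<times> real"
  have law: "?P (insert g S) = density (?P S) (\<lambda>z. ennreal (r z))"
    unfolding r_def by (rule bernoulli_law_insert[OF m L S g])
  have prob: "prob_space (?P S)" for S
    using bump_law_in_lipschitz_class[OF m L, of S] by (auto simp: lipschitz_class_def)
  have r [measurable]: "r \<in> borel_measurable obs_space"
    unfolding r_def[abs_def] by measurable
  have r0: "0 \<le> r z" for z
  proof -
    have "2 * (L / m) \<le> 1" using L(2) by linarith
    then show ?thesis using L(1) by (simp add: r_def)
  qed
  have r1: "(\<integral>\<^sup>+z. ennreal (r z) \<partial>?P S) = 1"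
  proof -
    interpret prob_space "?P (insert g S)" by (rule prob)
    have "1 = emeasure (density (?P S) (\<lambda>z. ennreal (r z))) (space (?P S))"
      using emeasure_space_1 unfolding law by simp
    also have "\<dots> = (\<integral>\<^sup>+z. ennreal (r z) * indicator (space (?P S)) z \<partial>?P S)"
      by (rule emeasure_density[OF _ sets.top]) measurable
    also have "\<dots> = (\<integral>\<^sup>+z. ennreal (r z) \<partial>?P S)"
      by (intro nn_integral_cong) auto
    finally show ?thesis by simp
  qed
  let ?N = "real (card (grid m :: (real ^ 'd) set))"
  have N: "?N = real m ^ CARD('d)" "0 < ?N" using m by (simp_all add: card_grid)
  have r2: "(\<integral>\<^sup>+z. ennreal ((r z)\<^sup>2) \<partial>?P S) = ennreal (1 + 4 * (L / m)\<^sup>2 / real m ^ CARD('d))"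
  proof -
    have "(\<integral>\<^sup>+z. ennreal ((r z)\<^sup>2) \<partial>?P S) = (\<Sum>z\<in>grid m \<times> {0, 1}. ennreal (bernoulli_weight (grid m) (bump L m S) z) * ennreal ((r z)\<^sup>2))"
      by (rule nn_integral_bernoulli_law[OF finite_grid grid_subset_cbox]) measurable
    also have "\<dots> = ennreal (\<Sum>z\<in>grid m \<times> {0, 1}. bernoulli_weight (grid m) (bump L m S) z * (r z)\<^sup>2)"
    proof -
      have "0 \<le> bernoulli_weight (grid m) (bump L m S) z" for z
        using bump_range[OF less_imp_le[OF L(1)] L(2), of S "fst z"] by (simp add: bernoulli_weight_def)
      then show ?thesis by (simp add: ennreal_mult'[symmetric])
    qed
    also have "(\<Sum>z\<in>grid m \<times> {0, 1}. bernoulli_weight (grid m) (bump L m S) z * (r z)\<^sup>2) =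
        (\<Sum>x\<in>grid m. 1 / ?N + (if x = g then 4 * (L / m)\<^sup>2 / ?N else 0))"
      unfolding sum.cartesian_product'
    proof (rule sum.cong[OF refl])
      fix x :: "real ^ 'd"
      show "(\<Sum>y\<in>{0, 1}. bernoulli_weight (grid m) (bump L m S) (x, y) * (r (x, y))\<^sup>2) =
          1 / ?N + (if x = g then 4 * (L / m)\<^sup>2 / ?N else 0)"
      proof (cases "x = g")
        case True
        have key: "(1 - 1 / 2) / N * (1 - 2 * h)\<^sup>2 + 1 / 2 / N * (1 + 2 * h)\<^sup>2 = 1 / N + 4 * h\<^sup>2 / N" for h N :: real
          by (cases "N = 0") (simp_all add: field_simps power2_eq_square)
        have "bernoulli_weight (grid m) (bump L m S) (g, 0) = (1 - 1 / 2) / ?N"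
          "bernoulli_weight (grid m) (bump L m S) (g, 1) = 1 / 2 / ?N"
          using g by (simp_all add: bernoulli_weight_def bump_grid[OF m L(1) g(1) S])
        moreover have "r (g, 0) = 1 - 2 * (L / m)" "r (g, 1) = 1 + 2 * (L / m)"
          by (simp_all add: r_def)
        moreover have "(\<Sum>y\<in>{0, 1}. F y) = F 0 + F 1" for F :: "real \<Rightarrow> real"
          by simp
        ultimately show ?thesis
          using True key[of ?N "L / m"] by (simp only: if_True refl)
      qed (simp add: bernoulli_weight_def r_def add_divide_distrib[symmetric])
    qed
    also have "\<dots> = 1 + 4 * (L / m)\<^sup>2 / ?N"
      using N(2) g(1) by (auto simp: sum.distrib finite_grid)
    finally show ?thesis unfolding N(1) .
  qed
  have bump: "bump L m S g = 1 / 2" "bump L m (insert g S) g = 1 / 2 + L / m"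
    using g by (simp_all add: bump_grid[OF m L(1) g(1)] S)
  have "a \<in> borel_measurable (PiM {1..n} (\<lambda>_. ?P S))"
    using a by (simp cong: measurable_cong_sets sets_PiM_cong)
  from two_point_risk_ge[OF prob _ r0 r1 r2 _ _ this, of "L / m" "1 / 2"] show ?thesis
    unfolding bump law by simp
qed

text \<open>Pairs the hypotheses that differ only at g, so that the two-point bound can be applied
  to each pair.\<close>

lemma sum_Pow_remove:
  fixes F :: "'a set \<Rightarrow> 'b::comm_monoid_add"
  assumes "finite G" "g \<in> G"
  shows "(\<Sum>S\<in>Pow G. F S) = (\<Sum>S\<in>Pow (G - {g}). F S + F (insert g S))"
proof -
  have G: "G = insert g (G - {g})" using assms by auto
  have "(\<Sum>S\<in>Pow G. F S) = (\<Sum>S\<in>Pow (G - {g}). F S) + (\<Sum>S\<in>insert g ` Pow (G - {g}). F S)"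
    by (subst G, subst Pow_insert, rule sum.union_disjoint) (use assms in auto)
  also have "(\<Sum>S\<in>insert g ` Pow (G - {g}). F S) = (\<Sum>S\<in>Pow (G - {g}). F (insert g S))"
    by (subst sum.reindex) (auto simp: inj_on_def)
  finally show ?thesis by (simp add: sum.distrib)
qed

text \<open>Assouad's method: the risk is averaged over the hypercube of all subsets of the grid.\<close>

lemma minimax_risk_ge:
  fixes m n :: nat and L :: real
  assumes m: "m \<ge> 1" and L: "0 < L" "L / m \<le> 1 / 2"
  shows "ennreal ((L / m)\<^sup>2 / (2 * (1 + (1 + 4 * (L / m)\<^sup>2 / real m ^ CARD('d)) ^ n))) \<le> minimax_risk TYPE('d::finite) L n"
  unfolding minimax_risk_def
proof (rule INF_greatest)
  fix f :: "(nat \<Rightarrow> (real ^ 'd) \<times> real) \<Rightarrow> real ^ 'd \<Rightarrow> real" assume "f \<in> estimators n"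
  then have f: "case_prod f \<in> borel_measurable (PiM {1..n} (\<lambda>_. obs_space) \<Otimes>\<^sub>M restrict_space borel (cbox 0 1))"
    by (simp add: estimators_def)
  let ?W = "SUP (P, \<eta>)\<in>lipschitz_class L. quadratic_risk n f P \<eta>"
  let ?G = "grid m :: (real ^ 'd) set"
  let ?P = "\<lambda>S. bernoulli_law ?G (bump L m S)"
  let ?\<Pi> = "\<lambda>S. PiM {1..n} (\<lambda>_. ?P S)"
  define N where "N = card ?G"
  define R where "R S g = (\<integral>\<^sup>+D. ennreal ((bump L m S g - f D g)\<^sup>2) \<partial>?\<Pi> S)" for S g
  define \<kappa> where "\<kappa> = (L / m)\<^sup>2 / (1 + (1 + 4 * (L / m)\<^sup>2 / real m ^ CARD('d)) ^ n)"
  have N: "N = m ^ CARD('d)" "0 < N" using m by (simp_all add: N_def card_grid)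
  have range: "bump L m S x \<in> {0..1}" for S and x :: "real ^ 'd"
    by (rule bump_range[OF less_imp_le[OF L(1)] L(2)])
  have "0 \<le> \<kappa>"
    unfolding \<kappa>_def using L(1) by (intro divide_nonneg_nonneg add_nonneg_nonneg zero_le_power) auto
  have sets_\<Pi>: "sets (?\<Pi> S) = sets (PiM {1..n} (\<lambda>_. obs_space))" for S
    by (intro sets_PiM_cong refl) simp
  have fg: "(\<lambda>D. f D g) \<in> borel_measurable (PiM {1..n} (\<lambda>_. obs_space))" if "g \<in> ?G" for g
    using measurable_compose[OF measurable_Pair2' f, of g] that grid_subset_cbox[of m]
    by (auto simp: space_restrict_space)
  have in_class: "(?P S, bump L m S) \<in> lipschitz_class L" for S
    by (rule bump_law_in_lipschitz_class[OF m L])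
  \<comment> \<open>As X is uniform on the grid, the risk is the average of the pointwise risks, one
    for each coordinate of the hypercube.\<close>
  have risk: "quadratic_risk n f (?P S) (bump L m S) = ennreal (1 / N) * (\<Sum>g\<in>?G. R S g)" for S
  proof -
    have "(\<integral>\<^sup>+z. ennreal ((bump L m S (fst z) - f D (fst z))\<^sup>2) \<partial>?P S) =
        ennreal (1 / N) * (\<Sum>g\<in>?G. ennreal ((bump L m S g - f D g)\<^sup>2))" if D: "D \<in> space (?\<Pi> S)" for D
    proof -
      have D': "D \<in> space (PiM {1..n} (\<lambda>_. obs_space))"
        using D sets_eq_imp_space_eq[OF sets_\<Pi>] by simp
      have fst: "fst \<in> obs_space \<rightarrow>\<^sub>M restrict_space borel (cbox 0 (1 :: real ^ 'd))"
        by (rule measurable_restrict_space2) (auto simp: space_obs_space)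
      have [measurable]: "(\<lambda>z. f D (fst z)) \<in> borel_measurable obs_space"
        using measurable_compose[OF fst measurable_compose[OF measurable_Pair1'[OF D'] f]] by simp
      have [measurable]: "(\<lambda>z. bump L m S (fst z)) \<in> borel_measurable obs_space"
        by (rule measurable_compose_continuous_on_cbox[OF lipschitz_on_continuous_on[OF bump_lipschitz[OF less_imp_le[OF L(1)]]] measurable_obs_fst])
          (auto simp: space_obs_space)
      have w: "0 \<le> bernoulli_weight ?G (bump L m S) z" for z
        using range[of S "fst z"] by (simp add: bernoulli_weight_def)
      have "(\<integral>\<^sup>+z. ennreal ((bump L m S (fst z) - f D (fst z))\<^sup>2) \<partial>?P S) =
          (\<Sum>z\<in>?G \<times> {0, 1}. ennreal (bernoulli_weight ?G (bump L m S) z) * ennreal ((bump L m S (fst z) - f D (fst z))\<^sup>2))"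
        by (rule nn_integral_bernoulli_law[OF finite_grid grid_subset_cbox]) measurable
      also have "\<dots> = ennreal (\<Sum>z\<in>?G \<times> {0, 1}. bernoulli_weight ?G (bump L m S) z * (bump L m S (fst z) - f D (fst z))\<^sup>2)"
        using w by (simp add: ennreal_mult'[symmetric])
      also have "\<dots> = ennreal ((\<Sum>g\<in>?G. (bump L m S g - f D g)\<^sup>2) / N)"
        using sum_bernoulli_weight[of ?G "bump L m S" "\<lambda>x. (bump L m S x - f D x)\<^sup>2"] by (simp add: N_def)
      also have "\<dots> = ennreal (1 / N) * (\<Sum>g\<in>?G. ennreal ((bump L m S g - f D g)\<^sup>2))"
        by (simp add: ennreal_mult'[symmetric] sum_nonneg)
      finally show ?thesis .
    qed
    then have "quadratic_risk n f (?P S) (bump L m S) =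
        (\<integral>\<^sup>+D. ennreal (1 / N) * (\<Sum>g\<in>?G. ennreal ((bump L m S g - f D g)\<^sup>2)) \<partial>?\<Pi> S)"
      unfolding quadratic_risk_def by (intro nn_integral_cong)
    also have "\<dots> = ennreal (1 / N) * (\<Sum>g\<in>?G. R S g)"
    proof -
      have m: "(\<lambda>D. ennreal ((bump L m S g - f D g)\<^sup>2)) \<in> borel_measurable (?\<Pi> S)" if "g \<in> ?G" for g
      proof -
        have [measurable]: "(\<lambda>D. f D g) \<in> borel_measurable (?\<Pi> S)"
          unfolding measurable_cong_sets[OF sets_\<Pi> refl] by (rule fg[OF that])
        show ?thesis by measurable
      qed
      have "(\<integral>\<^sup>+D. ennreal (1 / N) * (\<Sum>g\<in>?G. ennreal ((bump L m S g - f D g)\<^sup>2)) \<partial>?\<Pi> S) =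
          ennreal (1 / N) * (\<integral>\<^sup>+D. (\<Sum>g\<in>?G. ennreal ((bump L m S g - f D g)\<^sup>2)) \<partial>?\<Pi> S)"
        by (rule nn_integral_cmult) (intro borel_measurable_sum m)
      also have "(\<integral>\<^sup>+D. (\<Sum>g\<in>?G. ennreal ((bump L m S g - f D g)\<^sup>2)) \<partial>?\<Pi> S) = (\<Sum>g\<in>?G. R S g)"
        unfolding R_def by (rule nn_integral_sum) (rule m)
      finally show ?thesis .
    qed
    finally show ?thesis .
  qed
  have le_W: "(\<Sum>g\<in>?G. R S g) \<le> of_nat N * ?W" for S
  proof -
    have "of_nat N * (ennreal (1 / N) * (\<Sum>g\<in>?G. R S g)) \<le> of_nat N * ?W"
      unfolding risk[symmetric] by (intro mult_left_mono SUP_upper2[OF in_class[of S]]) auto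
    moreover have "of_nat N * ennreal (1 / N) = 1"
      using N(2) by (simp add: ennreal_of_nat_eq_real_of_nat ennreal_mult'[symmetric])
    ultimately show ?thesis by (simp add: mult.assoc[symmetric])
  qed
  have pair: "ennreal \<kappa> \<le> R S g + R (insert g S) g" if "g \<in> ?G" "S \<in> Pow (?G - {g})" for S g
    unfolding R_def \<kappa>_def using that by (intro assouad_pair_risk_ge[OF m L] fg) auto
  \<comment> \<open>There are N * 2^(N - 1) pairs of neighbouring hypotheses but 2^N hypotheses,
    each with summed risk at most N times the supremum. The quotient costs the factor 1 / 2.\<close>
  have "of_nat (N * 2 ^ (N - 1)) * ennreal \<kappa> = (\<Sum>g\<in>?G. \<Sum>S\<in>Pow (?G - {g}). ennreal \<kappa>)"
  proof -
    have "(\<Sum>g\<in>?G. \<Sum>S\<in>Pow (?G - {g}). ennreal \<kappa>) = (\<Sum>g\<in>?G. of_nat (2 ^ (N - 1)) * ennreal \<kappa>)"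
      using finite_grid[of m, where 'd='d] by (intro sum.cong refl) (simp add: card_Pow N_def)
    then show ?thesis by (simp add: N_def mult.assoc)
  qed
  also have "\<dots> \<le> (\<Sum>g\<in>?G. \<Sum>S\<in>Pow (?G - {g}). R S g + R (insert g S) g)"
    by (intro sum_mono pair)
  also have "\<dots> = (\<Sum>g\<in>?G. \<Sum>S\<in>Pow ?G. R S g)"
    by (intro sum.cong refl sum_Pow_remove[symmetric] finite_grid)
  also have "\<dots> = (\<Sum>S\<in>Pow ?G. \<Sum>g\<in>?G. R S g)"
    by (rule sum.swap)
  also have "\<dots> \<le> (\<Sum>S\<in>Pow ?G. of_nat N * ?W)"
    by (intro sum_mono le_W)
  also have "\<dots> = of_nat (2 ^ N * N) * ?W"
    using finite_grid[of m, where 'd='d] by (simp add: card_Pow N_def mult.assoc)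
  finally have le: "of_nat (N * 2 ^ (N - 1)) * ennreal \<kappa> \<le> of_nat (2 ^ N * N) * ?W" .
  have "ennreal (\<kappa> / 2) \<le> ?W"
  proof (cases ?W)
    case (real w)
    have "real (N * 2 ^ (N - 1)) * \<kappa> \<le> real (2 ^ N * N) * w"
      using le real \<open>0 \<le> \<kappa>\<close> by (simp add: ennreal_of_nat_eq_real_of_nat ennreal_mult'[symmetric])
    also have "2 ^ N = 2 * (2 :: nat) ^ (N - 1)"
      using N(2) by (cases N) auto
    finally have "\<kappa> / 2 \<le> w"
      using N(2) by (simp add: field_simps)
    then show ?thesis using real by (simp add: ennreal_leI)
  next
    case top
    show ?thesis unfolding top by (rule top_greatest)
  qed
  then show "ennreal ((L / m)\<^sup>2 / (2 * (1 + (1 + 4 * (L / m)\<^sup>2 / real m ^ CARD('d)) ^ n))) \<le> ?W"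
    by (simp add: \<kappa>_def mult.commute)
qed


text \<open>Rounding N = n powr (1 / (d + 2)) up to m gives n \<le> m^(d + 2), so the n-th power of
  the second moment is at most exp (4 L^2 n / m^(d + 2)) \<le> exp (4 L^2). From m \<le> 2 N the gap
  L / m is at least L / (2 N), and 8 is 2 times the square of this 2. The condition
  \<open>large\<close> gives L / m \<le> 1 / 2, which keeps the tents below 1.\<close>

lemma minimax_risk_rate_ge:
  assumes L: "0 < L" and n: "n \<ge> 1" and large: "2 * L \<le> real n powr (1 / (real CARD('d) + 2))"
  shows "ennreal (L\<^sup>2 / (8 * (1 + exp (4 * L\<^sup>2))) * real n powr (- 2 / (real CARD('d) + 2))) \<le>
    minimax_risk TYPE('d::finite) L n"
proof -
  let ?d = "CARD('d)"
  define N where "N = real n powr (1 / (real ?d + 2))"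
  define m where "m = nat \<lceil>N\<rceil>"
  note N = powr_rate[OF n, of ?d, folded N_def]
  have m: "N \<le> m" "m \<le> 2 * N" "m \<ge> 1"
    using N(1) by (auto simp: m_def) linarith+
  have Lm: "L / m \<le> 1 / 2"
    using large m N(1) unfolding N_def[symmetric] by (simp add: field_simps)
  have "(1 + 4 * (L / m)\<^sup>2 / real m ^ ?d) ^ n \<le> exp (4 * (L / m)\<^sup>2 / real m ^ ?d) ^ n"
    by (intro power_mono exp_ge_add_one_self) auto
  also have "\<dots> = exp (4 * L\<^sup>2 * (n / real m ^ (?d + 2)))"
    by (simp add: exp_of_nat_mult[symmetric] power_add power_divide mult_ac power2_eq_square)
  also have "\<dots> \<le> exp (4 * L\<^sup>2 * 1)"
  proof -
    have "real n \<le> real m ^ (?d + 2)"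
      unfolding N(2) using m(1) N(1) by (intro power_mono) auto
    then have "real n / real m ^ (?d + 2) \<le> 1"
      using m(3) by (intro divide_le_eq_1_pos[THEN iffD2]) auto
    then show ?thesis by (simp only: exp_le_cancel_iff) (intro mult_left_mono; simp)
  qed
  finally have B: "(1 + 4 * (L / m)\<^sup>2 / real m ^ ?d) ^ n \<le> exp (4 * L\<^sup>2)" by simp
  have "L\<^sup>2 / (8 * (1 + exp (4 * L\<^sup>2))) * real n powr (- 2 / (real ?d + 2)) = (L / (2 * N))\<^sup>2 / (2 * (1 + exp (4 * L\<^sup>2)))"
    unfolding N(3) by (simp add: power_divide power_mult_distrib)
  also have "\<dots> \<le> (L / m)\<^sup>2 / (2 * (1 + (1 + 4 * (L / m)\<^sup>2 / real m ^ ?d) ^ n))"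
  proof (rule frac_le)
    show "(L / (2 * N))\<^sup>2 \<le> (L / m)\<^sup>2"
      using m L N(1) by (intro power_mono divide_left_mono) auto
    show "0 < 2 * (1 + (1 + 4 * (L / m)\<^sup>2 / real m ^ ?d) ^ n)"
      by (intro mult_pos_pos add_pos_nonneg zero_le_power) auto
  qed (use B in auto)
  finally show ?thesis
    using minimax_risk_ge[OF m(3) L Lm, where n=n and 'd='d] by (meson ennreal_leI order_trans)
qed

theorem theorem2:
  fixes M :: "'w measure"
    and X :: "'w \<Rightarrow> real ^ 'd::finite" and Y :: "'w \<Rightarrow> real"
    and XS :: "nat \<Rightarrow> 'w \<Rightarrow> real ^ 'd" and YS :: "nat \<Rightarrow> 'w \<Rightarrow> real"
    and \<eta> :: "real ^ 'd \<Rightarrow> real"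
    and K :: nat and lam :: "nat \<Rightarrow> real" and c C :: real
    and T :: "nat \<Rightarrow> nat \<Rightarrow> 'w \<Rightarrow> 'd mtree"
  assumes "prob_space M"
    and "(\<lambda>\<omega>. (X \<omega>, Y \<omega>)) \<in> M \<rightarrow>\<^sub>M obs_space"
    and "cond_prob_function M X Y \<eta>"
    and "\<exists>L. L-lipschitz_on (cbox 0 1) \<eta>"
    and "\<And>i. i \<ge> 1 \<Longrightarrow> (\<lambda>\<omega>. (XS i \<omega>, YS i \<omega>)) \<in> M \<rightarrow>\<^sub>M obs_space"
    and "\<And>i. i \<ge> 1 \<Longrightarrow> distr M obs_space (\<lambda>\<omega>. (XS i \<omega>, YS i \<omega>)) =
                        distr M obs_space (\<lambda>\<omega>. (X \<omega>, Y \<omega>))"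
    and "lam 0 = 0" and "\<And>n. n \<ge> 1 \<Longrightarrow> lam n > 0" and "mono lam"
    and "0 < c" and "c \<le> C"
    and "\<And>n. n \<ge> 1 \<Longrightarrow> c * real n powr (1 / (real CARD('d) + 2)) \<le> lam n \<and>
                        lam n \<le> C * real n powr (1 / (real CARD('d) + 2))"
    and "K \<ge> 1"
    and "\<And>k. k \<in> {1..K} \<Longrightarrow> mondrian_tree_process M lam (T k)"
    and "mutually_independent M (\<lambda>\<omega>. (X \<omega>, Y \<omega>)) (\<lambda>i \<omega>. (XS i \<omega>, YS i \<omega>)) K T"
  shows "(\<lambda>n. \<integral>\<omega>. (\<eta> (X \<omega>) - forest_estimate (\<lambda>i. (XS i \<omega>, YS i \<omega>)) n K
                                  (\<lambda>k. T k n \<omega>) (X \<omega>))\<^sup>2 \<partial>M)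
           \<in> O(\<lambda>n. real n powr (- 2 / (real CARD('d) + 2)))
       \<and> (\<forall>L>0. (\<lambda>n. enn2real (minimax_risk TYPE('d) L n))
                  \<in> \<Theta>(\<lambda>n. real n powr (- 2 / (real CARD('d) + 2))))"
proof (intro conjI allI impI)
  let ?rate = "\<lambda>n. real n powr (- 2 / (real CARD('d) + 2))"
  let ?risk = "\<lambda>n. \<integral>\<omega>. (\<eta> (X \<omega>) - forest_estimate (\<lambda>i. (XS i \<omega>, YS i \<omega>)) n K
      (\<lambda>k. T k n \<omega>) (X \<omega>))\<^sup>2 \<partial>M"
  obtain L where L: "L-lipschitz_on (cbox 0 1) \<eta>" using assms(4) by blast
  let ?c = "\<lambda>L :: real. 4 * (1 + C) ^ CARD('d) + 36 * L\<^sup>2 * real CARD('d) / c\<^sup>2"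
  have bound: "4 * (1 + lam n) ^ CARD('d) / real n + 36 * L\<^sup>2 * real CARD('d) / (lam n)\<^sup>2 \<le> ?c L * ?rate n"
    if "n \<ge> 1" for n :: nat and L :: real
    by (rule rate_bound) (use assms(10,12) that in auto)
  show "?risk \<in> O(?rate)"
  proof (rule bigoI[of _ "?c L"], rule eventually_mono[OF eventually_ge_at_top[of 1]])
    fix n :: nat assume n: "1 \<le> n"
    have "?risk n \<le> ?c L * ?rate n"
      using mondrian_forest_risk_le[OF assms(1,2,3) L assms(5,6,13,14,15) n assms(8)[OF n]] bound[OF n]
      by (rule order_trans)
    then show "norm (?risk n) \<le> ?c L * norm (?rate n)"
      by simp
  qed
  fix L :: real assume L: "0 < L"
  \<comment> \<open>The first tree of the forest witnesses that \<open>MP (lam n) (0, 1)\<close> is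
    a probability law, as the averaging estimator requires.\<close>
  have upper: "minimax_risk TYPE('d) L n \<le> ennreal (?c L * ?rate n)" if n: "n \<ge> 1" for n
  proof -
    interpret prob_space M by (rule assms(1))
    have T: "mondrian_tree_process M lam (T 1)" using assms(13,14) by simp
    have "prob_space (distr M mtree_space (T 1 n))"
      using T by (intro prob_space_distr) (simp add: mondrian_tree_process_def)
    then have "prob_space (MP (lam n) (0, 1 :: real ^ 'd))"
      using T n by (simp add: mondrian_tree_process_def)
    from minimax_risk_le[OF this assms(8)[OF n] n] bound[OF n] show ?thesis
      by (blast intro: order_trans ennreal_leI)
  qed
  show "(\<lambda>n. enn2real (minimax_risk TYPE('d) L n)) \<in> \<Theta>(?rate)"
  proof (rule bigthetaI)
    have nonneg: "0 \<le> ?c L"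
      using assms(10,11) by simp
    show "(\<lambda>n. enn2real (minimax_risk TYPE('d) L n)) \<in> O(?rate)"
    proof (rule bigoI[of _ "?c L"], rule eventually_mono[OF eventually_ge_at_top[of 1]])
      fix n :: nat assume "1 \<le> n"
      from enn2real_leI[OF _ upper[OF this]] show "norm (enn2real (minimax_risk TYPE('d) L n)) \<le> ?c L * norm (?rate n)"
        using nonneg by simp
    qed
    let ?e = "L\<^sup>2 / (8 * (1 + exp (4 * L\<^sup>2)))"
    have e: "0 < ?e" using L by (intro divide_pos_pos mult_pos_pos add_pos_pos) auto
    show "(\<lambda>n. enn2real (minimax_risk TYPE('d) L n)) \<in> \<Omega>(?rate)"
    proof (rule landau_omega.bigI[OF e])
      have "filterlim (\<lambda>n. real n powr (1 / (real CARD('d) + 2))) at_top sequentially"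
        by real_asymp
      then have "eventually (\<lambda>n. 2 * L \<le> real n powr (1 / (real CARD('d) + 2))) sequentially"
        by (simp add: filterlim_at_top)
      then show "eventually (\<lambda>n. ?e * norm (?rate n) \<le> norm (enn2real (minimax_risk TYPE('d) L n))) sequentially"
        using eventually_ge_at_top[of 1]
      proof eventually_elim
        case (elim n)
        \<comment> \<open>Since \<open>enn2real\<close> sends infinity to 0, the lower bound passes
          to the reals only after finiteness is known.\<close>
        have "minimax_risk TYPE('d) L n \<noteq> top"
          using upper[OF elim(2)] by (auto simp: top_unique)
        then have "?e * ?rate n \<le> enn2real (minimax_risk TYPE('d) L n)"
          using enn2real_mono[OF minimax_risk_rate_ge[OF L elim(2,1)]] e by (simp add: less_top)
        then show ?case by simp
      qed
    qed
  qed
qed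

end
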